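(* Let $1<p<\infty$, $1\le q<p$, let $0<s<1$, and let $\Omega$ be an open set in $\mathbb{R}^N$. Let $w_{s,p,\Omega}$ be the $(s,p)$-torsion function of $\Omega$, and let $$\lambda_{p,q}^s(\Omega)=\inf_{u\in C_0^\infty(\Omega)}\Big\{\iint_{\mathbb{R}^{2N}}\frac{|u(x)-u(y)|^p}{|x-y|^{N+sp}}\,dx\,dy\ :\ \int_\Omega|u|^q\,dx=1\Big\}.$$ Then the compactness of the embedding $\mathcal{D}_0^{s,p}(\Omega)\hookrightarrow L^q(\Omega)$ is equivalent both to the finiteness of $\|w_{s,p,\Omega}\|_{L^{\frac{p-1}{p-q}q}(\Omega)}$ and to the positivity of $\lambda_{p,q}^s(\Omega)$.
   Context: $C_0^\infty(\Omega)$ is the set of smooth functions with compact support in $\Omega$ (extended by $0$ to $\mathbb{R}^N$). For an open set $\Omega$, $\mathcal{D}_0^{s,p}(\Omega)$ is the completion of $C_0^\infty(\Omega)$ with respect to the norm $[u]_{s,p}=\Big(\iint_{\mathbb{R}^{2N}}\frac{|u(x)-u(y)|^p}{|x-y|^{N+sp}}\,dx\,dy\Big)^{1/p}$. The embedding $\mathcal{D}_0^{s,p}(\Omega)\hookrightarrow L^q(\Omega)$ is compact if the inclusion of $C_0^\infty(\Omega)$ into $L^q(\Omega)$ extends to a compact operator from $\mathcal{D}_0^{s,p}(\Omega)$ to $L^q(\Omega)$. Torsion function, compact case: if the embedding $\mathcal{D}_0^{s,p}(\Omega)\hookrightarrow L^1(\Omega)$ is compact (this is the case for bounded $\Omega$),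 elements of $\mathcal{D}_0^{s,p}(\Omega)$ are functions, extended by $0$ outside $\Omega$, and $w_{s,p,\Omega}$ is the unique solution of $$\min_{u\in\mathcal{D}_0^{s,p}(\Omega)}\Big\{\frac1p\iint_{\mathbb{R}^{2N}}\frac{|u(x)-u(y)|^p}{|x-y|^{N+sp}}\,dx\,dy-\int_\Omega u\,dx\Big\}.$$ Torsion function, general case: for an arbitrary open set $\Omega$, define $w_{s,p,\Omega}(x)=\lim_{r\to\infty}w_r(x)\in[0,\infty]$ for $x\in\Omega$, where, for $r>\inf\{\rho>0:|B_\rho(0)\cap\Omega|>0\}$, $w_r=w_{s,p,B_r(0)\cap\Omega}$ on $B_r(0)\cap\Omega$ (the torsion function of the bounded open set $B_r(0)\cap\Omega$) and $w_r=0$ elsewhere. The limit exists because $w_r$ is nondecreasing in $r$, and this definition agrees with the previous one when the embedding into $L^1(\Omega)$ is compact. *)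

theory Defs
  imports "HOL-Analysis.Analysis"
begin

text \<open>The space \<open>\<real>\<^sup>N\<close> is a type \<open>'a\<close> of class \<open>euclidean_space\<close>, with \<open>N = DIM('a)\<close>.\<close>

section \<open>Test functions\<close>

primrec Ck :: "nat \<Rightarrow> ('a::euclidean_space \<Rightarrow> real) \<Rightarrow> bool" where
  "Ck 0 f \<longleftrightarrow> continuous_on UNIV f"
| "Ck (Suc k) f \<longleftrightarrow>
     (\<forall>x. f differentiable (at x)) \<and> (\<forall>b\<in>Basis. Ck k (\<lambda>x. frechet_derivative f (at x) b))"

definition smooth :: "('a::euclidean_space \<Rightarrow> real) \<Rightarrow> bool" where
  "smooth f \<longleftrightarrow> (\<forall>k. Ck k f)"

definition C0inf :: "'a::euclidean_space set \<Rightarrow> ('a \<Rightarrow> real) set" where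
  "C0inf \<Omega> = {f. smooth f \<and> compact (closure {x. f x \<noteq> 0}) \<and> closure {x. f x \<noteq> 0} \<subseteq> \<Omega>}"

section \<open>Lebesgue and Gagliardo norms\<close>

text \<open>Power with a positive real exponent on \<open>[0,\<infinity>]\<close>.\<close>

definition epowr :: "ennreal \<Rightarrow> real \<Rightarrow> ennreal" where
  "epowr x a = (if x = \<infinity> then \<infinity> else ennreal (enn2real x powr a))"

definition Lnorm :: "real \<Rightarrow> 'a::euclidean_space set \<Rightarrow> ('a \<Rightarrow> ennreal) \<Rightarrow> ennreal" where
  "Lnorm q \<Omega> f = epowr (\<integral>\<^sup>+ x \<in> \<Omega>. epowr (f x) q \<partial>lborel) (1 / q)"

text \<open>Classes of functions modulo null sets are handled through Borel representatives;
  equality in \<open>L\<^sup>q(\<Omega>)\<close> is equality almost everywhere on \<open>\<Omega>\<close>.\<close>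

definition Lq :: "real \<Rightarrow> 'a::euclidean_space set \<Rightarrow> ('a \<Rightarrow> real) set" where
  "Lq q \<Omega> = {f. set_borel_measurable lborel \<Omega> f \<and> Lnorm q \<Omega> (\<lambda>x. ennreal \<bar>f x\<bar>) < \<infinity>}"

definition Lq_dist :: "real \<Rightarrow> 'a::euclidean_space set \<Rightarrow> ('a \<Rightarrow> real) \<Rightarrow> ('a \<Rightarrow> real) \<Rightarrow> ennreal" where
  "Lq_dist q \<Omega> f g = Lnorm q \<Omega> (\<lambda>x. ennreal \<bar>f x - g x\<bar>)"

text \<open>On the diagonal the quotient is \<open>0 / 0 = 0\<close>; the diagonal is a null set.\<close>

definition energy :: "real \<Rightarrow> real \<Rightarrow> ('a::euclidean_space \<Rightarrow> real) \<Rightarrow> ennreal" where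
  "energy s p u =
     (\<integral>\<^sup>+ (x, y). ennreal (\<bar>u x - u y\<bar> powr p / norm (x - y) powr (real DIM('a) + s * p))
        \<partial>(lborel \<Otimes>\<^sub>M lborel))"

definition gnorm :: "real \<Rightarrow> real \<Rightarrow> ('a::euclidean_space \<Rightarrow> real) \<Rightarrow> ennreal" where
  "gnorm s p u = epowr (energy s p u) (1 / p)"

section \<open>The completion of the test functions\<close>

text \<open>Points of the completion are classes of Cauchy sequences of test functions, two sequences
  being identified when the norm of their difference tends to \<open>0\<close>.  In general such a class is
  not a function.\<close>

definition cauchy_seqs ::
  "real \<Rightarrow> real \<Rightarrow> 'a::euclidean_space set \<Rightarrow> (nat \<Rightarrow> 'a \<Rightarrow> real) set" where
  "cauchy_seqs s p \<Omega> =
     {\<phi>. (\<forall>n. \<phi> n \<in> C0inf \<Omega>) \<and>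
         (\<forall>e>0. \<exists>M. \<forall>m\<ge>M. \<forall>n\<ge>M. gnorm s p (\<lambda>x. \<phi> m x - \<phi> n x) < e)}"

definition null_rel ::
  "real \<Rightarrow> real \<Rightarrow> 'a::euclidean_space set \<Rightarrow> (nat \<Rightarrow> 'a \<Rightarrow> real) rel" where
  "null_rel s p \<Omega> =
     {(\<phi>, \<psi>). \<phi> \<in> cauchy_seqs s p \<Omega> \<and> \<psi> \<in> cauchy_seqs s p \<Omega> \<and>
         (\<lambda>n. gnorm s p (\<lambda>x. \<phi> n x - \<psi> n x)) \<longlonglongrightarrow> 0}"

definition D0 ::
  "real \<Rightarrow> real \<Rightarrow> 'a::euclidean_space set \<Rightarrow> (nat \<Rightarrow> 'a \<Rightarrow> real) set set" where
  "D0 s p \<Omega> = cauchy_seqs s p \<Omega> // null_rel s p \<Omega>"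

definition D0_norm :: "real \<Rightarrow> real \<Rightarrow> (nat \<Rightarrow> 'a::euclidean_space \<Rightarrow> real) set \<Rightarrow> ennreal" where
  "D0_norm s p U = (THE l. \<forall>\<phi>\<in>U. (\<lambda>n. gnorm s p (\<phi> n)) \<longlonglongrightarrow> l)"

definition D0_embed ::
  "real \<Rightarrow> real \<Rightarrow> 'a::euclidean_space set \<Rightarrow> ('a \<Rightarrow> real) \<Rightarrow> (nat \<Rightarrow> 'a \<Rightarrow> real) set" where
  "D0_embed s p \<Omega> u = null_rel s p \<Omega> `` {\<lambda>n. u}"

definition D0_add ::
  "real \<Rightarrow> real \<Rightarrow> 'a::euclidean_space set \<Rightarrow>
     (nat \<Rightarrow> 'a \<Rightarrow> real) set \<Rightarrow> (nat \<Rightarrow> 'a \<Rightarrow> real) set \<Rightarrow> (nat \<Rightarrow> 'a \<Rightarrow> real) set" where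
  "D0_add s p \<Omega> U V = null_rel s p \<Omega> `` {(\<lambda>n x. \<phi> n x + \<psi> n x) | \<phi> \<psi>. \<phi> \<in> U \<and> \<psi> \<in> V}"

definition D0_scale ::
  "real \<Rightarrow> real \<Rightarrow> 'a::euclidean_space set \<Rightarrow>
     real \<Rightarrow> (nat \<Rightarrow> 'a \<Rightarrow> real) set \<Rightarrow> (nat \<Rightarrow> 'a \<Rightarrow> real) set" where
  "D0_scale s p \<Omega> c U = null_rel s p \<Omega> `` {(\<lambda>n x. c * \<phi> n x) | \<phi>. \<phi> \<in> U}"

section \<open>Compactness of the embedding\<close>

text \<open>A compact operator is a linear operator sending every bounded sequence to a sequence with
  a convergent subsequence; boundedness follows.\<close>

definition compact_operator ::
  "real \<Rightarrow> real \<Rightarrow> real \<Rightarrow> 'a::euclidean_space set \<Rightarrow>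
     ((nat \<Rightarrow> 'a \<Rightarrow> real) set \<Rightarrow> 'a \<Rightarrow> real) \<Rightarrow> bool" where
  "compact_operator s p q \<Omega> T \<longleftrightarrow>
     (\<forall>U \<in> D0 s p \<Omega>. T U \<in> Lq q \<Omega>) \<and>
     (\<forall>U \<in> D0 s p \<Omega>. \<forall>V \<in> D0 s p \<Omega>.
        AE x\<in>\<Omega> in lborel. T (D0_add s p \<Omega> U V) x = T U x + T V x) \<and>
     (\<forall>c. \<forall>U \<in> D0 s p \<Omega>.
        AE x\<in>\<Omega> in lborel. T (D0_scale s p \<Omega> c U) x = c * T U x) \<and>
     (\<forall>U. (\<forall>n. U n \<in> D0 s p \<Omega>) \<and> (\<exists>C<\<infinity>. \<forall>n. D0_norm s p (U n) \<le> C) \<longrightarrow>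
        (\<exists>k f. strict_mono (k :: nat \<Rightarrow> nat) \<and> f \<in> Lq q \<Omega> \<and>
           (\<lambda>n. Lq_dist q \<Omega> (T (U (k n))) f) \<longlonglongrightarrow> 0))"

definition compact_embedding :: "real \<Rightarrow> real \<Rightarrow> real \<Rightarrow> 'a::euclidean_space set \<Rightarrow> bool" where
  "compact_embedding s p q \<Omega> \<longleftrightarrow>
     (\<exists>T. compact_operator s p q \<Omega> T \<and>
        (\<forall>u \<in> C0inf \<Omega>. AE x\<in>\<Omega> in lborel. T (D0_embed s p \<Omega> u) x = u x))"

section \<open>Torsion functions\<close>

text \<open>When the completion embeds continuously into \<open>L\<^sup>1(\<Omega>)\<close>, the function attached to
  a class is the common \<open>L\<^sup>1\<close> limit of its Cauchy sequences.  It is extended by \<open>0\<close>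
  outside \<open>\<Omega>\<close>.\<close>

definition D0_fun ::
  "real \<Rightarrow> real \<Rightarrow> 'a::euclidean_space set \<Rightarrow> ('a \<Rightarrow> real) set" where
  "D0_fun s p \<Omega> =
     {u. u \<in> borel_measurable lborel \<and> (\<forall>x. x \<notin> \<Omega> \<longrightarrow> u x = 0) \<and>
         (\<exists>U \<in> D0 s p \<Omega>. \<forall>\<phi>\<in>U. (\<lambda>n. Lq_dist 1 \<Omega> (\<phi> n) u) \<longlonglongrightarrow> 0)}"

text \<open>By Fatou's lemma the energy is finite on \<open>D0_fun\<close>, so \<open>enn2real\<close> is harmless.\<close>

definition torsion_functional ::
  "real \<Rightarrow> real \<Rightarrow> 'a::euclidean_space set \<Rightarrow> ('a \<Rightarrow> real) \<Rightarrow> real" where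
  "torsion_functional s p \<Omega> u = 1 / p * enn2real (energy s p u) - (LINT x:\<Omega>|lborel. u x)"

definition compact_torsion ::
  "real \<Rightarrow> real \<Rightarrow> 'a::euclidean_space set \<Rightarrow> ('a \<Rightarrow> real) \<Rightarrow> bool" where
  "compact_torsion s p \<Omega> w \<longleftrightarrow>
     w \<in> D0_fun s p \<Omega> \<and>
     (\<forall>v \<in> D0_fun s p \<Omega>. torsion_functional s p \<Omega> w \<le> torsion_functional s p \<Omega> v)"

text \<open>Torsion functions are determined up to null sets only, and there are uncountably many radii,
  so the pointwise limit is taken along suitable representatives \<open>wr r\<close>; by monotonicity
  in \<open>r\<close> the class of the limit does not depend on them.  If \<open>ball 0 r \<inter> \<Omega>\<close> is empty, the only
  admissible \<open>wr r\<close> is \<open>0\<close>, so small radii need no separate treatment.\<close>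

definition torsion_function ::
  "real \<Rightarrow> real \<Rightarrow> 'a::euclidean_space set \<Rightarrow> ('a \<Rightarrow> ennreal) \<Rightarrow> bool" where
  "torsion_function s p \<Omega> w \<longleftrightarrow>
     w \<in> borel_measurable (restrict_space lborel \<Omega>) \<and>
     (\<exists>wr :: real \<Rightarrow> 'a \<Rightarrow> real.
        (\<forall>r>0. compact_torsion s p (ball 0 r \<inter> \<Omega>) (wr r)) \<and>
        (AE x\<in>\<Omega> in lborel. ((\<lambda>r. ennreal (wr r x)) \<longlongrightarrow> w x) at_top))"

section \<open>The Poincare--Sobolev constant\<close>

definition lambda_pq :: "real \<Rightarrow> real \<Rightarrow> real \<Rightarrow> 'a::euclidean_space set \<Rightarrow> ennreal" where
  "lambda_pq s p q \<Omega> =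
     (INF u \<in> {u \<in> C0inf \<Omega>. (LINT x:\<Omega>|lborel. \<bar>u x\<bar> powr q) = 1}. energy s p u)"

end

theory Submission
  imports Defs "HOL-Library.Diagonal_Subsequence"
begin

text \<open>
  The three properties are proved in a cycle: compactness implies that the constant \<open>\<lambda>\<close> is positive, this
  implies that the power of the torsion function \<open>w\<close> is integrable, and this implies compactness.  The
  exponent is \<open>\<gamma> = (p - 1) / (p - q) * q\<close> throughout.

  The first implication is soft: if \<open>\<lambda>\<close> were \<open>0\<close>, there would be test functions of energy at most \<open>1\<close> with
  arbitrarily large \<open>L\<^sup>q\<close> norm (\<open>lambda_pos_of_compact_embedding\<close>).

  The other two rest on comparing the torsion function of a bounded piece of \<open>\<Omega>\<close>, a minimizer, with explicit
  competitors.  For \<open>\<lambda> > 0\<close> the competitor is \<open>w - \<epsilon> * min w k powr \<gamma>\<close>.  It loses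
  at least a multiple of the energy of \<open>min w k powr (\<gamma> / q)\<close>, to which the Poincare-Sobolev inequality applies,
  and the exponents match so that \<open>(\<integral> min w k powr \<gamma>) powr (p / q)\<close> is bounded by a multiple of
  \<open>\<integral> min w k powr \<gamma>\<close>.  As \<open>q < p\<close>, this bounds the integral, uniformly in the piece and in \<open>k\<close>
  (\<open>torsion_truncated_bound\<close>).

  For the last implication the competitor is the \<open>p\<close>-norm of the pair \<open>(w, c * u)\<close> with a test function \<open>u\<close>.  By
  the triangle inequality for this norm its energy is at most that of \<open>w\<close> plus \<open>c powr p\<close> times that of \<open>u\<close>
  (\<open>torsion_lp_competitor\<close>).  Letting \<open>c\<close> tend to \<open>0\<close> yields the Hardy inequality
  \<open>\<integral> \<bar>u\<bar> powr p / w powr (p - 1) \<le> energy s p u\<close> (\<open>torsion_hardy\<close>), and with Young's inequality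
  \<open>\<integral> \<bar>u\<bar> powr q \<le> a * energy s p u + C a * \<integral> w powr \<gamma>\<close> with both integrals over any measurable set, for every \<open>a > 0\<close>
  (\<open>integral_power_le_energy_add_torsion\<close>).  If the last integral is finite, this shows that the inclusion of the test
  functions into \<open>L\<^sup>q\<close> is continuous and that bounded sets are tight.  On balls, functions of bounded energy are close in
  \<open>L\<^sup>p\<close> to their averages over small balls (\<open>local_bound_by_averages\<close>), so compactness reduces to that of bounded
  sets of finitely many numbers (\<open>compact_embedding_of_bounds\<close>).

  Two tools make the competitors admissible.  The minimum over the completion is not beaten by
  continuous functions with compact support, since mollification does not increase the energy
  (\<open>mollify\<close>, \<open>torsion_minimal\<close>), and \<open>w\<close> is the limit in \<open>L\<^sup>1\<close> and in energy of test functions, to which the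
  nonlinear operations are applied (\<open>D0_fun_approx\<close>).
\<close>

section \<open>Inequalities between powers\<close>

text \<open>Convexity, in the form used below for derivatives, increments and Jensen's inequality alike.  The
  endpoints are included; at \<open>a = 0\<close> the default value \<open>0 powr c = 0\<close> makes the left-hand side vanish.\<close>

lemma powr_tangent:
  fixes a b r :: real
  assumes "0 \<le> a" "0 \<le> b" "1 \<le> r"
  shows "r * a powr (r - 1) * (b - a) \<le> b powr r - a powr r"
proof -
  consider "a = 0" | "a > 0" "b = 0" | "a > 0" "b > 0" using assms by linarith
  then show ?thesis
  proof cases
    case 1
    then show ?thesis using assms by auto
  next
    case 2
    have "a powr r = a powr (r - 1) * a"
      using 2 by (metis powr_mult_base less_imp_le add.commute diff_add_cancel mult.commute)
    moreover have "a powr (r - 1) * a \<le> r * (a powr (r - 1) * a)"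
      using assms by (intro mult_right_mono[of 1 r, simplified]) auto
    ultimately show ?thesis using 2 assms by (simp add: algebra_simps)
  next
    case 3
    have "r * a powr (r - 1) * (b - a) \<le> b powr r - a powr r"
    proof (rule convex_on_imp_above_tangent[of "{0<..}" "\<lambda>x. x powr r"])
      show "convex_on {0<..} (\<lambda>x. x powr r)" using powr_convex assms by blast
      show "connected {0::real<..}" by simp
      show "a \<in> interior {0<..}" using 3 by (simp add: interior_open)
      show "b \<in> {0<..}" using 3 by simp
      show "((\<lambda>x. x powr r) has_real_derivative r * a powr (r - 1)) (at a within {0<..})"
        using 3 by (auto intro: DERIV_subset[OF has_real_derivative_powr])
    qed
    then show ?thesis .
  qed
qed

text \<open>Convexity of the power at the weights \<open>A\<close>, \<open>B\<close>.  Integrated with \<open>A\<close>, \<open>B\<close> the two norms it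
  is Minkowski's inequality, so that it serves for integrals and for pairs of numbers alike.\<close>

lemma powr_add_weighted:
  fixes a b A B p :: real
  assumes "0 \<le> a" "0 \<le> b" "0 < A" "0 < B" "1 \<le> p"
  shows "(a + b) powr p \<le> (A + B) powr (p - 1) * (a powr p * A powr (1 - p) + b powr p * B powr (1 - p))"
proof -
  define m where "m = (a + b) / (A + B)"
  have m0: "0 \<le> m" using assms by (simp add: m_def)
  have 1: "p * m powr (p - 1) * (a / A - m) \<le> (a / A) powr p - m powr p"
    using powr_tangent[of m "a/A" p] m0 assms by simp
  have 2: "p * m powr (p - 1) * (b / B - m) \<le> (b / B) powr p - m powr p"
    using powr_tangent[of m "b/B" p] m0 assms by simp
  have "A * (p * m powr (p - 1) * (a / A - m)) + B * (p * m powr (p - 1) * (b / B - m))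
      = p * m powr (p - 1) * (A * (a / A - m) + B * (b / B - m))" by (simp add: algebra_simps)
  also have "A * (a / A - m) + B * (b / B - m) = 0"
  proof -
    have "A * (a / A - m) + B * (b / B - m) = a + b - (A + B) * m"
      using assms by (simp add: algebra_simps)
    then show ?thesis using assms by (simp add: m_def)
  qed
  finally have 3: "(A + B) * m powr p \<le> A * (a / A) powr p + B * (b / B) powr p"
    using mult_left_mono[OF 1, of A] mult_left_mono[OF 2, of B] assms by (simp add: algebra_simps)
  have e: "c * (x / c) powr p = x powr p * c powr (1 - p)" if "0 < c" "0 \<le> x" for c x :: real
    using that by (simp add: powr_divide powr_diff)
  have "(a + b) powr p = (A + B) powr (p - 1) * ((A + B) * m powr p)"
  proof -
    have "(A + B) * m powr p = (a + b) powr p * (A + B) powr (1 - p)"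
      unfolding m_def using e[of "A + B" "a + b"] assms by simp
    moreover have "(A + B) powr (p - 1) * (A + B) powr (1 - p) = 1"
      using assms by (simp flip: powr_add)
    ultimately show ?thesis by (simp add: algebra_simps)
  qed
  also have "\<dots> \<le> (A + B) powr (p - 1) * (A * (a / A) powr p + B * (b / B) powr p)"
    using 3 by (intro mult_left_mono) auto
  finally show ?thesis using e assms by simp
qed

lemma lp_pair_triangle:
  fixes a b c d p :: real
  assumes "0 \<le> a" "0 \<le> b" "0 \<le> c" "0 \<le> d" "1 \<le> p"
  shows "((a + b) powr p + (c + d) powr p) powr (1/p)
       \<le> (a powr p + c powr p) powr (1/p) + (b powr p + d powr p) powr (1/p)"
proof -
  define A where "A = (a powr p + c powr p) powr (1/p)"
  define B where "B = (b powr p + d powr p) powr (1/p)"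
  have Ap: "A powr p = a powr p + c powr p" and Bp: "B powr p = b powr p + d powr p"
    using assms by (auto simp: A_def B_def powr_powr)
  have root: "(x powr p) powr (1/p) = x" if "0 \<le> x" for x :: real
    using that assms by (simp add: powr_powr)
  show ?thesis
  proof (cases "A = 0 \<or> B = 0")
    case True
    then show ?thesis
    proof
      assume A: "A = 0"
      then have "a powr p + c powr p = 0" using Ap assms by simp
      then have "a powr p = 0 \<and> c powr p = 0" by (smt (verit) powr_ge_zero)
      then show ?thesis by simp
    next
      assume B: "B = 0"
      then have "b powr p + d powr p = 0" using Bp assms by simp
      then have "b powr p = 0 \<and> d powr p = 0" by (smt (verit) powr_ge_zero)
      then show ?thesis by simp
    qed
  next
    case False
    then have AB: "0 < A" "0 < B" by (auto simp: A_def B_def)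
    have "(a + b) powr p + (c + d) powr p
        \<le> (A + B) powr (p - 1) * (A powr p * A powr (1 - p) + B powr p * B powr (1 - p))"
      using powr_add_weighted[of a b A B p] powr_add_weighted[of c d A B p] AB assms
      unfolding Ap Bp by (simp add: algebra_simps)
    also have "\<dots> = (A + B) powr p"
      using AB by (simp flip: powr_add) (simp add: powr_diff)
    finally have "((a + b) powr p + (c + d) powr p) powr (1/p) \<le> ((A + B) powr p) powr (1/p)"
      using assms by (intro powr_mono2) auto
    then show ?thesis using root[of "A + B"] AB by (simp add: A_def B_def)
  qed
qed

text \<open>The \<open>p\<close>-norm of a pair is \<open>1\<close>-Lipschitz for the \<open>p\<close>-norm.  Applied to increments of functions, this
  is the hidden convexity of the energy: the energy of \<open>(\<bar>f\<bar>\<^sup>p + \<bar>g\<bar>\<^sup>p)\<close> to the power \<open>1/p\<close> is at most the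
  sum of the energies of \<open>f\<close> and \<open>g\<close>.\<close>

lemma lp_pair_norm_diff:
  fixes a b c d p :: real
  assumes "0 \<le> a" "0 \<le> b" "0 \<le> c" "0 \<le> d" "1 \<le> p"
  shows "\<bar>(a powr p + c powr p) powr (1/p) - (b powr p + d powr p) powr (1/p)\<bar> powr p
       \<le> \<bar>a - b\<bar> powr p + \<bar>c - d\<bar> powr p"
proof -
  have *: "(a powr p + c powr p) powr (1/p)
     \<le> (b powr p + d powr p) powr (1/p) + (\<bar>a - b\<bar> powr p + \<bar>c - d\<bar> powr p) powr (1/p)"
    if "0 \<le> a" "0 \<le> b" "0 \<le> c" "0 \<le> d" for a b c d :: real
  proof -
    have "(a powr p + c powr p) powr (1/p)
       \<le> ((b + \<bar>a - b\<bar>) powr p + (d + \<bar>c - d\<bar>) powr p) powr (1/p)"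
      using that assms by (intro powr_mono2 add_mono) auto
    also have "\<dots> \<le> (b powr p + d powr p) powr (1/p) + (\<bar>a - b\<bar> powr p + \<bar>c - d\<bar> powr p) powr (1/p)"
      using that assms by (intro lp_pair_triangle) auto
    finally show ?thesis .
  qed
  have "\<bar>(a powr p + c powr p) powr (1/p) - (b powr p + d powr p) powr (1/p)\<bar>
      \<le> (\<bar>a - b\<bar> powr p + \<bar>c - d\<bar> powr p) powr (1/p)"
    using *[of a b c d] *[of b a d c] assms by (simp add: abs_minus_commute abs_le_iff)
  then have "\<bar>(a powr p + c powr p) powr (1/p) - (b powr p + d powr p) powr (1/p)\<bar> powr p
      \<le> ((\<bar>a - b\<bar> powr p + \<bar>c - d\<bar> powr p) powr (1/p)) powr p"
    using assms by (intro powr_mono2) auto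
  then show ?thesis using assms by (simp add: powr_powr)
qed

text \<open>A split according to whether \<open>t powr q\<close> exceeds \<open>\<delta>\<close>.  Integrated over a set of finite measure, it shows
  that convergence to \<open>0\<close> in \<open>L\<^sup>p\<close> implies the same in \<open>L\<^sup>q\<close>.\<close>

lemma powr_le_add_powr:
  fixes t \<delta> p q :: real
  assumes "0 \<le> t" "0 < \<delta>" "0 < q" "q < p"
  shows "t powr q \<le> \<delta> + \<delta> powr (1 - p/q) * t powr p"
proof (cases "t powr q \<le> \<delta>")
  case True
  then show ?thesis using assms by (smt (verit) mult_nonneg_nonneg powr_ge_zero)
next
  case False
  have "t powr p = t powr q * (t powr q) powr (p/q - 1)"
    using assms by (simp add: powr_powr field_simps flip: powr_add)
  moreover have "\<delta> powr (p/q - 1) \<le> (t powr q) powr (p/q - 1)"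
    using False assms by (intro powr_mono2) auto
  ultimately have "t powr q * \<delta> powr (p/q - 1) \<le> t powr p"
    by (simp add: mult_left_mono)
  moreover have "\<delta> powr (1 - p/q) * \<delta> powr (p/q - 1) = 1" using assms by (simp flip: powr_add)
  ultimately have "t powr q \<le> \<delta> powr (1 - p/q) * t powr p"
    using mult_left_mono[of "t powr q * \<delta> powr (p/q - 1)" "t powr p" "\<delta> powr (1 - p/q)"]
    by (simp add: algebra_simps)
  then show ?thesis using assms by linarith
qed

text \<open>Young's inequality with the weight \<open>x\<close> (a value of the torsion function): one of the two
  terms on the right dominates, according to the sign of \<open>a * u powr (p - q) - x powr (p - 1)\<close>.\<close>

lemma powr_weighted_young:
  fixes u x a p q :: real
  assumes "0 \<le> u" "0 < x" "0 < a" "1 \<le> q" "q < p"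
  shows "u powr q \<le> a * (u powr p / x powr (p - 1))
           + a powr (- q / (p - q)) * x powr ((p - 1) / (p - q) * q)"
proof (cases "x powr (p - 1) \<le> a * u powr (p - q)")
  case True
  then have "u powr q * x powr (p - 1) \<le> u powr q * (a * u powr (p - q))" by (intro mult_left_mono) auto
  also have "\<dots> = a * u powr p" by (simp flip: powr_add)
  finally have "u powr q \<le> a * (u powr p / x powr (p - 1))"
    using assms by (simp add: field_simps)
  then show ?thesis by (smt (verit) mult_nonneg_nonneg powr_ge_zero)
next
  case False
  have "u powr q = (u powr (p - q)) powr (q / (p - q))"
    using assms by (simp add: powr_powr)
  also have "\<dots> \<le> (x powr (p - 1) / a) powr (q / (p - q))"
    using False assms by (intro powr_mono2) (auto simp: field_simps)
  also have "\<dots> = a powr (- q / (p - q)) * x powr ((p - 1) / (p - q) * q)"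
    using assms by (simp add: powr_divide powr_powr powr_minus field_simps)
  finally show ?thesis using assms by (smt (verit) mult_nonneg_nonneg powr_ge_zero divide_nonneg_nonneg)
qed

lemma powr_one_minus_le:
  fixes x p :: real
  assumes "0 \<le> x" "x \<le> 1" "1 \<le> p"
  shows "(1 - x) powr p \<le> 1 - x"
  using powr_mono'[of 1 p "1 - x"] assms by auto

text \<open>The inequality \<open>(1 - x) powr p \<le> 1 - x\<close>, scaled by \<open>d powr p\<close>.  It measures the energy that a competitor
  loses when the increments \<open>d\<close> are reduced to \<open>d - e\<close>.\<close>

lemma powr_diff_le_linear:
  fixes d e p :: real
  assumes "0 \<le> e" "e \<le> d" "1 \<le> p"
  shows "(d - e) powr p \<le> d powr p - e * d powr (p - 1)"
proof (cases "d = 0")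
  case True
  then show ?thesis using assms by auto
next
  case False
  then have d: "d > 0" using assms by auto
  have "(d - e) powr p = d powr p * (1 - e/d) powr p"
  proof -
    have "d - e = d * (1 - e/d)" using d by (simp add: field_simps)
    moreover have "0 \<le> 1 - e/d" using d assms by simp
    ultimately show ?thesis using d by (simp add: powr_mult)
  qed
  also have "\<dots> \<le> d powr p * (1 - e/d)"
    using powr_one_minus_le[of "e/d" p] d assms by (intro mult_left_mono) auto
  also have "\<dots> = d powr p - e * d powr (p - 1)"
    using d by (simp add: algebra_simps powr_diff)
  finally show ?thesis .
qed

text \<open>An elementary substitute for \<open>(\<integral> g' powr (1/p)) powr p \<le> (\<integral> g') * (a - b) powr (p - 1)\<close> with \<open>g t = t powr r\<close>:
  the exponent \<open>k\<close> satisfies \<open>(k - 1) * p = r - 1\<close>, so that both sides can be compared at the larger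
  endpoint \<open>a\<close>.\<close>

lemma powr_increment_bound:
  fixes a b p r k :: real
  assumes ab: "0 \<le> b" "b \<le> a" and p: "1 \<le> p" and r: "1 \<le> r" and k: "k = (r + p - 1) / p"
  shows "(a powr k - b powr k) powr p \<le> k powr p * ((a powr r - b powr r) * (a - b) powr (p - 1))"
proof (cases "a = b")
  case True then show ?thesis using p by simp
next
  case False
  then have a: "0 < a" "b < a" using ab by auto
  have k1: "1 \<le> k" using p r by (simp add: k)
  have kp: "(k - 1) * p = r - 1" using k p by (simp add: field_simps)
  have "a powr k - b powr k \<le> k * a powr (k - 1) * (a - b)"
    using powr_tangent[of a b k] ab a k1 by (simp add: algebra_simps)
  moreover have "0 \<le> a powr k - b powr k" using ab k1 by (simp add: powr_mono2)
  ultimately have "(a powr k - b powr k) powr p \<le> (k * a powr (k - 1) * (a - b)) powr p"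
    using p by (intro powr_mono2) auto
  also have "\<dots> = k powr p * (a powr (r - 1) * (a - b) powr p)"
    using k1 a kp by (simp add: powr_mult powr_powr)
  also have "(a - b) powr p = (a - b) * (a - b) powr (p - 1)"
    using a by (simp add: powr_diff)
  also have "a powr (r - 1) * ((a - b) * (a - b) powr (p - 1))
      = (a powr (r - 1) * (a - b)) * (a - b) powr (p - 1)" by simp
  also have "a powr (r - 1) * (a - b) \<le> a powr r - b powr r"
  proof -
    have "b powr r = b powr (r - 1) * b"
      using ab by (metis powr_mult_base add.commute diff_add_cancel mult.commute)
    moreover have "a powr r = a powr (r - 1) * a"
      using ab a by (metis powr_mult_base add.commute diff_add_cancel mult.commute less_imp_le)
    moreover have "b powr (r - 1) * b \<le> a powr (r - 1) * b"
      using ab r by (intro mult_right_mono powr_mono2) auto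
    ultimately show ?thesis by (simp add: algebra_simps)
  qed
  finally show ?thesis by (simp add: mult_left_mono mult_right_mono)
qed

section \<open>Powers of extended nonnegative reals\<close>

lemma epowr_ennreal: "0 \<le> r \<Longrightarrow> epowr (ennreal r) a = ennreal (r powr a)"
  by (simp add: epowr_def)

lemma epowr_abs: "epowr (ennreal \<bar>r\<bar>) a = ennreal (\<bar>r\<bar> powr a)"
  by (simp add: epowr_ennreal)

lemma epowr_0 [simp]: "epowr 0 a = 0"
  by (simp add: epowr_def)

lemma epowr_top [simp]: "epowr top a = top"
  by (simp add: epowr_def)

lemma epowr_1 [simp]: "epowr x 1 = x"
  by (cases x) (auto simp: epowr_ennreal)

lemma epowr_less_top_iff [simp]: "epowr x a < top \<longleftrightarrow> x < top"
  by (cases x) (auto simp: epowr_ennreal)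

lemma epowr_eq_top_iff [simp]: "epowr x a = top \<longleftrightarrow> x = top"
  by (cases x) (auto simp: epowr_ennreal)

lemma epowr_mono: "x \<le> y \<Longrightarrow> 0 \<le> a \<Longrightarrow> epowr x a \<le> epowr y a"
  by (cases x; cases y) (auto simp: epowr_ennreal powr_mono2 top_unique)

lemma epowr_epowr: "epowr (epowr x a) b = epowr x (a * b)"
  by (cases x) (auto simp: epowr_ennreal powr_powr)

lemma epowr_inverse_exp: "a \<noteq> 0 \<Longrightarrow> epowr (epowr x (1/a)) a = x" "a \<noteq> 0 \<Longrightarrow> epowr (epowr x a) (1/a) = x"
  by (simp_all add: epowr_epowr)

lemma epowr_mult: "epowr (ennreal c * x) a = epowr (ennreal c) a * epowr x a" if "0 < c"
proof (cases x)
  case (real r)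
  then show ?thesis using that by (simp add: epowr_ennreal powr_mult flip: ennreal_mult)
next
  case top
  then show ?thesis using that by (simp add: epowr_ennreal ennreal_mult_top)
qed

lemma epowr_le_iff: "0 < a \<Longrightarrow> epowr x a \<le> y \<longleftrightarrow> x \<le> epowr y (1/a)"
  by (metis epowr_inverse_exp epowr_mono less_imp_le less_irrefl zero_less_divide_1_iff)

lemma le_epowr_iff: "0 < a \<Longrightarrow> y \<le> epowr x a \<longleftrightarrow> epowr y (1/a) \<le> x"
  by (metis epowr_inverse_exp epowr_mono less_imp_le less_irrefl zero_less_divide_1_iff)

lemma epowr_less_iff: "0 < a \<Longrightarrow> epowr x a < y \<longleftrightarrow> x < epowr y (1/a)"
  by (meson le_epowr_iff not_le epowr_le_iff)

lemma epowr_pos_iff [simp]: "0 < epowr x a \<longleftrightarrow> 0 < x"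
  by (cases x) (auto simp: epowr_ennreal)

lemma tendsto_epowr:
  assumes "(f \<longlongrightarrow> x) F" "0 < a"
  shows "((\<lambda>n. epowr (f n) a) \<longlongrightarrow> epowr x a) F"
proof (rule order_tendstoI)
  fix y assume "y < epowr x a"
  then have "epowr y (1/a) < x" using assms(2) by (meson epowr_le_iff le_epowr_iff not_le)
  then show "eventually (\<lambda>n. y < epowr (f n) a) F"
    using order_tendstoD(1)[OF assms(1), of "epowr y (1/a)"] assms(2)
    by (rule_tac eventually_mono) (auto simp: not_le[symmetric] epowr_le_iff)
next
  fix y assume "epowr x a < y"
  then have "x < epowr y (1/a)" using assms(2) by (simp add: epowr_less_iff)
  then show "eventually (\<lambda>n. epowr (f n) a < y) F"
    using order_tendstoD(2)[OF assms(1)] assms(2) by (auto elim!: eventually_mono simp: epowr_less_iff)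
qed

lemma borel_measurable_epowr [measurable]: "0 < a \<Longrightarrow> (\<lambda>x. epowr x a) \<in> borel_measurable borel"
  by (intro borel_measurable_continuous_onI)
     (auto simp: continuous_on_def intro!: tendsto_epowr tendsto_ident_at)

section \<open>Integrals of powers\<close>

definition pint :: "'b measure \<Rightarrow> real \<Rightarrow> ('b \<Rightarrow> real) \<Rightarrow> ennreal" where
  "pint M p f = (\<integral>\<^sup>+ x. ennreal (\<bar>f x\<bar> powr p) \<partial>M)"

lemma pint_zero [simp]: "pint M p (\<lambda>x. 0) = 0"
  by (simp add: pint_def)

lemma pint_cong_AE: "AE x in M. f x = g x \<Longrightarrow> pint M p f = pint M p g"
  unfolding pint_def by (rule nn_integral_cong_AE) (auto elim!: eventually_mono)

lemma pint_mono: "0 \<le> p \<Longrightarrow> (\<And>x. \<bar>f x\<bar> \<le> \<bar>g x\<bar>) \<Longrightarrow> pint M p f \<le> pint M p g"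
  unfolding pint_def by (intro nn_integral_mono ennreal_leI powr_mono2) auto

lemma pint_minus_commute: "pint M p (\<lambda>x. f x - g x) = pint M p (\<lambda>x. g x - f x)"
  unfolding pint_def by (simp add: abs_minus_commute)

lemma pint_cmult:
  assumes [measurable]: "f \<in> borel_measurable M"
  shows "pint M p (\<lambda>x. c * f x) = ennreal (\<bar>c\<bar> powr p) * pint M p f"
  unfolding pint_def
  by (subst nn_integral_cmult[symmetric]) (auto simp: abs_mult powr_mult ennreal_mult)

lemma pint_add_weighted:
  assumes [measurable]: "f \<in> borel_measurable M" "g \<in> borel_measurable M"
    and "1 \<le> p" "0 < A" "0 < B"
  shows "pint M p (\<lambda>x. f x + g x) \<le> ennreal ((A + B) powr (p - 1))
           * (ennreal (A powr (1 - p)) * pint M p f + ennreal (B powr (1 - p)) * pint M p g)"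
proof -
  have "pint M p (\<lambda>x. f x + g x) \<le> (\<integral>\<^sup>+ x. ennreal ((A + B) powr (p - 1))
      * (ennreal (A powr (1 - p)) * ennreal (\<bar>f x\<bar> powr p) + ennreal (B powr (1 - p)) * ennreal (\<bar>g x\<bar> powr p)) \<partial>M)"
    unfolding pint_def
  proof (rule nn_integral_mono)
    fix x
    have "\<bar>f x + g x\<bar> powr p \<le> (\<bar>f x\<bar> + \<bar>g x\<bar>) powr p"
      using assms by (intro powr_mono2) auto
    also have "\<dots> \<le> (A + B) powr (p - 1) * (\<bar>f x\<bar> powr p * A powr (1 - p) + \<bar>g x\<bar> powr p * B powr (1 - p))"
      using assms by (intro powr_add_weighted) auto
    finally show "ennreal (\<bar>f x + g x\<bar> powr p) \<le> ennreal ((A + B) powr (p - 1))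
      * (ennreal (A powr (1 - p)) * ennreal (\<bar>f x\<bar> powr p) + ennreal (B powr (1 - p)) * ennreal (\<bar>g x\<bar> powr p))"
      by (simp add: ennreal_leI mult.commute flip: ennreal_mult ennreal_plus)
  qed
  also have "\<dots> = ennreal ((A + B) powr (p - 1))
           * (ennreal (A powr (1 - p)) * pint M p f + ennreal (B powr (1 - p)) * pint M p g)"
    unfolding pint_def by (simp add: nn_integral_cmult nn_integral_add)
  finally show ?thesis .
qed

lemma pint_add_le:
  assumes "f \<in> borel_measurable M" "g \<in> borel_measurable M" "1 \<le> p"
  shows "pint M p (\<lambda>x. f x + g x) \<le> ennreal (2 powr (p - 1)) * (pint M p f + pint M p g)"
  using pint_add_weighted[OF assms, of 1 1] by simp

lemma pint_eq_0_add:
  assumes [measurable]: "f \<in> borel_measurable M" "g \<in> borel_measurable M"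
    and "1 \<le> p" "pint M p g = 0"
  shows "pint M p (\<lambda>x. f x + g x) \<le> pint M p f"
proof -
  have "AE x in M. ennreal (\<bar>g x\<bar> powr p) = 0"
    using assms(4) unfolding pint_def by (subst (asm) nn_integral_0_iff_AE) auto
  then have "AE x in M. f x + g x = f x" by (auto elim!: eventually_mono)
  then show ?thesis using pint_cong_AE[where f = "\<lambda>x. f x + g x" and g = f and M = M and p = p] by simp
qed

text \<open>Minkowski's inequality is \<open>powr_add_weighted\<close> with the two norms as weights, integrated.  This needs positive
  finite norms.\<close>

lemma pint_triangle:
  assumes [measurable]: "f \<in> borel_measurable M" "g \<in> borel_measurable M"
    and p: "1 \<le> p"
  shows "epowr (pint M p (\<lambda>x. f x + g x)) (1/p) \<le> epowr (pint M p f) (1/p) + epowr (pint M p g) (1/p)"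
proof -
  consider "pint M p f = top \<or> pint M p g = top" | "pint M p f = 0" | "pint M p g = 0"
    | "0 < pint M p f" "pint M p f < top" "0 < pint M p g" "pint M p g < top"
    by (metis less_top not_gr_zero)
  then show ?thesis
  proof cases
    case 1
    then show ?thesis by auto
  next
    case 2
    then have "pint M p (\<lambda>x. f x + g x) \<le> pint M p g"
      using pint_eq_0_add[of g M f p] p by (simp add: add.commute)
    then show ?thesis using 2 p by (simp add: epowr_mono)
  next
    case 3
    then have "pint M p (\<lambda>x. f x + g x) \<le> pint M p f"
      using pint_eq_0_add[of f M g p] p by simp
    then show ?thesis using 3 p by (simp add: epowr_mono)
  next
    case 4
    then obtain F G where FG: "pint M p f = ennreal F" "0 < F" "pint M p g = ennreal G" "0 < G"
      by (metis ennreal_cases ennreal_less_zero_iff less_irrefl)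
    define A where "A = F powr (1/p)"
    define B where "B = G powr (1/p)"
    have AB: "0 < A" "0 < B" using FG by (auto simp: A_def B_def)
    have Ap: "A powr p = F" and Bp: "B powr p = G" using FG p by (auto simp: A_def B_def powr_powr)
    have "pint M p (\<lambda>x. f x + g x) \<le> ennreal ((A + B) powr (p - 1) * (A powr (1 - p) * F + B powr (1 - p) * G))"
      using pint_add_weighted[of f M g p A B] p AB FG
      by (simp flip: ennreal_mult ennreal_plus)
    also have "A powr (1 - p) * F = A"
      using AB by (subst Ap[symmetric]) (simp flip: powr_add)
    also have "B powr (1 - p) * G = B"
      using AB by (subst Bp[symmetric]) (simp flip: powr_add)
    also have "(A + B) powr (p - 1) * (A + B) = (A + B) powr p"
      using AB by (simp add: powr_diff)
    finally have "epowr (pint M p (\<lambda>x. f x + g x)) (1/p) \<le> epowr (ennreal ((A + B) powr p)) (1/p)"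
      using p by (intro epowr_mono) auto
    also have "\<dots> = ennreal A + ennreal B"
      using AB p by (simp add: epowr_ennreal powr_powr)
    finally show ?thesis using FG by (simp add: epowr_ennreal A_def B_def)
  qed
qed

lemma pint_Fatou:
  assumes [measurable]: "\<And>n. f n \<in> borel_measurable M"
    and lim: "AE x in M. (\<lambda>n. f n x) \<longlonglongrightarrow> g x" and p: "0 < p"
  shows "pint M p g \<le> liminf (\<lambda>n. pint M p (f n))"
proof -
  have "pint M p g \<le> (\<integral>\<^sup>+ x. liminf (\<lambda>n. ennreal (\<bar>f n x\<bar> powr p)) \<partial>M)"
    unfolding pint_def
  proof (rule nn_integral_mono_AE)
    show "AE x in M. ennreal (\<bar>g x\<bar> powr p) \<le> liminf (\<lambda>n. ennreal (\<bar>f n x\<bar> powr p))"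
      using lim
    proof eventually_elim
      fix x assume "(\<lambda>n. f n x) \<longlonglongrightarrow> g x"
      then have "(\<lambda>n. ennreal (\<bar>f n x\<bar> powr p)) \<longlonglongrightarrow> ennreal (\<bar>g x\<bar> powr p)"
        using p by (intro tendsto_ennrealI tendsto_powr' tendsto_rabs tendsto_const) auto
      then have "liminf (\<lambda>n. ennreal (\<bar>f n x\<bar> powr p)) = ennreal (\<bar>g x\<bar> powr p)"
        by (intro lim_imp_Liminf) auto
      then show "ennreal (\<bar>g x\<bar> powr p) \<le> liminf (\<lambda>n. ennreal (\<bar>f n x\<bar> powr p))"
        by simp
    qed
  qed
  also have "\<dots> \<le> liminf (\<lambda>n. pint M p (f n))"
    unfolding pint_def by (rule nn_integral_liminf) measurable
  finally show ?thesis .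
qed

lemma subseq_of_eventually:
  assumes "\<And>n. \<exists>N. \<forall>m\<ge>N. Q n (m::nat)"
  shows "\<exists>r. strict_mono (r::nat \<Rightarrow> nat) \<and> (\<forall>n. Q n (r n))"
proof -
  obtain N where N: "\<And>n m. N n \<le> m \<Longrightarrow> Q n m" using assms by metis
  have "\<exists>r. \<forall>n. N n \<le> r n \<and> (r n < r (Suc n))"
  proof (rule dependent_nat_choice)
    show "\<exists>x. N 0 \<le> x" by auto
  next
    fix x n show "\<exists>y. N (Suc n) \<le> y \<and> x < y"
      by (intro exI[of _ "max (N (Suc n)) (Suc x)"]) auto
  qed
  then show ?thesis using N by (metis strict_mono_Suc_iff)
qed

lemma AE_tendsto_0_of_summable_pint:
  assumes [measurable]: "\<And>n. h n \<in> borel_measurable M"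
    and p: "0 < p" and b: "\<And>n. pint M p (h n) \<le> ennreal ((1/2) ^ n)"
  shows "AE x in M. (\<lambda>n. h n x) \<longlonglongrightarrow> 0"
proof -
  have "(\<integral>\<^sup>+ x. (\<Sum>n. ennreal (\<bar>h n x\<bar> powr p)) \<partial>M) = (\<Sum>n. pint M p (h n))"
    unfolding pint_def by (rule nn_integral_suminf) measurable
  also have "\<dots> \<le> (\<Sum>n. ennreal ((1/2) ^ n))"
    by (intro suminf_le b) auto
  also have "\<dots> < \<infinity>"
    by (subst suminf_ennreal2) auto
  finally have "AE x in M. (\<Sum>n. ennreal (\<bar>h n x\<bar> powr p)) \<noteq> \<infinity>"
    by (intro nn_integral_PInf_AE) auto
  then show ?thesis
  proof eventually_elim
    fix x assume "(\<Sum>n. ennreal (\<bar>h n x\<bar> powr p)) \<noteq> \<infinity>"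
    then have "summable (\<lambda>n. \<bar>h n x\<bar> powr p)"
      by (intro summable_suminf_not_top) auto
    then have "(\<lambda>n. \<bar>h n x\<bar> powr p) \<longlonglongrightarrow> 0" by (rule summable_LIMSEQ_zero)
    then have "(\<lambda>n. (\<bar>h n x\<bar> powr p) powr (1/p)) \<longlonglongrightarrow> 0 powr (1/p)"
      using p by (intro tendsto_powr' tendsto_const) auto
    then show "(\<lambda>n. h n x) \<longlonglongrightarrow> 0"
      using p by (simp add: powr_powr tendsto_rabs_zero_iff)
  qed
qed

lemma pint_tendsto_0_AE_subseq:
  assumes [measurable]: "\<And>n. h n \<in> borel_measurable M"
    and p: "0 < p" and "(\<lambda>n. pint M p (h n)) \<longlonglongrightarrow> 0"
  shows "\<exists>r. strict_mono (r::nat \<Rightarrow> nat) \<and> (AE x in M. (\<lambda>n. h (r n) x) \<longlonglongrightarrow> 0)"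
proof -
  have "\<exists>N. \<forall>m\<ge>N. pint M p (h m) \<le> ennreal ((1/2) ^ n)" for n
    using order_tendstoD(2)[OF assms(3), of "ennreal ((1/2) ^ n)"]
    by (auto simp: eventually_sequentially intro: less_imp_le)
  from subseq_of_eventually[of "\<lambda>n m. pint M p (h m) \<le> ennreal ((1/2) ^ n)", OF this]
  obtain r where "strict_mono r" "\<And>n. pint M p (h (r n)) \<le> ennreal ((1/2) ^ n)" by auto
  then show ?thesis using AE_tendsto_0_of_summable_pint[of "\<lambda>n. h (r n)" M p] p by auto
qed

text \<open>Completeness of \<open>L\<^sup>p\<close>.  Along a subsequence whose increments decrease fast enough, even the increments
  multiplied by \<open>2 ^ n\<close> tend to \<open>0\<close> almost everywhere, so the subsequence converges there; Fatou's lemma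
  then gives convergence of the whole sequence in the mean.\<close>

lemma pint_complete:
  fixes f :: "nat \<Rightarrow> 'b \<Rightarrow> real"
  assumes [measurable]: "\<And>n. f n \<in> borel_measurable M"
    and p: "1 \<le> p"
    and cau: "\<And>e::real. e > 0 \<Longrightarrow> \<exists>N. \<forall>m\<ge>N. \<forall>n\<ge>N. pint M p (\<lambda>x. f m x - f n x) \<le> ennreal e"
  shows "\<exists>g. g \<in> borel_measurable M \<and> (\<lambda>n. pint M p (\<lambda>x. f n x - g x)) \<longlonglongrightarrow> 0"
proof -
  have "\<exists>N. \<forall>m\<ge>N. \<forall>k\<ge>m. pint M p (\<lambda>x. f k x - f m x) \<le> ennreal ((1/2) ^ n * (1/2^n) powr p)" for n
  proof -
    have "0 < (1/2) ^ n * (1/2^n::real) powr p" by simp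
    from cau[OF this] obtain N where "\<forall>m\<ge>N. \<forall>k\<ge>N. pint M p (\<lambda>x. f m x - f k x) \<le> ennreal ((1/2) ^ n * (1/2^n) powr p)"
      by blast
    then show ?thesis by (meson order_trans)
  qed
  from subseq_of_eventually[of "\<lambda>n m. \<forall>k\<ge>m. pint M p (\<lambda>x. f k x - f m x) \<le> ennreal ((1/2) ^ n * (1/2^n) powr p)", OF this]
  obtain r where r: "strict_mono r"
    and rb: "\<And>n k. k \<ge> r n \<Longrightarrow> pint M p (\<lambda>x. f k x - f (r n) x) \<le> ennreal ((1/2) ^ n * (1/2^n) powr p)"
    by auto
  \<comment> \<open>the factor \<open>2 ^ n\<close> leaves a geometric series as a majorant of the increments\<close>
  define h where "h n x = 2 ^ n * (f (r (Suc n)) x - f (r n) x)" for n x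
  have [measurable]: "h n \<in> borel_measurable M" for n unfolding h_def by measurable
  have "pint M p (h n) \<le> ennreal ((1/2) ^ n)" for n
  proof -
    have "pint M p (h n) = ennreal ((2 ^ n) powr p) * pint M p (\<lambda>x. f (r (Suc n)) x - f (r n) x)"
      unfolding h_def by (subst pint_cmult) auto
    also have "\<dots> \<le> ennreal ((2 ^ n) powr p) * ennreal ((1/2) ^ n * (1/2^n) powr p)"
      using r by (intro mult_left_mono rb) (auto simp: strict_mono_less_eq)
    also have "\<dots> = ennreal ((1/2) ^ n)"
      by (simp add: powr_divide flip: ennreal_mult)
    finally show ?thesis .
  qed
  then have "AE x in M. (\<lambda>n. h n x) \<longlonglongrightarrow> 0"
    using p by (intro AE_tendsto_0_of_summable_pint[where p = p]) auto
  then have conv: "AE x in M. convergent (\<lambda>n. f (r n) x)"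
  proof eventually_elim
    fix x assume "(\<lambda>n. h n x) \<longlonglongrightarrow> 0"
    then have "Bseq (\<lambda>n. h n x)" by (intro convergent_imp_Bseq convergentI)
    then obtain K where K: "\<And>n. \<bar>h n x\<bar> \<le> K" by (auto simp: Bseq_def)
    have "summable (\<lambda>n. f (r (Suc n)) x - f (r n) x)"
    proof (rule summable_comparison_test')
      show "summable (\<lambda>n. K * (1/2) ^ n)" by (intro summable_mult summable_geometric) auto
      fix n
      show "norm (f (r (Suc n)) x - f (r n) x) \<le> K * (1/2) ^ n"
        using K[of n] by (simp add: h_def abs_mult power_one_over pos_le_divide_eq mult.commute)
    qed
    then have "convergent (\<lambda>n. \<Sum>i<n. f (r (Suc i)) x - f (r i) x)"
      by (simp add: summable_iff_convergent)
    then have "convergent (\<lambda>n. f (r n) x - f (r 0) x)"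
      by (simp add: sum_lessThan_telescope[where f = "\<lambda>i. f (r i) x"])
    then show "convergent (\<lambda>n. f (r n) x)"
      using convergent_add[OF _ convergent_const, of "\<lambda>n. f (r n) x - f (r 0) x" "f (r 0) x"] by simp
  qed
  define g where "g x = lim (\<lambda>n. f (r n) x)" for x
  have [measurable]: "g \<in> borel_measurable M" unfolding g_def by measurable
  have lim: "AE x in M. (\<lambda>n. f (r n) x) \<longlonglongrightarrow> g x"
    using conv by eventually_elim (simp add: g_def convergent_LIMSEQ_iff)
  have "(\<lambda>n. pint M p (\<lambda>x. f n x - g x)) \<longlonglongrightarrow> 0"
  proof (rule order_tendstoI)
    fix a :: ennreal assume "0 < a"
    then obtain e :: real where e: "0 < e" "ennreal e < a"
      by (metis dense ennreal_cases ennreal_less_zero_iff infinity_ennreal_def not_less_zero order_less_imp_not_eq2 top.not_eq_extremum zero_less_iff_neq_zero)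
    obtain N where N: "\<And>m n. N \<le> m \<Longrightarrow> N \<le> n \<Longrightarrow> pint M p (\<lambda>x. f m x - f n x) \<le> ennreal e"
      using cau[OF e(1)] by blast
    have "pint M p (\<lambda>x. f n x - g x) \<le> ennreal e" if n: "N \<le> n" for n
    proof -
      have "pint M p (\<lambda>x. f n x - g x) \<le> liminf (\<lambda>k. pint M p (\<lambda>x. f n x - f (r k) x))"
        using p lim by (intro pint_Fatou) (auto elim!: eventually_mono intro!: tendsto_intros)
      also have "\<dots> \<le> limsup (\<lambda>k. pint M p (\<lambda>x. f n x - f (r k) x))"
        by (rule Liminf_le_Limsup) simp
      also have "\<dots> \<le> ennreal e"
        using N[OF n] seq_suble[OF r]
        by (intro Limsup_bounded) (auto simp: eventually_sequentially intro!: exI[of _ N] intro: order_trans)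
      finally show ?thesis .
    qed
    then show "\<forall>\<^sub>F n in sequentially. pint M p (\<lambda>x. f n x - g x) < a"
      using e(2) by (auto simp: eventually_sequentially intro: order_le_less_trans)
  qed auto
  then show ?thesis by (auto intro!: exI[of _ g])
qed

lemma nn_integral_jensen:
  fixes f :: "'b \<Rightarrow> real"
  assumes [measurable]: "f \<in> borel_measurable M"
    and f: "\<And>x. 0 \<le> f x" and M: "emeasure M (space M) = 1" and p: "1 \<le> p"
  shows "epowr (\<integral>\<^sup>+ x. ennreal (f x) \<partial>M) p \<le> (\<integral>\<^sup>+ x. ennreal (f x powr p) \<partial>M)"
proof (cases "(\<integral>\<^sup>+ x. ennreal (f x) \<partial>M)")
  case (real m)
  \<comment> \<open>integrate the tangent line at the mean value\<close>
  have "ennreal p * ennreal (m powr (p - 1)) * ennreal m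
      = (\<integral>\<^sup>+ x. ennreal p * ennreal (m powr (p - 1)) * ennreal (f x) \<partial>M)"
    using real by (simp add: nn_integral_cmult)
  also have "\<dots> \<le> (\<integral>\<^sup>+ x. ennreal (f x powr p) + ennreal ((p - 1) * m powr p) \<partial>M)"
  proof (rule nn_integral_mono)
    fix x
    have "p * m powr (p - 1) * (f x - m) \<le> f x powr p - m powr p"
      using powr_tangent[of m "f x" p] real f p by auto
    moreover have "m powr (p - 1) * m = m powr p"
      using real by (metis powr_mult_base add.commute diff_add_cancel mult.commute)
    moreover have "p * m powr (p - 1) * (f x - m) = p * m powr (p - 1) * f x - p * (m powr (p - 1) * m)"
      by (simp add: algebra_simps)
    ultimately have "p * m powr (p - 1) * f x \<le> f x powr p + (p - 1) * m powr p"
      by (simp add: left_diff_distrib)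
    then show "ennreal p * ennreal (m powr (p - 1)) * ennreal (f x)
        \<le> ennreal (f x powr p) + ennreal ((p - 1) * m powr p)"
      using f p by (simp flip: ennreal_mult ennreal_plus)
  qed
  also have "\<dots> = (\<integral>\<^sup>+ x. ennreal (f x powr p) \<partial>M) + ennreal ((p - 1) * m powr p)"
    by (simp add: nn_integral_add M)
  finally have *: "ennreal p * ennreal (m powr (p - 1)) * ennreal m
      \<le> (\<integral>\<^sup>+ x. ennreal (f x powr p) \<partial>M) + ennreal ((p - 1) * m powr p)" .
  have mp: "m powr (p - 1) * m = m powr p"
    using real by (metis powr_mult_base add.commute diff_add_cancel mult.commute)
  show ?thesis
  proof (cases "\<integral>\<^sup>+ x. ennreal (f x powr p) \<partial>M")
    case (real y)
    have "p * m powr (p - 1) * m \<le> y + (p - 1) * m powr p"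
      using * real \<open>0 \<le> m\<close> p by (simp flip: ennreal_mult ennreal_plus)
    moreover have "p * m powr (p - 1) * m = p * m powr p" using mp by simp
    ultimately have "m powr p \<le> y" by (simp add: left_diff_distrib)
    then show ?thesis
      using real \<open>0 \<le> m\<close> \<open>(\<integral>\<^sup>+ x. ennreal (f x) \<partial>M) = ennreal m\<close> by (simp add: epowr_ennreal ennreal_leI)
  qed simp
next
  case top
  have "(\<integral>\<^sup>+ x. ennreal (f x) \<partial>M) \<le> (\<integral>\<^sup>+ x. 1 + ennreal (f x powr p) \<partial>M)"
  proof (rule nn_integral_mono)
    fix x
    have "f x \<le> 1 + f x powr p"
    proof (cases "f x \<le> 1")
      case False
      then have "f x powr 1 \<le> f x powr p" using p by (intro powr_mono) auto
      then show ?thesis using False by simp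
    qed (simp add: add_increasing2)
    then show "ennreal (f x) \<le> 1 + ennreal (f x powr p)"
      by (metis ennreal_1 ennreal_leI ennreal_plus powr_ge_zero zero_le_one)
  qed
  also have "\<dots> = 1 + (\<integral>\<^sup>+ x. ennreal (f x powr p) \<partial>M)"
    by (simp add: nn_integral_add M)
  finally show ?thesis using top by (simp add: top_unique)
qed

section \<open>The Gagliardo energy\<close>

text \<open>The energy is the \<open>L\<^sup>p\<close> integral of a difference quotient that depends linearly on the function.\<close>

definition dquot :: "real \<Rightarrow> real \<Rightarrow> ('a::euclidean_space \<Rightarrow> real) \<Rightarrow> 'a \<times> 'a \<Rightarrow> real" where
  "dquot s p u = (\<lambda>(x, y). (u x - u y) / norm (x - y) powr ((real DIM('a) + s * p) / p))"

lemma measurable_dquot [measurable]: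
  assumes [measurable]: "u \<in> borel_measurable borel"
  shows "dquot s p u \<in> borel_measurable (lborel \<Otimes>\<^sub>M lborel)"
  unfolding dquot_def by measurable

lemma energy_eq_pint:
  fixes u :: "'a::euclidean_space \<Rightarrow> real"
  assumes "0 < p"
  shows "energy s p u = pint (lborel \<Otimes>\<^sub>M lborel) p (dquot s p u)"
  unfolding energy_def pint_def dquot_def
  using assms by (intro nn_integral_cong) (auto simp: powr_divide powr_powr)

lemma gnorm_eq_pint:
  "0 < p \<Longrightarrow> gnorm s p u = epowr (pint (lborel \<Otimes>\<^sub>M lborel) p (dquot s p u)) (1/p)"
  by (simp add: gnorm_def energy_eq_pint)

lemma energy_eq_gnorm: "0 < p \<Longrightarrow> energy s p u = epowr (gnorm s p u) p"
  by (simp add: gnorm_def epowr_epowr)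

lemma energy_iterated:
  fixes u :: "'a::euclidean_space \<Rightarrow> real"
  assumes [measurable]: "u \<in> borel_measurable borel"
  shows "energy s p u = (\<integral>\<^sup>+ x. \<integral>\<^sup>+ y. ennreal (\<bar>u x - u y\<bar> powr p / norm (x - y) powr (real DIM('a) + s * p)) \<partial>lborel \<partial>lborel)"
  unfolding energy_def by (subst lborel.nn_integral_fst[symmetric]) auto

lemma energy_zero [simp]: "energy s p (\<lambda>x. 0) = 0"
  by (simp add: energy_def case_prod_unfold)

lemma gnorm_zero [simp]: "gnorm s p (\<lambda>x. 0) = 0"
  by (simp add: gnorm_def)

lemma energy_combination:
  fixes a b :: "'a::euclidean_space \<Rightarrow> real"
  assumes [measurable]: "a \<in> borel_measurable borel" "b \<in> borel_measurable borel" and t: "0 \<le> t"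
  shows "energy s p a + ennreal t * energy s p b = (\<integral>\<^sup>+ (x, y). ennreal
    ((\<bar>a x - a y\<bar> powr p + t * \<bar>b x - b y\<bar> powr p) / norm (x - y) powr (real DIM('a) + s * p)) \<partial>(lborel \<Otimes>\<^sub>M lborel))"
    (is "_ = (\<integral>\<^sup>+ (x, y). ennreal ((?A x y + t * ?B x y) / ?n x y) \<partial>_)")
proof -
  have "energy s p a + ennreal t * energy s p b
     = (\<integral>\<^sup>+ (x, y). ennreal (?A x y / ?n x y) + ennreal t * ennreal (?B x y / ?n x y) \<partial>(lborel \<Otimes>\<^sub>M lborel))"
    unfolding energy_def by (simp add: nn_integral_add nn_integral_cmult split_beta')
  moreover have "ennreal (?A x y / ?n x y) + ennreal t * ennreal (?B x y / ?n x y)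
      = ennreal ((?A x y + t * ?B x y) / ?n x y)" for x y
    using t by (simp add: add_divide_distrib flip: ennreal_mult ennreal_plus)
  ultimately show ?thesis by simp
qed

lemma energy_add_pointwise_le:
  fixes a b c :: "'a::euclidean_space \<Rightarrow> real"
  assumes "a \<in> borel_measurable borel" "b \<in> borel_measurable borel" "0 \<le> t"
    and "\<And>x y. \<bar>a x - a y\<bar> powr p + t * \<bar>b x - b y\<bar> powr p \<le> \<bar>c x - c y\<bar> powr p"
  shows "energy s p a + ennreal t * energy s p b \<le> energy s p c"
  unfolding energy_combination[OF assms(1-3)] unfolding energy_def
  using assms(4) by (intro nn_integral_mono) (auto intro!: ennreal_leI divide_right_mono)

lemma energy_le_add_pointwise:
  fixes a b c :: "'a::euclidean_space \<Rightarrow> real"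
  assumes "a \<in> borel_measurable borel" "b \<in> borel_measurable borel" "0 \<le> t"
    and "\<And>x y. \<bar>c x - c y\<bar> powr p \<le> \<bar>a x - a y\<bar> powr p + t * \<bar>b x - b y\<bar> powr p"
  shows "energy s p c \<le> energy s p a + ennreal t * energy s p b"
  unfolding energy_combination[OF assms(1-3)] unfolding energy_def
  using assms(4) by (intro nn_integral_mono) (auto intro!: ennreal_leI divide_right_mono)

lemma energy_mono:
  assumes "0 \<le> p" "\<And>x y. \<bar>u x - u y\<bar> \<le> \<bar>v x - v y\<bar>"
  shows "energy s p u \<le> energy s p v"
  unfolding energy_def
  using assms by (intro nn_integral_mono) (auto intro!: ennreal_leI divide_right_mono powr_mono2)

lemma energy_cong_diff: "(\<And>x y. \<bar>u x - u y\<bar> = \<bar>v x - v y\<bar>) \<Longrightarrow> energy s p u = energy s p v"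
  unfolding energy_def by simp

lemma energy_cmult:
  assumes [measurable]: "u \<in> borel_measurable borel" and p: "0 < p"
  shows "energy s p (\<lambda>x. c * u x) = ennreal (\<bar>c\<bar> powr p) * energy s p u"
proof -
  have "dquot s p (\<lambda>x. c * u x) = (\<lambda>z. c * dquot s p u z)"
    by (auto simp: dquot_def fun_eq_iff algebra_simps)
  then show ?thesis using p by (simp add: energy_eq_pint pint_cmult)
qed

lemma gnorm_cmult:
  assumes "u \<in> borel_measurable borel" and p: "0 < p"
  shows "gnorm s p (\<lambda>x. c * u x) = ennreal \<bar>c\<bar> * gnorm s p u"
proof (cases "c = 0")
  case True
  then show ?thesis using p by simp
next
  case False
  then show ?thesis using assms
    by (simp add: gnorm_def energy_cmult epowr_mult epowr_ennreal powr_powr)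
qed

lemma gnorm_minus_commute: "gnorm s p (\<lambda>x. u x - v x) = gnorm s p (\<lambda>x. v x - u x)"
  unfolding gnorm_def by (subst energy_cong_diff[where v = "\<lambda>x. v x - u x"]) auto

lemma gnorm_triangle:
  assumes [measurable]: "u \<in> borel_measurable borel" "v \<in> borel_measurable borel" and p: "1 \<le> p"
  shows "gnorm s p (\<lambda>x. u x + v x) \<le> gnorm s p u + gnorm s p v"
proof -
  have "dquot s p (\<lambda>x. u x + v x) = (\<lambda>z. dquot s p u z + dquot s p v z)"
    by (auto simp: dquot_def fun_eq_iff add_divide_distrib diff_divide_distrib)
  then show ?thesis using p pint_triangle[of "dquot s p u" "lborel \<Otimes>\<^sub>M lborel" "dquot s p v" p]
    by (simp add: gnorm_eq_pint)
qed

lemma gnorm_le_add_diff: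
  assumes [measurable]: "u \<in> borel_measurable borel" "v \<in> borel_measurable borel" and p: "1 \<le> p"
  shows "gnorm s p u \<le> gnorm s p v + gnorm s p (\<lambda>x. u x - v x)"
  using gnorm_triangle[of v "\<lambda>x. u x - v x" p s] p by simp

lemma energy_Fatou:
  fixes u :: "nat \<Rightarrow> 'a::euclidean_space \<Rightarrow> real"
  assumes [measurable]: "\<And>n. u n \<in> borel_measurable borel" "v \<in> borel_measurable borel"
    and lim: "AE x in lborel. (\<lambda>n. u n x) \<longlonglongrightarrow> v x" and p: "0 < p"
  shows "energy s p v \<le> liminf (\<lambda>n. energy s p (u n))"
proof -
  obtain Z where Z: "Z \<in> null_sets lborel" "\<And>x. x \<notin> Z \<Longrightarrow> (\<lambda>n. u n x) \<longlonglongrightarrow> v x"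
    using lim by (auto simp: eventually_ae_filter)
  have Zs [measurable]: "Z \<in> sets borel" using Z(1) by auto
  have 1: "AE x in lborel. x \<notin> Z" using Z(1) by (rule AE_not_in)
  have "AE z in lborel \<Otimes>\<^sub>M lborel. fst z \<notin> Z \<and> snd z \<notin> Z"
  proof (rule lborel_pair.AE_pair_measure)
    have "{z \<in> space (lborel \<Otimes>\<^sub>M lborel). fst z \<notin> Z \<and> snd z \<notin> Z} = (- Z) \<times> (- Z)"
      by (auto simp: space_pair_measure)
    then show "{z \<in> space (lborel \<Otimes>\<^sub>M lborel). fst z \<notin> Z \<and> snd z \<notin> Z} \<in> sets (lborel \<Otimes>\<^sub>M lborel)"
      using Zs by (metis pair_measureI sets_lborel borel_comp)
    show "AE x in lborel. AE y in lborel. fst (x, y) \<notin> Z \<and> snd (x, y) \<notin> Z"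
      using 1 by eventually_elim (use 1 in \<open>auto elim!: eventually_mono\<close>)
  qed
  then have "AE z in lborel \<Otimes>\<^sub>M lborel. (\<lambda>n. dquot s p (u n) z) \<longlonglongrightarrow> dquot s p v z"
  proof eventually_elim
    case (elim z)
    show ?case
    proof (cases "fst z = snd z")
      case True
      then show ?thesis by (auto simp: dquot_def split_beta)
    next
      case False
      then show ?thesis using elim Z(2) unfolding dquot_def split_beta
        by (intro tendsto_divide tendsto_diff) auto
    qed
  qed
  then show ?thesis using p by (simp add: energy_eq_pint pint_Fatou)
qed

lemma nn_integral_lborel_reflect:
  fixes f :: "'a::euclidean_space \<Rightarrow> ennreal"
  assumes [measurable]: "f \<in> borel_measurable borel"
  shows "(\<integral>\<^sup>+ y. f (x - y) \<partial>lborel) = (\<integral>\<^sup>+ y. f y \<partial>lborel)"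
proof -
  have "(\<integral>\<^sup>+ y. f y \<partial>lborel) = (\<integral>\<^sup>+ y. f y \<partial>(density (distr lborel borel (\<lambda>y. x + (-1) *\<^sub>R y)) (\<lambda>_. \<bar>-1::real\<bar> ^ DIM('a))))"
    using lborel_affine[of "-1" x] by simp
  then show ?thesis by (simp add: nn_integral_density nn_integral_distr)
qed

lemma nn_integral_lborel_translate:
  fixes f :: "'a::euclidean_space \<Rightarrow> ennreal"
  assumes [measurable]: "f \<in> borel_measurable borel"
  shows "(\<integral>\<^sup>+ y. f (y - z) \<partial>lborel) = (\<integral>\<^sup>+ y. f y \<partial>lborel)"
proof -
  have "(\<integral>\<^sup>+ y. f y \<partial>lborel) = (\<integral>\<^sup>+ y. f y \<partial>(density (distr lborel borel (\<lambda>y. - z + 1 *\<^sub>R y)) (\<lambda>_. \<bar>1::real\<bar> ^ DIM('a))))"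
    using lborel_affine[of 1 "- z"] by simp
  then show ?thesis by (simp add: nn_integral_density nn_integral_distr)
qed

lemma energy_translate:
  fixes u :: "'a::euclidean_space \<Rightarrow> real"
  assumes [measurable]: "u \<in> borel_measurable borel"
  shows "energy s p (\<lambda>x. u (x - z)) = energy s p u"
proof -
  define k where "k x y = ennreal (\<bar>u x - u y\<bar> powr p / norm (x - y) powr (real DIM('a) + s * p))" for x y :: 'a
  have [measurable]: "case_prod k \<in> borel_measurable (borel \<Otimes>\<^sub>M borel)" unfolding k_def by measurable
  have "energy s p (\<lambda>x. u (x - z)) = (\<integral>\<^sup>+ x. \<integral>\<^sup>+ y. k (x - z) (y - z) \<partial>lborel \<partial>lborel)"
    by (subst energy_iterated) (auto simp: k_def)
  also have "\<dots> = (\<integral>\<^sup>+ x. \<integral>\<^sup>+ y. k (x - z) y \<partial>lborel \<partial>lborel)"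
    by (subst nn_integral_lborel_translate) auto
  also have "\<dots> = (\<integral>\<^sup>+ x. \<integral>\<^sup>+ y. k x y \<partial>lborel \<partial>lborel)"
    by (subst nn_integral_lborel_translate[where f = "\<lambda>x. \<integral>\<^sup>+ y. k x y \<partial>lborel"]) auto
  also have "\<dots> = energy s p u"
    by (subst energy_iterated) (auto simp: k_def[abs_def])
  finally show ?thesis .
qed

text \<open>Poincare's inequality on a bounded set: compare with the values, all \<open>0\<close>, on a ball of
  radius \<open>1\<close> outside the set.\<close>

lemma energy_poincare:
  fixes r s p :: real
  assumes sp: "0 < s" "0 < p"
  shows "\<exists>C>0. \<forall>u::'a::euclidean_space \<Rightarrow> real. u \<in> borel_measurable borel \<longrightarrow> (\<forall>x. x \<notin> ball 0 r \<longrightarrow> u x = 0)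
    \<longrightarrow> ennreal C * pint lborel p u \<le> energy s p u"
proof (cases "0 < r")
  case False
  show ?thesis
  proof (intro exI[where x = 1] conjI allI impI)
    fix u :: "'a \<Rightarrow> real"
    assume u: "\<forall>x. x \<notin> ball 0 r \<longrightarrow> u x = 0"
    have "u x = 0" for x
    proof -
      have "\<not> norm x < r" using False norm_ge_zero[of x] by linarith
      then show "u x = 0" using u by simp
    qed
    then have "u = (\<lambda>x. 0)" by auto
    then show "ennreal 1 * pint lborel p u \<le> energy s p u" by simp
  qed simp
next
  case r: True
  obtain b :: 'a where b: "b \<in> Basis" using nonempty_Basis by (metis ex_in_conv)
  define z where "z = (r + 1) *\<^sub>R b"
  have nz: "norm z = r + 1" using b r by (simp add: z_def)
  define \<alpha> where "\<alpha> = real DIM('a) + s * p"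
  have \<alpha>: "0 < \<alpha>" using sp by (simp add: \<alpha>_def add_pos_pos)
  define A where "A = (2 * r + 2) powr \<alpha>"
  have A: "0 < A" using r by (simp add: A_def)
  have d: "norm (x - y) \<le> 2 * r + 2" "x \<noteq> y" "y \<notin> ball 0 r" if "x \<in> ball 0 r" "y \<in> ball z 1" for x y
  proof -
    have xy: "norm x < r" "norm (z - y) < 1" using that by (auto simp: dist_norm)
    have "norm (x - y) \<le> norm x + norm y" by (rule norm_triangle_ineq4)
    moreover have "norm y \<le> norm z + norm (z - y)" by (metis norm_minus_commute norm_triangle_sub)
    ultimately show "norm (x - y) \<le> 2 * r + 2" using xy nz by linarith
    have "norm z \<le> norm y + norm (z - y)" by (rule norm_triangle_sub)
    then have "norm y > r" using xy nz by linarith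
    then show "y \<notin> ball 0 r" by simp
    then show "x \<noteq> y" using that by auto
  qed
  show ?thesis
  proof (intro exI conjI allI impI)
    show "0 < measure lborel (ball z 1) / A"
      using A content_ball_pos[of 1 z] by simp
    fix u :: "'a \<Rightarrow> real"
    assume [measurable]: "u \<in> borel_measurable borel" and u0: "\<forall>x. x \<notin> ball 0 r \<longrightarrow> u x = 0"
    have "ennreal (measure lborel (ball z 1) / A) * pint lborel p u
        = (\<integral>\<^sup>+ x. \<integral>\<^sup>+ y. ennreal (\<bar>u x\<bar> powr p / A) * indicator (ball z 1) y \<partial>lborel \<partial>lborel)"
    proof -
      have "(\<integral>\<^sup>+ y. ennreal (\<bar>u x\<bar> powr p / A) * indicator (ball z 1) y \<partial>lborel)
          = ennreal (measure lborel (ball z 1) / A) * ennreal (\<bar>u x\<bar> powr p)" for x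
      proof -
        have "emeasure lborel (ball z 1) = ennreal (measure lborel (ball z 1))"
          using emeasure_lborel_ball_finite[of z 1] by (intro emeasure_eq_ennreal_measure) auto
        then show ?thesis using A
          by (subst nn_integral_cmult_indicator) (auto simp flip: ennreal_mult simp: mult.commute)
      qed
      then show ?thesis unfolding pint_def by (simp add: nn_integral_cmult)
    qed
    also have "\<dots> \<le> (\<integral>\<^sup>+ x. \<integral>\<^sup>+ y. ennreal (\<bar>u x - u y\<bar> powr p / norm (x - y) powr \<alpha>) \<partial>lborel \<partial>lborel)"
    proof (intro nn_integral_mono)
      fix x y
      show "ennreal (\<bar>u x\<bar> powr p / A) * indicator (ball z 1) y
         \<le> ennreal (\<bar>u x - u y\<bar> powr p / norm (x - y) powr \<alpha>)"
      proof (cases "x \<in> ball 0 r \<and> y \<in> ball z 1")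
        case True
        then have "norm (x - y) powr \<alpha> \<le> A" unfolding A_def using d \<alpha> by (intro powr_mono2) auto
        moreover have "u y = 0" using u0 d True by auto
        ultimately show ?thesis using True d
          by (auto intro!: ennreal_leI divide_left_mono simp: A)
      next
        case False
        then show ?thesis using u0 by (auto simp: indicator_def)
      qed
    qed
    also have "\<dots> = energy s p u" by (simp add: energy_iterated \<alpha>_def)
    finally show "ennreal (measure lborel (ball z 1) / A) * pint lborel p u \<le> energy s p u" .
  qed
qed

text \<open>On the dyadic shell of radius \<open>2 powr (- j)\<close> the integral is of order \<open>2 powr (- j * p * (1 - s))\<close>, on
  that of radius \<open>2 powr j\<close> of order \<open>2 powr (- j * s * p)\<close>: the two geometric series converge because
  \<open>s < 1\<close> and because \<open>0 < s\<close>.\<close>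

lemma kernel_integrable:
  fixes s p :: real
  assumes s: "0 < s" "s < 1" and p: "1 < p"
  shows "(\<integral>\<^sup>+ z. ennreal (min (norm z) 1 powr p / norm z powr (real DIM('a) + s * p)) \<partial>(lborel :: 'a::euclidean_space measure)) < \<infinity>"
proof -
  define N where "N = real DIM('a)"
  define \<alpha> where "\<alpha> = N + s * p"
  define V where "V = unit_ball_vol N"
  have V: "0 \<le> V" by (simp add: V_def N_def)
  have N: "0 \<le> N" and \<alpha>: "0 \<le> \<alpha>" using s p by (auto simp: N_def \<alpha>_def)
  have em: "emeasure lborel (cball (0::'a) (2 powr t)) = ennreal (V * 2 powr (t * N))" for t
    by (subst emeasure_cball) (auto simp: V_def N_def powr_powr[symmetric] powr_realpow)
  define g where "g j z = ennreal (2 powr ((real j + 1) * \<alpha> - real j * p)) * indicator (cball (0::'a) (2 powr (- real j))) z" for j :: nat and z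
  define h where "h j z = ennreal (2 powr (- real j * \<alpha>)) * indicator (cball (0::'a) (2 powr (real j + 1))) z" for j :: nat and z
  have [measurable]: "cball (0::'a) t \<in> sets borel" for t by (simp add: borel_closed)
  have [measurable]: "g j \<in> borel_measurable borel" "h j \<in> borel_measurable borel" for j
    unfolding g_def h_def by measurable
  have G: "(\<integral>\<^sup>+ z. g j z \<partial>lborel) = ennreal (V * 2 powr \<alpha> * (2 powr (- (p * (1 - s)))) ^ j)" for j
  proof -
    have "(\<integral>\<^sup>+ z. g j z \<partial>lborel) = ennreal (2 powr ((real j + 1) * \<alpha> - real j * p)) * ennreal (V * 2 powr (- real j * N))"
      unfolding g_def by (subst nn_integral_cmult_indicator) (auto simp: em[of "- real j", simplified])
    also have "\<dots> = ennreal (V * 2 powr ((real j + 1) * \<alpha> - real j * p - real j * N))"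
      using V by (simp add: powr_diff powr_minus divide_simps flip: ennreal_mult)
    also have "2 powr ((real j + 1) * \<alpha> - real j * p - real j * N) = 2 powr \<alpha> * (2 powr (- (p * (1 - s)))) powr real j"
      by (simp add: powr_powr \<alpha>_def algebra_simps flip: powr_add)
    finally show ?thesis by (simp add: powr_realpow mult.assoc)
  qed
  have H: "(\<integral>\<^sup>+ z. h j z \<partial>lborel) = ennreal (V * 2 powr N * (2 powr (- (s * p))) ^ j)" for j
  proof -
    have "(\<integral>\<^sup>+ z. h j z \<partial>lborel) = ennreal (2 powr (- real j * \<alpha>)) * ennreal (V * 2 powr ((real j + 1) * N))"
      unfolding h_def by (subst nn_integral_cmult_indicator) (auto simp: em)
    also have "\<dots> = ennreal (V * 2 powr ((real j + 1) * N - real j * \<alpha>))"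
      using V by (simp add: powr_diff powr_minus divide_simps flip: ennreal_mult)
    also have "2 powr ((real j + 1) * N - real j * \<alpha>) = 2 powr N * (2 powr (- (s * p))) powr real j"
      by (simp add: powr_powr \<alpha>_def algebra_simps flip: powr_add)
    finally show ?thesis by (simp add: powr_realpow mult.assoc)
  qed
  have "ennreal (min (norm z) 1 powr p / norm z powr \<alpha>) \<le> (\<Sum>j. g j z) + (\<Sum>j. h j z)" for z :: 'a
  proof -
    consider "z = 0" | "0 < norm z" "norm z \<le> 1" | "1 < norm z" by fastforce
    then show ?thesis
    proof cases
      case 2
      define j where "j = nat \<lfloor>- log 2 (norm z)\<rfloor>"
      have "log 2 (norm z) \<le> 0" using 2 by simp
      then have j: "real j \<le> - log 2 (norm z)" "- log 2 (norm z) < real j + 1"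
        unfolding j_def by linarith+
      then have "2 powr (- real j - 1) \<le> norm z" "norm z \<le> 2 powr (- real j)"
        using 2 by (auto simp: le_log_iff[symmetric] log_le_iff[symmetric])
      then have "norm z powr p / norm z powr \<alpha> \<le> (2 powr (- real j)) powr p / (2 powr (- real j - 1)) powr \<alpha>"
        using 2 p \<alpha> by (intro frac_le powr_mono2) auto
      also have "\<dots> = 2 powr ((real j + 1) * \<alpha> - real j * p)"
        by (simp add: powr_powr algebra_simps flip: powr_diff)
      finally have "ennreal (min (norm z) 1 powr p / norm z powr \<alpha>) \<le> g j z"
        using 2 \<open>norm z \<le> 2 powr (- real j)\<close> by (simp add: g_def ennreal_leI)
      also have "g j z \<le> (\<Sum>j. g j z)"
        using sum_le_suminf[of "\<lambda>j. g j z" "{j}"] by simp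
      also have "\<dots> \<le> (\<Sum>j. g j z) + (\<Sum>j. h j z)" by simp
      finally show ?thesis .
    next
      case 3
      define j where "j = nat \<lfloor>log 2 (norm z)\<rfloor>"
      have z0: "0 < norm z" using 3 by linarith
      then have "log 2 (norm z) \<ge> 0" using 3 by (simp add: zero_le_log_cancel_iff)
      then have j: "real j \<le> log 2 (norm z)" "log 2 (norm z) < real j + 1"
        unfolding j_def by linarith+
      then have "2 powr real j \<le> norm z" "norm z \<le> 2 powr (real j + 1)"
        using z0 by (auto simp: le_log_iff log_le_iff[symmetric])
      then have "1 / norm z powr \<alpha> \<le> 1 / (2 powr real j) powr \<alpha>"
        using z0 3 \<alpha> by (intro divide_left_mono powr_mono2) auto
      also have "\<dots> = 2 powr (- real j * \<alpha>)"
        by (simp add: powr_powr powr_minus_divide)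
      finally have "ennreal (min (norm z) 1 powr p / norm z powr \<alpha>) \<le> h j z"
        using 3 \<open>norm z \<le> 2 powr (real j + 1)\<close> by (simp add: h_def ennreal_leI)
      also have "h j z \<le> (\<Sum>j. h j z)"
        using sum_le_suminf[of "\<lambda>j. h j z" "{j}"] by simp
      also have "\<dots> \<le> (\<Sum>j. g j z) + (\<Sum>j. h j z)" by simp
      finally show ?thesis .
    qed (use p in auto)
  qed
  then have "(\<integral>\<^sup>+ z. ennreal (min (norm z) 1 powr p / norm z powr \<alpha>) \<partial>(lborel :: 'a measure))
      \<le> (\<integral>\<^sup>+ z. (\<Sum>j. g j z) + (\<Sum>j. h j z) \<partial>lborel)"
    by (rule nn_integral_mono)
  also have "\<dots> = (\<Sum>j. \<integral>\<^sup>+ z. g j z \<partial>lborel) + (\<Sum>j. \<integral>\<^sup>+ z. h j z \<partial>lborel)"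
    by (simp add: nn_integral_add nn_integral_suminf)
  also have "\<dots> = (\<Sum>j. ennreal (V * 2 powr \<alpha> * (2 powr (- (p * (1 - s)))) ^ j)) + (\<Sum>j. ennreal (V * 2 powr N * (2 powr (- (s * p))) ^ j))"
    by (simp only: G H)
  also have "\<dots> < \<infinity>"
  proof -
    have "2 powr (- (p * (1 - s))) < (1::real)" "2 powr (- (s * p)) < (1::real)"
      using s p by (simp_all add: powr_less_one)
    then show ?thesis using V
      by (subst (1 2) suminf_ennreal2) (auto intro!: summable_mult summable_geometric)
  qed
  finally show ?thesis by (simp add: \<alpha>_def N_def)
qed

text \<open>The integrand vanishes unless one of the two points lies in the ball that contains the support, and
  then the integral over the other point is bounded by that of the kernel.\<close>

lemma energy_finite:
  fixes u :: "'a::euclidean_space \<Rightarrow> real"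
  assumes s: "0 < s" "s < 1" and p: "1 < p"
    and [measurable]: "u \<in> borel_measurable borel"
    and K: "0 \<le> K" "\<And>x y. \<bar>u x - u y\<bar> \<le> K * min (norm (x - y)) 1"
    and u0: "\<And>x. x \<notin> ball 0 R \<Longrightarrow> u x = 0"
  shows "energy s p u < \<infinity>"
proof -
  define \<alpha> where "\<alpha> = real DIM('a) + s * p"
  define f where "f z = ennreal (min (norm z) 1 powr p / norm z powr \<alpha>)" for z :: 'a
  have [measurable]: "f \<in> borel_measurable borel" unfolding f_def by measurable
  have fin: "(\<integral>\<^sup>+ z. f z \<partial>lborel) < \<infinity>" using kernel_integrable[OF s p, where 'a = 'a] by (simp add: f_def \<alpha>_def)
  have f_sym: "f (x - y) = f (y - x)" for x y by (simp add: f_def norm_minus_commute)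
  have [measurable]: "ball (0::'a) R \<in> sets borel" by simp
  have B: "emeasure lborel (ball 0 R :: 'a set) < \<infinity>" using emeasure_lborel_ball_finite by auto
  have "energy s p u \<le> (\<integral>\<^sup>+ x. \<integral>\<^sup>+ y. ennreal (K powr p) * (indicator (ball 0 R) x * f (x - y) + indicator (ball 0 R) y * f (x - y)) \<partial>lborel \<partial>lborel)"
    unfolding energy_iterated[OF assms(4)] \<alpha>_def[symmetric]
  proof (intro nn_integral_mono)
    fix x y :: 'a
    show "ennreal (\<bar>u x - u y\<bar> powr p / norm (x - y) powr \<alpha>)
        \<le> ennreal (K powr p) * (indicator (ball 0 R) x * f (x - y) + indicator (ball 0 R) y * f (x - y))"
    proof (cases "x \<in> ball 0 R \<or> y \<in> ball 0 R")
      case True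
      have "\<bar>u x - u y\<bar> powr p \<le> (K * min (norm (x - y)) 1) powr p"
        using p by (intro powr_mono2 K) auto
      also have "\<dots> = K powr p * min (norm (x - y)) 1 powr p"
        using K by (simp add: powr_mult)
      finally have "ennreal (\<bar>u x - u y\<bar> powr p / norm (x - y) powr \<alpha>)
        \<le> ennreal (K powr p * (min (norm (x - y)) 1 powr p / norm (x - y) powr \<alpha>))"
        by (intro ennreal_leI) (simp add: divide_right_mono)
      also have "\<dots> = ennreal (K powr p) * f (x - y)"
        unfolding f_def by (subst ennreal_mult) auto
      also have "\<dots> \<le> ennreal (K powr p) * (indicator (ball 0 R) x * f (x - y) + indicator (ball 0 R) y * f (x - y))"
        using True by (intro mult_left_mono) (auto simp: indicator_def)
      finally show ?thesis .
    next
      case False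
      then have "u x = 0" "u y = 0" using u0 by auto
      then show ?thesis by simp
    qed
  qed
  also have "\<dots> = (\<integral>\<^sup>+ x. ennreal (K powr p) * ((\<integral>\<^sup>+ y. indicator (ball 0 R) x * f (x - y) \<partial>lborel)
       + (\<integral>\<^sup>+ y. indicator (ball 0 R) y * f (x - y) \<partial>lborel)) \<partial>lborel)"
    (is "_ = (\<integral>\<^sup>+ x. ennreal (K powr p) * (?I x + ?J x) \<partial>lborel)")
  proof (rule nn_integral_cong)
    fix x :: 'a
    have "(\<integral>\<^sup>+ y. ennreal (K powr p) * (indicator (ball 0 R) x * f (x - y) + indicator (ball 0 R) y * f (x - y)) \<partial>lborel)
      = ennreal (K powr p) * (\<integral>\<^sup>+ y. indicator (ball 0 R) x * f (x - y) + indicator (ball 0 R) y * f (x - y) \<partial>lborel)"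
      by (rule nn_integral_cmult) measurable
    also have "(\<integral>\<^sup>+ y. indicator (ball 0 R) x * f (x - y) + indicator (ball 0 R) y * f (x - y) \<partial>lborel) = ?I x + ?J x"
      by (rule nn_integral_add) measurable
    finally show "(\<integral>\<^sup>+ y. ennreal (K powr p) * (indicator (ball 0 R) x * f (x - y) + indicator (ball 0 R) y * f (x - y)) \<partial>lborel)
      = ennreal (K powr p) * (?I x + ?J x)" .
  qed
  also have "\<dots> = ennreal (K powr p) * (\<integral>\<^sup>+ x. ?I x + ?J x \<partial>lborel)"
    by (rule nn_integral_cmult) measurable
  also have "(\<integral>\<^sup>+ x. ?I x + ?J x \<partial>lborel) = (\<integral>\<^sup>+ x. ?I x \<partial>lborel) + (\<integral>\<^sup>+ x. ?J x \<partial>lborel)"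
    by (rule nn_integral_add) measurable
  also have "(\<integral>\<^sup>+ x. \<integral>\<^sup>+ y. indicator (ball 0 R) x * f (x - y) \<partial>lborel \<partial>lborel)
      = emeasure lborel (ball 0 R :: 'a set) * (\<integral>\<^sup>+ z. f z \<partial>lborel)"
    by (simp add: nn_integral_cmult nn_integral_lborel_reflect nn_integral_multc)
  also have "(\<integral>\<^sup>+ x. \<integral>\<^sup>+ y. indicator (ball 0 R) y * f (x - y) \<partial>lborel \<partial>lborel)
      = (\<integral>\<^sup>+ y. \<integral>\<^sup>+ x. indicator (ball 0 R) y * f (x - y) \<partial>lborel \<partial>lborel)"
    by (subst lborel_pair.Fubini') auto
  also have "\<dots> = emeasure lborel (ball 0 R :: 'a set) * (\<integral>\<^sup>+ z. f z \<partial>lborel)"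
    by (simp add: nn_integral_cmult nn_integral_lborel_translate nn_integral_multc)
  also have "ennreal (K powr p) * (emeasure lborel (ball 0 R :: 'a set) * (\<integral>\<^sup>+ z. f z \<partial>lborel)
       + emeasure lborel (ball 0 R :: 'a set) * (\<integral>\<^sup>+ z. f z \<partial>lborel)) < \<infinity>"
    using fin B by (simp add: ennreal_mult_less_top)
  finally show ?thesis .
qed

section \<open>Smooth functions\<close>

lemma Ck_SucI:
  assumes "\<And>x. (f has_derivative D x) (at x)" "\<And>b. b \<in> Basis \<Longrightarrow> Ck k (\<lambda>x. D x b)"
  shows "Ck (Suc k) f"
proof -
  have "frechet_derivative f (at x) = D x" for x
    using frechet_derivative_at[OF assms(1)] by simp
  then show ?thesis using assms by (auto simp: differentiable_def)
qed

lemma Ck_SucE: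
  assumes "Ck (Suc k) f"
  obtains D where "\<And>x. (f has_derivative D x) (at x)" "\<And>b. b \<in> Basis \<Longrightarrow> Ck k (\<lambda>x. D x b)"
  using assms that[of "\<lambda>x. frechet_derivative f (at x)"] by (auto simp: frechet_derivative_works)

lemma Ck_Suc_imp: "Ck (Suc k) f \<Longrightarrow> Ck k f"
proof (induction k arbitrary: f)
  case 0
  then obtain D where D: "\<And>x. (f has_derivative D x) (at x)" by (rule Ck_SucE) blast
  have "continuous_on UNIV f"
    using has_derivative_continuous[OF D] by (simp add: continuous_on_eq_continuous_within)
  then show ?case by simp
next
  case (Suc k)
  from Suc.prems obtain D where D: "\<And>x. (f has_derivative D x) (at x)"
    "\<And>b. b \<in> Basis \<Longrightarrow> Ck (Suc k) (\<lambda>x. D x b)" by (rule Ck_SucE) blast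
  then show ?case using Suc.IH by (intro Ck_SucI[of f D]) auto
qed

lemma Ck_imp_continuous: "Ck k f \<Longrightarrow> continuous_on UNIV f"
  by (induction k) (use Ck_Suc_imp in auto)

lemma Ck_const: "Ck k (\<lambda>x. c)"
proof (induction k arbitrary: c)
  case (Suc k)
  show ?case by (rule Ck_SucI[where D = "\<lambda>x y. 0"]) (auto intro: Suc derivative_eq_intros)
qed simp

lemma Ck_add: "Ck k f \<Longrightarrow> Ck k g \<Longrightarrow> Ck k (\<lambda>x. f x + g x)"
proof (induction k arbitrary: f g)
  case 0
  then show ?case by (auto intro: continuous_on_add)
next
  case (Suc k)
  from Suc.prems(1) obtain F where F: "\<And>x. (f has_derivative F x) (at x)"
    "\<And>b. b \<in> Basis \<Longrightarrow> Ck k (\<lambda>x. F x b)" by (rule Ck_SucE) auto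
  from Suc.prems(2) obtain G where G: "\<And>x. (g has_derivative G x) (at x)"
    "\<And>b. b \<in> Basis \<Longrightarrow> Ck k (\<lambda>x. G x b)" by (rule Ck_SucE) auto
  show ?case
    by (rule Ck_SucI[where D = "\<lambda>x y. F x y + G x y"]) (auto intro: has_derivative_add F G Suc.IH)
qed

lemma Ck_mult: "Ck k f \<Longrightarrow> Ck k g \<Longrightarrow> Ck k (\<lambda>x. f x * g x)"
proof (induction k arbitrary: f g)
  case 0
  then show ?case by (auto intro: continuous_on_mult)
next
  case (Suc k)
  from Suc.prems(1) obtain F where F: "\<And>x. (f has_derivative F x) (at x)"
    "\<And>b. b \<in> Basis \<Longrightarrow> Ck k (\<lambda>x. F x b)" by (rule Ck_SucE) auto
  from Suc.prems(2) obtain G where G: "\<And>x. (g has_derivative G x) (at x)"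
    "\<And>b. b \<in> Basis \<Longrightarrow> Ck k (\<lambda>x. G x b)" by (rule Ck_SucE) auto
  have fg: "Ck k f" "Ck k g" using Suc.prems by (auto intro: Ck_Suc_imp simp del: Ck.simps)
  show ?case
  proof (rule Ck_SucI)
    show "((\<lambda>x. f x * g x) has_derivative (\<lambda>y. f x * G x y + F x y * g x)) (at x)" for x
      by (rule has_derivative_mult[OF F(1) G(1)])
    show "Ck k (\<lambda>x. f x * G x b + F x b * g x)" if "b \<in> Basis" for b
      using that by (intro Ck_add Suc.IH F G fg)
  qed
qed

lemma smooth_add: "smooth f \<Longrightarrow> smooth g \<Longrightarrow> smooth (\<lambda>x. f x + g x)"
  and smooth_cmult: "smooth f \<Longrightarrow> smooth (\<lambda>x. c * f x)"
  by (auto simp: smooth_def intro: Ck_add Ck_mult Ck_const)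

text \<open>The functions \<open>exp (- 1 / t) / t ^ m\<close> on the positive half line span a space that is closed
  under differentiation.\<close>

definition flat_exp :: "nat \<Rightarrow> real \<Rightarrow> real" where
  "flat_exp m t = (if 0 < t then exp (- 1 / t) / t ^ m else 0)"

lemma flat_exp_nonneg: "0 \<le> flat_exp m t"
  by (simp add: flat_exp_def)

text \<open>The exponential series of \<open>1 / t\<close> dominates each of its terms.  The case \<open>n = 2\<close> gives the derivative at
  \<open>0\<close>.\<close>

lemma flat_exp_bound: "\<bar>flat_exp m t\<bar> \<le> fact (m + n) * \<bar>t\<bar> ^ n"
proof (cases "0 < t")
  case True
  have "(1 / t) ^ (m + n) /\<^sub>R fact (m + n) \<le> (\<Sum>k. (1 / t) ^ k /\<^sub>R fact k)"
    using sum_le_suminf[OF summable_exp_generic[of "1/t"], of "{m + n}"] True by simp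
  also have "\<dots> = exp (1 / t)" by (simp add: exp_def)
  finally have *: "(1 / t) ^ (m + n) / fact (m + n) \<le> exp (1 / t)" by (simp add: divide_inverse mult.commute)
  have "exp (- 1 / t) / t ^ m = 1 / (exp (1 / t) * t ^ m)"
    by (simp add: exp_minus field_simps)
  also have "\<dots> \<le> 1 / (((1 / t) ^ (m + n) / fact (m + n)) * t ^ m)"
    using True * by (intro divide_left_mono mult_right_mono) auto
  also have "\<dots> = fact (m + n) * t ^ n"
    using True by (simp add: power_add power_one_over)
  finally show ?thesis using True by (simp add: flat_exp_def)
qed (simp add: flat_exp_def)

lemma flat_exp_deriv:
  "(flat_exp m has_real_derivative (flat_exp (m + 2) t - real m * flat_exp (m + 1) t)) (at t)"
proof -
  consider "0 < t" | "t < 0" | "t = 0" by linarith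
  then show ?thesis
  proof cases
    case 1
    have "((\<lambda>t. exp (- 1 / t) / t ^ m) has_real_derivative (flat_exp (m + 2) t - real m * flat_exp (m + 1) t)) (at t)"
    proof -
      have "((\<lambda>t. exp (- 1 / t) / t ^ m) has_real_derivative
         (exp (- 1 / t) * (1 / t ^ 2) * t ^ m - exp (- 1 / t) * (real m * t ^ (m - 1))) / (t ^ m * t ^ m)) (at t)"
        using 1 by (auto intro!: derivative_eq_intros simp: power2_eq_square)
      also have "(exp (- 1 / t) * (1 / t ^ 2) * t ^ m - exp (- 1 / t) * (real m * t ^ (m - 1))) / (t ^ m * t ^ m)
         = flat_exp (m + 2) t - real m * flat_exp (m + 1) t"
        using 1 by (cases m) (auto simp: flat_exp_def field_simps power2_eq_square)
      finally show ?thesis .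
    qed
    then show ?thesis
      by (rule has_field_derivative_transform_within_open[of _ _ _ "{0<..}"]) (use 1 in \<open>auto simp: flat_exp_def\<close>)
  next
    case 2
    have "((\<lambda>t. 0) has_real_derivative (flat_exp (m + 2) t - real m * flat_exp (m + 1) t)) (at t)"
      using 2 by (auto simp: flat_exp_def)
    then show ?thesis
      by (rule has_field_derivative_transform_within_open[of _ _ _ "{..<0}"]) (use 2 in \<open>auto simp: flat_exp_def\<close>)
  next
    case 3
    have "(\<lambda>h. (flat_exp m (0 + h) - flat_exp m 0) / h) \<midarrow>0\<rightarrow> 0"
    proof (rule Lim_null_comparison)
      show "\<forall>\<^sub>F h in at 0. norm ((flat_exp m (0 + h) - flat_exp m 0) / h) \<le> fact (m + 2) * \<bar>h\<bar>"
      proof (rule always_eventually, rule allI)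
        fix h :: real
        show "norm ((flat_exp m (0 + h) - flat_exp m 0) / h) \<le> fact (m + 2) * \<bar>h\<bar>"
          using flat_exp_bound[of m h 2]
          by (cases "h = 0") (auto simp: flat_exp_def[of m 0] power2_eq_square pos_divide_le_eq mult.assoc)
      qed
      show "((\<lambda>h. fact (m + 2) * \<bar>h\<bar>) \<longlongrightarrow> 0) (at (0::real))"
        by (intro tendsto_eq_intros) auto
    qed
    then show ?thesis using 3 by (simp add: DERIV_def flat_exp_def[of _ 0])
  qed
qed

lemma Ck_flat_exp_compose:
  assumes "\<And>k. Ck k f"
  shows "Ck k (\<lambda>x. flat_exp m (f x))"
proof (induction k arbitrary: m)
  case 0
  have "continuous_on UNIV (flat_exp m)"
    using DERIV_continuous[OF flat_exp_deriv] by (simp add: continuous_on_eq_continuous_within)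
  then show ?case using Ck_imp_continuous[OF assms[of 0]]
    by (auto intro: continuous_on_compose2)
next
  case (Suc k)
  from assms[of "Suc k"] obtain F where F: "\<And>x. (f has_derivative F x) (at x)"
    "\<And>b. b \<in> Basis \<Longrightarrow> Ck k (\<lambda>x. F x b)" by (rule Ck_SucE) auto
  show ?case
  proof (rule Ck_SucI)
    fix x
    show "((\<lambda>x. flat_exp m (f x)) has_derivative
       (\<lambda>y. (flat_exp (m + 2) (f x) + (- real m) * flat_exp (m + 1) (f x)) * F x y)) (at x)"
      using has_derivative_compose[OF F(1), of "flat_exp m" "(*) (flat_exp (m + 2) (f x) - real m * flat_exp (m + 1) (f x))"]
        flat_exp_deriv[of m "f x"] by (simp add: has_field_derivative_def)
  next
    fix b :: 'a assume b: "b \<in> Basis"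
    show "Ck k (\<lambda>x. (flat_exp (m + 2) (f x) + (- real m) * flat_exp (m + 1) (f x)) * F x b)"
      by (intro Ck_mult Ck_add Ck_const F b Suc.IH)
  qed
qed

text \<open>The inner function of the bump \<open>flat_exp 0 (e\<^sup>2 - x \<bullet> x)\<close>.\<close>

lemma Ck_sphere: "Ck k (\<lambda>x::'a::euclidean_space. c - x \<bullet> x)"
proof -
  have lin: "Ck k (\<lambda>x::'a. (-2) * (x \<bullet> b))" for b k
  proof (cases k)
    case 0
    then show ?thesis by (auto intro!: continuous_intros)
  next
    case (Suc k')
    show ?thesis unfolding Suc
      by (rule Ck_SucI[where D = "\<lambda>x y. (-2) * (y \<bullet> b)"]) (auto intro!: derivative_eq_intros Ck_const simp del: Ck.simps)
  qed
  show ?thesis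
  proof (cases k)
    case 0
    then show ?thesis by (auto intro!: continuous_intros)
  next
    case (Suc k')
    show ?thesis unfolding Suc
      by (rule Ck_SucI[where D = "\<lambda>x y. (-2) * (x \<bullet> y)"]) (use lin in \<open>auto intro!: derivative_eq_intros simp: inner_commute simp del: Ck.simps mult_minus_left\<close>)
  qed
qed

lemma Ck_imp_Lipschitz:
  fixes f :: "'a::euclidean_space \<Rightarrow> real"
  assumes "Ck 1 f" "\<And>x. x \<notin> ball 0 R \<Longrightarrow> f x = 0"
  shows "\<exists>L\<ge>0. \<forall>x y. \<bar>f x - f y\<bar> \<le> L * norm (x - y)"
proof -
  from assms(1) obtain D where D: "\<And>x. (f has_derivative D x) (at x)"
    "\<And>b. b \<in> Basis \<Longrightarrow> continuous_on UNIV (\<lambda>x. D x b)" unfolding One_nat_def by (rule Ck_SucE) auto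
  have "\<exists>C. \<forall>x\<in>cball 0 R. \<bar>D x b\<bar> \<le> C" if "b \<in> Basis" for b
  proof -
    have "bounded ((\<lambda>x. D x b) ` cball 0 R)"
      using D(2)[OF that] by (intro compact_imp_bounded compact_continuous_image) (auto intro: continuous_on_subset)
    then show ?thesis by (auto simp: bounded_iff)
  qed
  then obtain C where C: "\<And>b x. b \<in> Basis \<Longrightarrow> x \<in> cball 0 R \<Longrightarrow> \<bar>D x b\<bar> \<le> C b" by metis
  define L where "L = (\<Sum>b\<in>Basis. max 0 (C b))"
  have L: "0 \<le> L" by (simp add: L_def sum_nonneg)
  have Dz: "D x = (\<lambda>y. 0)" if "x \<notin> cball 0 R" for x
  proof -
    have "(f has_derivative (\<lambda>y. 0)) (at x)"
      by (rule has_derivative_transform_within_open[of "\<lambda>y. 0" _ _ _ "- cball 0 R"])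
         (use that assms(2) in \<open>auto simp: open_Compl\<close>)
    then show ?thesis using D(1) has_derivative_unique by blast
  qed
  have "onorm (D x) \<le> L" for x
  proof (rule onorm_bound[OF L])
    fix y
    interpret bounded_linear "D x" using D(1) by (rule has_derivative_bounded_linear)
    have "D x y = D x (\<Sum>b\<in>Basis. (y \<bullet> b) *\<^sub>R b)" by (simp add: euclidean_representation)
    also have "\<dots> = (\<Sum>b\<in>Basis. (y \<bullet> b) * D x b)" by (simp add: sum scale)
    also have "norm \<dots> \<le> (\<Sum>b\<in>Basis. norm y * max 0 (C b))"
    proof (rule sum_norm_le)
      fix b :: 'a assume b: "b \<in> Basis"
      have "\<bar>D x b\<bar> \<le> max 0 (C b)" using C[OF b, of x] Dz[of x] by (cases "x \<in> cball 0 R") auto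
      then show "norm ((y \<bullet> b) * D x b) \<le> norm y * max 0 (C b)"
        using Basis_le_norm[OF b, of y] by (auto simp: abs_mult intro!: mult_mono)
    qed
    finally show "norm (D x y) \<le> L * norm y" by (simp add: L_def sum_distrib_left mult.commute)
  qed
  then have "norm (f x - f y) \<le> L * norm (x - y)" for x y
    using differentiable_bound[of UNIV f D L x y] D(1) by (auto intro: has_derivative_at_withinI)
  then show ?thesis using L by auto
qed

text \<open>All derivatives fall on the smooth factor, by differentiation under the integral sign.\<close>

lemma Ck_integral_shift:
  fixes v g :: "'a::euclidean_space \<Rightarrow> real"
  assumes v: "continuous_on UNIV v" and g: "Ck k g"
  shows "Ck k (\<lambda>x. integral (cbox a b) (\<lambda>y. v y * g (x - y)))"
  using g
proof (induction k arbitrary: g)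
  case 0
  have "continuous_on (UNIV \<times> cbox a b) (\<lambda>(x, y). v y * g (x - y))"
    unfolding split_beta
  proof (rule continuous_on_mult)
    show "continuous_on (UNIV \<times> cbox a b) (\<lambda>p. v (snd p))"
      by (rule continuous_on_compose2[OF v]) (auto intro: continuous_intros)
    show "continuous_on (UNIV \<times> cbox a b) (\<lambda>p. g (fst p - snd p))"
      by (rule continuous_on_compose2[OF Ck_imp_continuous[OF 0]]) (auto intro!: continuous_intros)
  qed
  then show ?case using integral_continuous_on_param[of UNIV a b "\<lambda>x y. v y * g (x - y)"] by simp
next
  case (Suc k)
  from Suc.prems obtain D where D: "\<And>x. (g has_derivative D x) (at x)"
    "\<And>b. b \<in> Basis \<Longrightarrow> Ck k (\<lambda>x. D x b)" by (rule Ck_SucE) auto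
  have bl: "bounded_linear (D x)" for x using D(1) by (rule has_derivative_bounded_linear)
  define F where "F x y = v y *\<^sub>R Blinfun (D (x - y))" for x y
  have F_apply: "blinfun_apply (F x y) d = v y * D (x - y) d" for x y d
    by (simp add: F_def blinfun.scaleR_left bounded_linear_Blinfun_apply bl)
  have gc: "continuous_on UNIV g" using Suc.prems by (rule Ck_imp_continuous)
  have cF: "continuous_on (UNIV \<times> cbox a b) (\<lambda>(x, y). F x y)"
    unfolding split_beta F_def
  proof (rule continuous_on_scaleR)
    show "continuous_on (UNIV \<times> cbox a b) (\<lambda>p. v (snd p))"
      by (rule continuous_on_compose2[OF v]) (auto intro: continuous_intros)
    show "continuous_on (UNIV \<times> cbox a b) (\<lambda>p. Blinfun (D (fst p - snd p)))"
    proof (rule continuous_on_blinfun_componentwise)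
      fix i :: 'a assume i: "i \<in> Basis"
      have "continuous_on (UNIV \<times> cbox a b) (\<lambda>p. D (fst p - snd p) i)"
        by (rule continuous_on_compose2[OF Ck_imp_continuous[OF D(2)[OF i]]]) (auto intro!: continuous_intros)
      then show "continuous_on (UNIV \<times> cbox a b) (\<lambda>p. blinfun_apply (Blinfun (D (fst p - snd p))) i)"
        by (simp add: bounded_linear_Blinfun_apply bl)
    qed
  qed
  have cFx: "continuous_on (cbox a b) (F x)" for x
  proof -
    have "continuous_on (cbox a b) (\<lambda>y. (x, y))"
      by (rule continuous_on_Pair[OF continuous_on_const continuous_on_id])
    from continuous_on_compose2[OF cF this] show ?thesis by auto
  qed
  show ?case
  proof (rule Ck_SucI)
    fix x0
    have "((\<lambda>x. integral (cbox a b) (\<lambda>y. v y * g (x - y))) has_derivative blinfun_apply (integral (cbox a b) (F x0))) (at x0 within UNIV)"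
    proof (rule leibniz_rule[OF _ _ cF])
      fix x y
      have "((\<lambda>x. g (x - y)) has_derivative (\<lambda>d. D (x - y) d)) (at x)"
        by (rule has_derivative_compose[of "\<lambda>x. x - y" "\<lambda>d. d" x UNIV g "D (x - y)", simplified])
           (auto intro!: derivative_eq_intros D)
      then show "((\<lambda>x. v y * g (x - y)) has_derivative blinfun_apply (F x y)) (at x within UNIV)"
        unfolding F_apply[abs_def] by (auto intro!: derivative_eq_intros)
    next
      fix x
      show "(\<lambda>y. v y * g (x - y)) integrable_on cbox a b"
      proof (intro integrable_continuous continuous_on_mult)
        show "continuous_on (cbox a b) v" using v by (rule continuous_on_subset) simp
        show "continuous_on (cbox a b) (\<lambda>y. g (x - y))"
          by (rule continuous_on_compose2[OF gc]) (auto intro!: continuous_intros)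
      qed
    qed auto
    moreover have "blinfun_apply (integral (cbox a b) (F x0)) = (\<lambda>d. integral (cbox a b) (\<lambda>y. v y * D (x0 - y) d))"
      by (rule ext) (simp add: blinfun_apply_integral[OF integrable_continuous[OF cFx]] F_apply)
    ultimately show "((\<lambda>x. integral (cbox a b) (\<lambda>y. v y * g (x - y))) has_derivative
        (\<lambda>d. integral (cbox a b) (\<lambda>y. v y * D (x0 - y) d))) (at x0)"
      by simp
  next
    fix i :: 'a assume "i \<in> Basis"
    then show "Ck k (\<lambda>x. integral (cbox a b) (\<lambda>y. v y * D (x - y) i))"
      using Suc.IH[OF D(2)] by simp
  qed
qed

section \<open>Mollification\<close>

lemma lborel_distr_reflect: "distr lborel borel (\<lambda>y. x - y) = (lborel :: 'a::euclidean_space measure)"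
  using lborel_affine[of "-1" x] by (simp add: density_1)

lemma integrable_compact_support:
  fixes v :: "'a::euclidean_space \<Rightarrow> real"
  assumes "continuous_on UNIV v" "compact K" "\<And>x. x \<notin> K \<Longrightarrow> v x = 0"
  shows "integrable lborel v"
proof -
  have "integrable lborel (\<lambda>x. indicator K x *\<^sub>R v x)"
    using assms by (intro borel_integrable_compact) (auto intro: continuous_on_subset)
  also have "(\<lambda>x. indicator K x *\<^sub>R v x) = v" using assms(3) by (auto simp: indicator_def fun_eq_iff)
  finally show ?thesis .
qed

lemma bump_exists:
  fixes e :: real
  assumes e: "0 < e"
  shows "\<exists>\<rho>::'a::euclidean_space \<Rightarrow> real. (\<forall>k. Ck k \<rho>) \<and> (\<forall>x. 0 \<le> \<rho> x) \<and> (\<forall>x. x \<notin> ball 0 e \<longrightarrow> \<rho> x = 0)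
      \<and> (\<integral>\<^sup>+ x. ennreal (\<rho> x) \<partial>lborel) = 1"
proof -
  define h where "h x = flat_exp 0 (e\<^sup>2 - x \<bullet> x)" for x :: 'a
  have hk: "Ck k h" for k unfolding h_def[abs_def] by (intro Ck_flat_exp_compose Ck_sphere)
  have [measurable]: "h \<in> borel_measurable borel"
    using Ck_imp_continuous[OF hk[of 0]] by (rule borel_measurable_continuous_onI)
  have h0: "0 \<le> h x" for x by (simp add: h_def flat_exp_nonneg)
  have hz: "h x = 0" if "x \<notin> ball 0 e" for x
  proof -
    have "e\<^sup>2 \<le> (norm x)\<^sup>2" using that e by (intro power_mono) auto
    then show ?thesis by (simp add: h_def flat_exp_def dot_square_norm)
  qed
  have h1: "h x \<le> 1" for x by (simp add: h_def flat_exp_def)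
  define I where "I = (\<integral>\<^sup>+ x. ennreal (h x) \<partial>lborel)"
  have "I \<le> (\<integral>\<^sup>+ x. indicator (ball (0::'a) e) x \<partial>lborel)"
    unfolding I_def using h1 hz by (intro nn_integral_mono) (auto simp: indicator_def)
  also have "\<dots> = emeasure lborel (ball (0::'a) e)" by (subst nn_integral_indicator) auto
  also have "\<dots> < \<infinity>" using emeasure_lborel_ball_finite by auto
  finally have fin: "I < \<infinity>" .
  have "0 < I"
  proof (rule ccontr)
    assume "\<not> 0 < I"
    then have "AE x in lborel. h x = 0"
      unfolding I_def by (subst (asm) zero_less_iff_neq_zero, simp, subst (asm) nn_integral_0_iff_AE)
        (auto elim!: eventually_mono simp: h0 antisym)
    moreover have pos: "0 < h x" if "x \<in> ball 0 e" for x
    proof -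
      have "(norm x)\<^sup>2 < e\<^sup>2" using that e by (intro power_strict_mono) auto
      then show ?thesis by (simp add: h_def flat_exp_def dot_square_norm)
    qed
    ultimately have "AE x in lborel. x \<notin> ball (0::'a) e"
      by (elim eventually_mono) (metis less_irrefl)
    then have "ball (0::'a) e \<in> null_sets lborel"
      by (subst (asm) AE_iff_null_sets[symmetric]) auto
    then show False using open_not_negligible[of "ball (0::'a) e"] e
      by (auto simp: negligible_iff_null_sets null_sets_completionI)
  qed
  then obtain c where c: "I = ennreal c" "0 < c"
    using fin by (cases I) auto
  define \<rho> where "\<rho> x = (1 / c) * h x" for x
  have "(\<integral>\<^sup>+ x. ennreal (\<rho> x) \<partial>lborel) = ennreal (1/c) * I"
    unfolding I_def \<rho>_def using h0 c by (subst nn_integral_cmult[symmetric]) (auto simp flip: ennreal_mult)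
  also have "\<dots> = 1" using c by (simp flip: ennreal_mult)
  finally have "(\<integral>\<^sup>+ x. ennreal (\<rho> x) \<partial>lborel) = 1" .
  moreover have "Ck k \<rho>" for k unfolding \<rho>_def[abs_def] by (intro Ck_mult Ck_const hk)
  ultimately show ?thesis using h0 hz c by (intro exI[of _ \<rho>]) (auto simp: \<rho>_def)
qed

text \<open>The hypothesis on \<open>M\<close> holds when \<open>M\<close> is the average of the translates of \<open>v\<close> with weight \<open>\<rho>\<close>; it is
  Jensen's inequality under the integral over pairs that compares the energies.\<close>

lemma energy_average_le:
  fixes v M \<rho> :: "'a::euclidean_space \<Rightarrow> real"
  assumes p: "1 \<le> p"
    and [measurable]: "v \<in> borel_measurable borel" "M \<in> borel_measurable borel" "\<rho> \<in> borel_measurable borel"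
    and \<rho>: "\<And>x. 0 \<le> \<rho> x" "(\<integral>\<^sup>+ x. ennreal (\<rho> x) \<partial>lborel) = 1"
    and M: "\<And>x y. ennreal \<bar>M x - M y\<bar> \<le> (\<integral>\<^sup>+ z. ennreal (\<rho> z) * ennreal \<bar>v (x - z) - v (y - z)\<bar> \<partial>lborel)"
  shows "energy s p M \<le> energy s p v"
proof -
  define \<alpha> where "\<alpha> = real DIM('a) + s * p"
  define k where "k x y z = ennreal (\<rho> z) * ennreal (\<bar>v (x - z) - v (y - z)\<bar> powr p / norm (x - y) powr \<alpha>)" for x y z :: 'a
  have le: "ennreal (\<bar>M x - M y\<bar> powr p / norm (x - y) powr \<alpha>) \<le> (\<integral>\<^sup>+ z. k x y z \<partial>lborel)" for x y
  proof -
    let ?\<mu> = "density lborel (\<lambda>z. ennreal (\<rho> z))"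
    let ?f = "\<lambda>z. \<bar>v (x - z) - v (y - z)\<bar>"
    have [measurable]: "?f \<in> borel_measurable borel" by measurable
    have "ennreal (\<bar>M x - M y\<bar> powr p) = epowr (ennreal \<bar>M x - M y\<bar>) p"
      by (simp add: epowr_ennreal)
    also have "\<dots> \<le> epowr (\<integral>\<^sup>+ z. ennreal (\<rho> z) * ennreal (?f z) \<partial>lborel) p"
      using p by (intro epowr_mono M) auto
    also have "\<dots> = epowr (\<integral>\<^sup>+ z. ennreal (?f z) \<partial>?\<mu>) p"
      by (subst nn_integral_density) auto
    also have "\<dots> \<le> (\<integral>\<^sup>+ z. ennreal (?f z powr p) \<partial>?\<mu>)"
      using p \<rho>(2) by (intro nn_integral_jensen) (auto simp: emeasure_density)
    also have "\<dots> = (\<integral>\<^sup>+ z. ennreal (\<rho> z) * ennreal (?f z powr p) \<partial>lborel)"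
      by (subst nn_integral_density) auto
    finally have *: "ennreal (\<bar>M x - M y\<bar> powr p) \<le> (\<integral>\<^sup>+ z. ennreal (\<rho> z) * ennreal (?f z powr p) \<partial>lborel)" .
    have "ennreal (\<bar>M x - M y\<bar> powr p / norm (x - y) powr \<alpha>) = ennreal (1 / norm (x - y) powr \<alpha>) * ennreal (\<bar>M x - M y\<bar> powr p)"
      by (simp flip: ennreal_mult)
    also have "\<dots> \<le> ennreal (1 / norm (x - y) powr \<alpha>) * (\<integral>\<^sup>+ z. ennreal (\<rho> z) * ennreal (?f z powr p) \<partial>lborel)"
      by (intro mult_left_mono *) auto
    also have "\<dots> = (\<integral>\<^sup>+ z. ennreal (1 / norm (x - y) powr \<alpha>) * (ennreal (\<rho> z) * ennreal (?f z powr p)) \<partial>lborel)"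
      by (subst nn_integral_cmult) auto
    also have "\<dots> = (\<integral>\<^sup>+ z. k x y z \<partial>lborel)"
      unfolding k_def using \<rho>(1) by (intro nn_integral_cong) (simp flip: ennreal_mult)
    finally show ?thesis .
  qed
  have [measurable]: "(\<lambda>(x, y, z). k x y z) \<in> borel_measurable (borel \<Otimes>\<^sub>M borel \<Otimes>\<^sub>M borel)"
    unfolding k_def by measurable
  have m1 [measurable]: "(\<lambda>(y, z). k x y z) \<in> borel_measurable (borel \<Otimes>\<^sub>M borel)" for x
    unfolding k_def by measurable
  have m2 [measurable]: "(\<lambda>(x, z). \<integral>\<^sup>+ y. k x y z \<partial>lborel) \<in> borel_measurable (borel \<Otimes>\<^sub>M borel)"
    unfolding k_def by measurable
  have "energy s p M \<le> (\<integral>\<^sup>+ x. \<integral>\<^sup>+ y. \<integral>\<^sup>+ z. k x y z \<partial>lborel \<partial>lborel \<partial>lborel)"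
    unfolding energy_iterated[OF assms(3)] \<alpha>_def[symmetric] by (intro nn_integral_mono le)
  also have "\<dots> = (\<integral>\<^sup>+ x. \<integral>\<^sup>+ z. \<integral>\<^sup>+ y. k x y z \<partial>lborel \<partial>lborel \<partial>lborel)"
    by (intro nn_integral_cong lborel_pair.Fubini'[symmetric]) measurable
  also have "\<dots> = (\<integral>\<^sup>+ z. \<integral>\<^sup>+ x. \<integral>\<^sup>+ y. k x y z \<partial>lborel \<partial>lborel \<partial>lborel)"
    by (intro lborel_pair.Fubini'[symmetric]) measurable
  also have "\<dots> = (\<integral>\<^sup>+ z. ennreal (\<rho> z) * energy s p v \<partial>lborel)"
  proof (rule nn_integral_cong)
    fix z :: 'a
    have [measurable]: "(\<lambda>x. v (x - z)) \<in> borel_measurable borel" by measurable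
    have "(\<integral>\<^sup>+ x. \<integral>\<^sup>+ y. k x y z \<partial>lborel \<partial>lborel) = ennreal (\<rho> z) * energy s p (\<lambda>x. v (x - z))"
      unfolding k_def by (simp add: energy_iterated nn_integral_cmult \<alpha>_def)
    then show "(\<integral>\<^sup>+ x. \<integral>\<^sup>+ y. k x y z \<partial>lborel \<partial>lborel) = ennreal (\<rho> z) * energy s p v"
      by (simp add: energy_translate)
  qed
  also have "\<dots> = energy s p v" by (simp add: nn_integral_multc \<rho>(2))
  finally show ?thesis .
qed

text \<open>Mollification reaches continuous functions from test functions at no cost in energy.  The compact
  set \<open>K'\<close> contains the supports of all approximations, so that uniform convergence gives convergence
  of integrals.\<close>

lemma mollify:
  fixes v :: "'a::euclidean_space \<Rightarrow> real"
  assumes p: "1 \<le> p" and v: "continuous_on UNIV v" and K: "compact K" "K \<subseteq> \<Omega>" "\<And>x. x \<notin> K \<Longrightarrow> v x = 0"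
    and \<Omega>: "open \<Omega>"
  shows "\<exists>K'. compact K' \<and> K' \<subseteq> \<Omega> \<and>
     (\<forall>\<delta>>0. \<exists>\<phi>\<in>C0inf \<Omega>. (\<forall>x. x \<notin> K' \<longrightarrow> \<phi> x = 0) \<and> (\<forall>x. \<bar>\<phi> x - v x\<bar> \<le> \<delta>) \<and> energy s p \<phi> \<le> energy s p v)"
proof (cases "K = {}")
  case True
  then have "v = (\<lambda>x. 0)" using K by auto
  moreover have "(\<lambda>x. 0) \<in> C0inf \<Omega>" by (simp add: C0inf_def smooth_def Ck_const)
  ultimately show ?thesis by (intro exI[of _ "{}"]) (auto intro!: bexI[of _ "\<lambda>x. 0"])
next
  case False
  obtain e0 where e0: "0 < e0" "{x. infdist x K \<le> e0} \<subseteq> \<Omega>"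
    using compact_in_open_separated[OF False K(1) \<Omega> K(2)] by blast
  \<comment> \<open>room for the supports of all mollifications of radius at most \<open>e0\<close>\<close>
  define K' where "K' = {x. infdist x K \<le> e0}"
  have K': "compact K'" "K' \<subseteq> \<Omega>" using e0 compact_infdist_le[OF False K(1) e0(1)] by (auto simp: K'_def)
  obtain a where a: "K \<subseteq> cbox (- a) a"
    using bounded_subset_cbox_symmetric[OF compact_imp_bounded[OF K(1)]] by blast
  have [measurable]: "v \<in> borel_measurable borel" using v by (rule borel_measurable_continuous_onI)
  have "uniformly_continuous_on UNIV v"
  proof -
    have "uniformly_continuous_on K' v"
      using K'(1) v by (intro compact_uniformly_continuous) (auto intro: continuous_on_subset)
    then have uK: "\<And>d. 0 < d \<Longrightarrow> \<exists>e>0. \<forall>x\<in>K'. \<forall>y\<in>K'. dist y x < e \<longrightarrow> dist (v y) (v x) < d"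
      unfolding uniformly_continuous_on_def by simp
    show ?thesis unfolding uniformly_continuous_on_def
    proof (intro allI impI)
      fix d :: real assume "0 < d"
      then obtain e where e: "0 < e" "\<And>x y. x \<in> K' \<Longrightarrow> y \<in> K' \<Longrightarrow> dist y x < e \<Longrightarrow> dist (v y) (v x) < d"
        using uK by metis
      have "dist (v y) (v x) < d" if "dist y x < min e e0" for x y
      proof (cases "x \<in> K \<or> y \<in> K")
        case True
        have "infdist x K \<le> e0 \<and> infdist y K \<le> e0"
          using True
        proof
          assume "x \<in> K"
          then have "infdist x K \<le> dist x x" "infdist y K \<le> dist y x" by (auto intro: infdist_le)
          then show ?thesis using that e0 by auto
        next
          assume "y \<in> K"
          then have "infdist x K \<le> dist x y" "infdist y K \<le> dist y y" by (auto intro: infdist_le)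
          then show ?thesis using that e0 by (auto simp: dist_commute)
        qed
        then show ?thesis using e that by (auto simp: K'_def)
      next
        case False
        then show ?thesis using K(3) \<open>0 < d\<close> by auto
      qed
      then show "\<exists>e>0. \<forall>x\<in>UNIV. \<forall>x'\<in>UNIV. dist x' x < e \<longrightarrow> dist (v x') (v x) < d"
        using e(1) e0(1) by (intro exI[of _ "min e e0"]) auto
    qed
  qed
  then have uc: "\<And>d. 0 < d \<Longrightarrow> \<exists>e>0. \<forall>x y. dist y x < e \<longrightarrow> dist (v y) (v x) < d"
    unfolding uniformly_continuous_on_def by simp
  have "\<exists>\<phi>\<in>C0inf \<Omega>. (\<forall>x. x \<notin> K' \<longrightarrow> \<phi> x = 0) \<and> (\<forall>x. \<bar>\<phi> x - v x\<bar> \<le> \<delta>) \<and> energy s p \<phi> \<le> energy s p v"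
    if \<delta>: "0 < \<delta>" for \<delta> :: real
  proof -
    obtain e1 where e1: "0 < e1" "\<And>x y. dist x y < e1 \<Longrightarrow> dist (v x) (v y) < \<delta>"
      using uc[OF \<delta>] by metis
    define e where "e = min e0 e1"
    have e: "0 < e" using e0 e1 by (simp add: e_def)
    obtain \<rho> :: "'a \<Rightarrow> real" where \<rho>: "\<And>k. Ck k \<rho>" "\<And>x. 0 \<le> \<rho> x" "\<And>x. x \<notin> ball 0 e \<Longrightarrow> \<rho> x = 0"
        "(\<integral>\<^sup>+ x. ennreal (\<rho> x) \<partial>lborel) = 1"
      using bump_exists[OF e] by blast
    have \<rho>c: "continuous_on UNIV \<rho>" using \<rho>(1)[of 0] by (rule Ck_imp_continuous)
    then have [measurable]: "\<rho> \<in> borel_measurable borel" by (rule borel_measurable_continuous_onI)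
    define M where "M x = integral (cbox (- a) a) (\<lambda>y. v y * \<rho> (x - y))" for x
    have Mk: "Ck k M" for k unfolding M_def[abs_def] using v \<rho>(1) by (rule Ck_integral_shift)
    have [measurable]: "M \<in> borel_measurable borel"
      using Ck_imp_continuous[OF Mk[of 0]] by (rule borel_measurable_continuous_onI)
    have int: "integrable lborel (\<lambda>z. v (x - z) * \<rho> z)" for x
    proof (rule integrable_compact_support[where K = "cball 0 e"])
      show "continuous_on UNIV (\<lambda>z. v (x - z) * \<rho> z)"
        by (rule continuous_on_mult[OF continuous_on_compose2[OF v] \<rho>c]) (auto intro!: continuous_intros)
    qed (use \<rho>(3) in auto)
    have M_eq: "M x = (\<integral>z. v (x - z) * \<rho> z \<partial>lborel)" for x
    proof -
      have i: "integrable lborel (\<lambda>y. v y * \<rho> (x - y))"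
      proof (rule integrable_compact_support[OF _ K(1)])
        show "continuous_on UNIV (\<lambda>z. v z * \<rho> (x - z))"
          by (rule continuous_on_mult[OF v continuous_on_compose2[OF \<rho>c]]) (auto intro!: continuous_intros)
      qed (use K(3) in auto)
      have "M x = integral UNIV (\<lambda>y. if y \<in> cbox (- a) a then v y * \<rho> (x - y) else 0)"
        unfolding M_def by (rule Henstock_Kurzweil_Integration.integral_restrict_UNIV[symmetric])
      also have "(\<lambda>y. if y \<in> cbox (- a) a then v y * \<rho> (x - y) else 0) = (\<lambda>y. v y * \<rho> (x - y))"
        using a K(3) by (auto simp: fun_eq_iff)
      also have "integral UNIV (\<lambda>y. v y * \<rho> (x - y)) = (\<integral>y. v y * \<rho> (x - y) \<partial>lborel)"
        by (rule integral_lborel[OF i])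
      also have "\<dots> = (\<integral>y. v y * \<rho> (x - y) \<partial>(distr lborel borel (\<lambda>y. x - y)))"
        by (simp add: lborel_distr_reflect)
      also have "\<dots> = (\<integral>z. v (x - z) * \<rho> z \<partial>lborel)"
        by (subst integral_distr) auto
      finally show ?thesis .
    qed
    have int\<rho>: "integrable lborel \<rho>"
      by (rule integrable_compact_support[OF \<rho>c, of "cball 0 e"]) (use \<rho>(3) in auto)
    have I\<rho>: "(\<integral>z. \<rho> z \<partial>lborel) = 1"
      using \<rho>(4) \<rho>(2) by (subst integral_eq_nn_integral) auto
    have near: "\<bar>M x - v x\<bar> \<le> \<delta>" for x
    proof -
      have "M x - v x = (\<integral>z. v (x - z) * \<rho> z \<partial>lborel) - (\<integral>z. v x * \<rho> z \<partial>lborel)"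
        using I\<rho> by (simp add: M_eq)
      also have "\<dots> = (\<integral>z. v (x - z) * \<rho> z - v x * \<rho> z \<partial>lborel)"
        using int int\<rho> by (intro Bochner_Integration.integral_diff[symmetric]) auto
      also have "\<bar>\<dots>\<bar> \<le> (\<integral>z. \<bar>v (x - z) * \<rho> z - v x * \<rho> z\<bar> \<partial>lborel)" by (rule integral_abs_bound)
      also have "\<dots> \<le> (\<integral>z. \<delta> * \<rho> z \<partial>lborel)"
      proof (rule integral_mono)
        show "integrable lborel (\<lambda>z. \<bar>v (x - z) * \<rho> z - v x * \<rho> z\<bar>)" using int int\<rho> by auto
        show "integrable lborel (\<lambda>z. \<delta> * \<rho> z)" using int\<rho> by auto
        fix z
        show "\<bar>v (x - z) * \<rho> z - v x * \<rho> z\<bar> \<le> \<delta> * \<rho> z"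
        proof (cases "z \<in> ball 0 e")
          case True
          then have "dist (v (x - z)) (v x) < \<delta>" by (intro e1) (auto simp: dist_norm e_def)
          then have "\<bar>v (x - z) - v x\<bar> * \<rho> z \<le> \<delta> * \<rho> z" using \<rho>(2) by (intro mult_right_mono) (auto simp: dist_real_def)
          then show ?thesis using \<rho>(2)[of z] by (simp add: abs_mult flip: left_diff_distrib)
        qed (simp add: \<rho>(3))
      qed
      also have "\<dots> = \<delta>" using I\<rho> by simp
      finally show ?thesis .
    qed
    have supp: "M x = 0" if "x \<notin> K'" for x
    proof -
      have "v (x - z) * \<rho> z = 0" for z
      proof (cases "z \<in> ball 0 e")
        case True
        have "x - z \<notin> K"
        proof
          assume "x - z \<in> K"
          then have "infdist x K \<le> dist x (x - z)" by (rule infdist_le)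
          also have "\<dots> < e0" using True by (simp add: dist_norm e_def)
          finally show False using that by (simp add: K'_def)
        qed
        then show ?thesis using K(3) by simp
      qed (simp add: \<rho>(3))
      then have "(\<lambda>z. v (x - z) * \<rho> z) = (\<lambda>z. 0)" by (rule ext)
      then show ?thesis by (simp only: M_eq integral_zero)
    qed
    have cl: "closure {x. M x \<noteq> 0} \<subseteq> K'"
      using supp K'(1) by (intro closure_minimal compact_imp_closed) auto
    have "M \<in> C0inf \<Omega>"
      using Mk cl K' by (auto simp: C0inf_def smooth_def compact_eq_bounded_closed intro: bounded_subset)
    moreover have "energy s p M \<le> energy s p v"
    proof (rule energy_average_le[OF p _ _ _ \<rho>(2) \<rho>(4)])
      fix x y
      have "M x - M y = (\<integral>z. v (x - z) * \<rho> z - v (y - z) * \<rho> z \<partial>lborel)"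
        unfolding M_eq using int by (intro Bochner_Integration.integral_diff[symmetric]) auto
      also have "ennreal \<bar>\<dots>\<bar> \<le> (\<integral>\<^sup>+ z. ennreal \<bar>v (x - z) * \<rho> z - v (y - z) * \<rho> z\<bar> \<partial>lborel)"
        using integral_norm_bound_ennreal[of lborel "\<lambda>z. v (x - z) * \<rho> z - v (y - z) * \<rho> z"] int by simp
      also have "\<dots> = (\<integral>\<^sup>+ z. ennreal (\<rho> z) * ennreal \<bar>v (x - z) - v (y - z)\<bar> \<partial>lborel)"
      proof (rule nn_integral_cong)
        fix z
        have "\<bar>v (x - z) * \<rho> z - v (y - z) * \<rho> z\<bar> = \<rho> z * \<bar>v (x - z) - v (y - z)\<bar>"
          using \<rho>(2)[of z] by (simp add: abs_mult flip: left_diff_distrib)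
        then show "ennreal \<bar>v (x - z) * \<rho> z - v (y - z) * \<rho> z\<bar> = ennreal (\<rho> z) * ennreal \<bar>v (x - z) - v (y - z)\<bar>"
          using \<rho>(2)[of z] by (simp add: ennreal_mult)
      qed
      finally show "ennreal \<bar>M x - M y\<bar> \<le> (\<integral>\<^sup>+ z. ennreal (\<rho> z) * ennreal \<bar>v (x - z) - v (y - z)\<bar> \<partial>lborel)" .
    qed measurable
    ultimately show ?thesis using near supp by blast
  qed
  then show ?thesis using K' by blast
qed

section \<open>Test functions and their completion\<close>

lemma C0inf_iff: "f \<in> C0inf \<Omega> \<longleftrightarrow> smooth f \<and> (\<exists>K. compact K \<and> K \<subseteq> \<Omega> \<and> (\<forall>x. x \<notin> K \<longrightarrow> f x = 0))"
proof
  assume "f \<in> C0inf \<Omega>"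
  then show "smooth f \<and> (\<exists>K. compact K \<and> K \<subseteq> \<Omega> \<and> (\<forall>x. x \<notin> K \<longrightarrow> f x = 0))"
    using closure_subset[of "{x. f x \<noteq> 0}"] by (auto simp: C0inf_def intro!: exI[of _ "closure {x. f x \<noteq> 0}"])
next
  assume "smooth f \<and> (\<exists>K. compact K \<and> K \<subseteq> \<Omega> \<and> (\<forall>x. x \<notin> K \<longrightarrow> f x = 0))"
  then obtain K where K: "smooth f" "compact K" "K \<subseteq> \<Omega>" "\<And>x. x \<notin> K \<Longrightarrow> f x = 0" by blast
  then have "closure {x. f x \<noteq> 0} \<subseteq> K"
    by (intro closure_minimal compact_imp_closed) auto
  then show "f \<in> C0inf \<Omega>"
    using K by (auto simp: C0inf_def compact_eq_bounded_closed intro: bounded_subset)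
qed

lemma C0inf_smooth: "f \<in> C0inf \<Omega> \<Longrightarrow> smooth f"
  by (simp add: C0inf_def)

lemma C0inf_compact_support:
  assumes "f \<in> C0inf \<Omega>"
  obtains K where "compact K" "K \<subseteq> \<Omega>" "\<And>x. x \<notin> K \<Longrightarrow> f x = 0"
  using assms unfolding C0inf_iff by blast

lemma C0inf_continuous: "f \<in> C0inf \<Omega> \<Longrightarrow> continuous_on UNIV f"
  using Ck_imp_continuous[of 0 f] by (simp add: C0inf_def smooth_def)

lemma C0inf_borel [measurable_dest]: "f \<in> C0inf \<Omega> \<Longrightarrow> f \<in> borel_measurable borel"
  by (intro borel_measurable_continuous_onI C0inf_continuous)

lemma C0inf_zero_off: "f \<in> C0inf \<Omega> \<Longrightarrow> x \<notin> \<Omega> \<Longrightarrow> f x = 0"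
  by (metis C0inf_compact_support subsetD)

lemma C0inf_integrable: "f \<in> C0inf \<Omega> \<Longrightarrow> integrable lborel f"
  by (metis C0inf_compact_support C0inf_continuous integrable_compact_support)

lemma C0inf_zero: "(\<lambda>x. 0) \<in> C0inf \<Omega>"
  by (simp add: C0inf_def smooth_def Ck_const)

lemma C0inf_cmult:
  assumes "f \<in> C0inf \<Omega>"
  shows "(\<lambda>x. c * f x) \<in> C0inf \<Omega>"
proof -
  obtain K where "compact K" "K \<subseteq> \<Omega>" "\<And>x. x \<notin> K \<Longrightarrow> f x = 0"
    using assms by (rule C0inf_compact_support) blast
  then show ?thesis using C0inf_smooth[OF assms]
    unfolding C0inf_iff by (auto intro: smooth_cmult)
qed

lemma C0inf_add:
  assumes "f \<in> C0inf \<Omega>" "g \<in> C0inf \<Omega>"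
  shows "(\<lambda>x. f x + g x) \<in> C0inf \<Omega>"
proof -
  obtain K where "compact K" "K \<subseteq> \<Omega>" "\<And>x. x \<notin> K \<Longrightarrow> f x = 0"
    using assms(1) by (rule C0inf_compact_support) blast
  moreover obtain L where "compact L" "L \<subseteq> \<Omega>" "\<And>x. x \<notin> L \<Longrightarrow> g x = 0"
    using assms(2) by (rule C0inf_compact_support) blast
  ultimately have "compact (K \<union> L)" "K \<union> L \<subseteq> \<Omega>" "\<And>x. x \<notin> K \<union> L \<Longrightarrow> f x + g x = 0"
    by (auto intro: compact_Un)
  then show ?thesis using C0inf_smooth[OF assms(1)] C0inf_smooth[OF assms(2)]
    unfolding C0inf_iff by (blast intro: smooth_add)
qed

lemma C0inf_diff:
  assumes "f \<in> C0inf \<Omega>" "g \<in> C0inf \<Omega>"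
  shows "(\<lambda>x. f x - g x) \<in> C0inf \<Omega>"
  using C0inf_add[OF assms(1) C0inf_cmult[OF assms(2), of "-1"]] by simp

text \<open>A smooth function with compact support is bounded and Lipschitz.\<close>

lemma C0inf_energy_finite:
  fixes u :: "'a::euclidean_space \<Rightarrow> real"
  assumes sp: "0 < s" "s < 1" "1 < p" and u: "u \<in> C0inf \<Omega>"
  shows "energy s p u < \<infinity>"
proof -
  obtain K where K: "compact K" "\<And>x. x \<notin> K \<Longrightarrow> u x = 0"
    using u by (rule C0inf_compact_support) blast
  obtain R where "\<And>x. x \<in> K \<Longrightarrow> norm x < R"
    using compact_imp_bounded[OF K(1)] by (auto simp: bounded_pos_less)
  then have R: "\<And>x. x \<notin> ball 0 R \<Longrightarrow> u x = 0" using K(2) by auto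
  have "Ck 1 u" using C0inf_smooth[OF u] unfolding smooth_def by blast
  then have "\<exists>L\<ge>0. \<forall>x y. \<bar>u x - u y\<bar> \<le> L * norm (x - y)" using R by (rule Ck_imp_Lipschitz)
  then obtain L where L: "0 \<le> L" "\<And>x y. \<bar>u x - u y\<bar> \<le> L * norm (x - y)"
    by auto
  have "compact (u ` K)"
    using K(1) C0inf_continuous[OF u] by (intro compact_continuous_image) (auto intro: continuous_on_subset)
  then obtain B where B: "\<And>x. x \<in> K \<Longrightarrow> \<bar>u x\<bar> \<le> B" "0 < B"
    using compact_imp_bounded[of "u ` K"] by (auto simp: bounded_pos)
  then have B': "\<bar>u x\<bar> \<le> B" for x using K(2)[of x] by (cases "x \<in> K") auto
  define C where "C = max L (2 * B)"
  have C: "0 \<le> C" "L \<le> C" "2 * B \<le> C" using L by (auto simp: C_def)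
  have "\<bar>u x - u y\<bar> \<le> C * min (norm (x - y)) 1" for x y
  proof (cases "norm (x - y) \<le> 1")
    case True
    have "L * norm (x - y) \<le> C * norm (x - y)" using C by (intro mult_right_mono) auto
    then show ?thesis using L(2)[of x y] True by simp
  next
    case False
    then show ?thesis using B'[of x] B'[of y] C by simp
  qed
  then show ?thesis using C(1) u sp R by (intro energy_finite[where K = C and R = R]) auto
qed

lemma C0inf_gnorm_finite:
  "0 < s \<Longrightarrow> s < 1 \<Longrightarrow> 1 < p \<Longrightarrow> u \<in> C0inf \<Omega> \<Longrightarrow> gnorm s p u < \<infinity>"
  using C0inf_energy_finite[of s p u \<Omega>] by (simp add: gnorm_def)

lemma tendsto_close_ennreal:
  fixes a b d :: "nat \<Rightarrow> ennreal"
  assumes a: "a \<longlonglongrightarrow> l" and l: "l < top" and d: "d \<longlonglongrightarrow> 0"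
    and le: "\<And>n. b n \<le> a n + d n" "\<And>n. a n \<le> b n + d n"
  shows "b \<longlonglongrightarrow> l"
proof (rule tendsto_sandwich)
  show "(\<lambda>n. a n - d n) \<longlonglongrightarrow> l"
    using tendsto_diff_ennreal[OF a d] l by simp
  show "(\<lambda>n. a n + d n) \<longlonglongrightarrow> l"
    using tendsto_add[OF a d] by simp
  show "\<forall>\<^sub>F n in sequentially. b n \<le> a n + d n" using le by simp
  have "\<forall>\<^sub>F n in sequentially. a n < top \<and> d n < top"
    using order_tendstoD(2)[OF a l] order_tendstoD(2)[OF d, of top] by (auto elim: eventually_elim2)
  then show "\<forall>\<^sub>F n in sequentially. a n - d n \<le> b n"
    by eventually_elim (use le in \<open>auto simp: ennreal_minus_le_iff add.commute\<close>)
qed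

lemma cauchy_seqs_C0inf: "\<phi> \<in> cauchy_seqs s p \<Omega> \<Longrightarrow> \<phi> n \<in> C0inf \<Omega>"
  by (simp add: cauchy_seqs_def)

lemma cauchy_seqs_const: "u \<in> C0inf \<Omega> \<Longrightarrow> (\<lambda>n. u) \<in> cauchy_seqs s p \<Omega>"
  by (simp add: cauchy_seqs_def)

lemma cauchy_seqsD:
  assumes "\<phi> \<in> cauchy_seqs s p \<Omega>" "0 < e"
  shows "\<exists>M. \<forall>m\<ge>M. \<forall>n\<ge>M. gnorm s p (\<lambda>x. \<phi> m x - \<phi> n x) < e"
  using assms by (simp add: cauchy_seqs_def)

lemma cauchy_seqs_add:
  assumes \<phi>: "\<phi> \<in> cauchy_seqs s p \<Omega>" and \<psi>: "\<psi> \<in> cauchy_seqs s p \<Omega>" and p: "1 \<le> p"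
  shows "(\<lambda>n x. \<phi> n x + \<psi> n x) \<in> cauchy_seqs s p \<Omega>"
proof -
  note [measurable] = C0inf_borel[OF cauchy_seqs_C0inf[OF \<phi>]] C0inf_borel[OF cauchy_seqs_C0inf[OF \<psi>]]
  have "\<exists>M. \<forall>m\<ge>M. \<forall>n\<ge>M. gnorm s p (\<lambda>x. \<phi> m x + \<psi> m x - (\<phi> n x + \<psi> n x)) < e" if e: "0 < e" for e
  proof -
    have e2: "0 < e / 2" using e by (simp add: ennreal_zero_less_divide)
    obtain M1 M2 where M: "\<And>m n. m \<ge> M1 \<Longrightarrow> n \<ge> M1 \<Longrightarrow> gnorm s p (\<lambda>x. \<phi> m x - \<phi> n x) < e/2"
      "\<And>m n. m \<ge> M2 \<Longrightarrow> n \<ge> M2 \<Longrightarrow> gnorm s p (\<lambda>x. \<psi> m x - \<psi> n x) < e/2"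
      using cauchy_seqsD[OF \<phi> e2] cauchy_seqsD[OF \<psi> e2] by metis
    have "gnorm s p (\<lambda>x. \<phi> m x + \<psi> m x - (\<phi> n x + \<psi> n x)) < e" if "m \<ge> max M1 M2" "n \<ge> max M1 M2" for m n
    proof -
      have "gnorm s p (\<lambda>x. \<phi> m x + \<psi> m x - (\<phi> n x + \<psi> n x))
          = gnorm s p (\<lambda>x. (\<phi> m x - \<phi> n x) + (\<psi> m x - \<psi> n x))" by (simp add: algebra_simps)
      also have "\<dots> \<le> gnorm s p (\<lambda>x. \<phi> m x - \<phi> n x) + gnorm s p (\<lambda>x. \<psi> m x - \<psi> n x)"
        using p by (intro gnorm_triangle) auto
      also have "\<dots> < e/2 + e/2" using M that by (intro add_strict_mono) auto
      also have "\<dots> = e" 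
      proof -
        have "e/2 + e/2 = (e * 2) / 2" by (simp add: mult_2_right flip: add_divide_distrib_ennreal)
        also have "\<dots> = e" by (rule mult_divide_eq_ennreal) auto
        finally show ?thesis .
      qed
      finally show ?thesis .
    qed
    then show ?thesis by blast
  qed
  then show ?thesis using \<phi> \<psi> by (auto simp: cauchy_seqs_def intro: C0inf_add)
qed

lemma cauchy_seqs_cmult:
  assumes \<phi>: "\<phi> \<in> cauchy_seqs s p \<Omega>" and p: "1 \<le> p"
  shows "(\<lambda>n x. c * \<phi> n x) \<in> cauchy_seqs s p \<Omega>"
proof -
  note [measurable] = C0inf_borel[OF cauchy_seqs_C0inf[OF \<phi>]]
  have eq: "gnorm s p (\<lambda>x. c * \<phi> m x - c * \<phi> n x) = ennreal \<bar>c\<bar> * gnorm s p (\<lambda>x. \<phi> m x - \<phi> n x)" for m n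
    using gnorm_cmult[of "\<lambda>x. \<phi> m x - \<phi> n x" p s c] p by (simp add: right_diff_distrib)
  have "\<exists>M. \<forall>m\<ge>M. \<forall>n\<ge>M. gnorm s p (\<lambda>x. c * \<phi> m x - c * \<phi> n x) < e" if e: "0 < e" for e
  proof -
    obtain d where d: "\<bar>c\<bar> \<le> d" "0 < d" by (meson abs_ge_zero le_less_trans less_imp_le lt_ex gt_ex)
    have e2: "0 < e / ennreal d" using e by (simp add: ennreal_zero_less_divide)
    obtain M where M: "\<And>m n. m \<ge> M \<Longrightarrow> n \<ge> M \<Longrightarrow> gnorm s p (\<lambda>x. \<phi> m x - \<phi> n x) < e / ennreal d"
      using cauchy_seqsD[OF \<phi> e2] by metis
    have "gnorm s p (\<lambda>x. c * \<phi> m x - c * \<phi> n x) < e" if "m \<ge> M" "n \<ge> M" for m n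
    proof -
      have "ennreal \<bar>c\<bar> * gnorm s p (\<lambda>x. \<phi> m x - \<phi> n x) \<le> ennreal d * gnorm s p (\<lambda>x. \<phi> m x - \<phi> n x)"
        using d by (intro mult_right_mono ennreal_leI) auto
      also have "\<dots> < ennreal d * (e / ennreal d)"
        using M[OF that] d by (intro ennreal_mult_strict_left_mono) auto
      also have "\<dots> = e * ennreal d / ennreal d" by (simp add: ennreal_times_divide mult.commute)
      also have "\<dots> = e" using d by (intro mult_divide_eq_ennreal) auto
      finally show ?thesis by (simp add: eq)
    qed
    then show ?thesis by blast
  qed
  then show ?thesis using \<phi> by (auto simp: cauchy_seqs_def intro: C0inf_cmult)
qed

lemma null_relD:
  assumes "(\<phi>, \<psi>) \<in> null_rel s p \<Omega>"
  shows "\<phi> \<in> cauchy_seqs s p \<Omega>" "\<psi> \<in> cauchy_seqs s p \<Omega>" "(\<lambda>n. gnorm s p (\<lambda>x. \<phi> n x - \<psi> n x)) \<longlonglongrightarrow> 0"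
  using assms by (auto simp: null_rel_def)

lemma null_rel_refl: "\<phi> \<in> cauchy_seqs s p \<Omega> \<Longrightarrow> (\<phi>, \<phi>) \<in> null_rel s p \<Omega>"
  by (simp add: null_rel_def)

lemma gnorm_convergent:
  assumes sp: "0 < s" "s < 1" "1 < p" and \<phi>: "\<phi> \<in> cauchy_seqs s p \<Omega>"
  shows "\<exists>l<top. (\<lambda>n. gnorm s p (\<phi> n)) \<longlonglongrightarrow> l"
proof -
  note [measurable] = C0inf_borel[OF cauchy_seqs_C0inf[OF \<phi>]]
  define a where "a n = enn2real (gnorm s p (\<phi> n))" for n
  have a: "gnorm s p (\<phi> n) = ennreal (a n)" "0 \<le> a n" for n
    using C0inf_gnorm_finite[OF sp cauchy_seqs_C0inf[OF \<phi>, of n]] by (auto simp: a_def)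
  have "Cauchy a"
  proof (rule metric_CauchyI)
    fix e :: real assume e: "0 < e"
    then obtain M where M: "\<And>m n. m \<ge> M \<Longrightarrow> n \<ge> M \<Longrightarrow> gnorm s p (\<lambda>x. \<phi> m x - \<phi> n x) < ennreal e"
      using cauchy_seqsD[OF \<phi>, of "ennreal e"] by auto
    have *: "a m < a n + e" if "m \<ge> M" "n \<ge> M" for m n
    proof -
      have "ennreal (a m) \<le> ennreal (a n) + gnorm s p (\<lambda>x. \<phi> m x - \<phi> n x)"
        using gnorm_le_add_diff[of "\<phi> m" "\<phi> n" p s] sp by (simp add: a)
      also have "\<dots> < ennreal (a n) + ennreal e"
        using M[OF that] by (simp add: ennreal_add_left_cancel_less)
      finally show ?thesis using a e by (simp add: ennreal_less_iff flip: ennreal_plus)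
    qed
    then show "\<exists>M. \<forall>m\<ge>M. \<forall>n\<ge>M. dist (a m) (a n) < e"
      by (intro exI[of _ M]) (auto simp: dist_real_def abs_less_iff algebra_simps dest: *)
  qed
  then obtain l where l: "a \<longlonglongrightarrow> l" using Cauchy_convergent convergent_def by blast
  then have "(\<lambda>n. ennreal (a n)) \<longlonglongrightarrow> ennreal l" by (rule tendsto_ennrealI)
  then show ?thesis using a(1) by (intro exI[of _ "ennreal l"]) simp
qed

lemma gnorm_tendsto_of_null_rel:
  assumes sp: "0 < s" "s < 1" "1 < p" and r: "(\<phi>, \<psi>) \<in> null_rel s p \<Omega>"
    and l: "(\<lambda>n. gnorm s p (\<phi> n)) \<longlonglongrightarrow> l" "l < top"
  shows "(\<lambda>n. gnorm s p (\<psi> n)) \<longlonglongrightarrow> l"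
proof (rule tendsto_close_ennreal[OF l null_relD(3)[OF r]])
  note [measurable] = C0inf_borel[OF cauchy_seqs_C0inf[OF null_relD(1)[OF r]]]
    C0inf_borel[OF cauchy_seqs_C0inf[OF null_relD(2)[OF r]]]
  fix n
  show "gnorm s p (\<psi> n) \<le> gnorm s p (\<phi> n) + gnorm s p (\<lambda>x. \<phi> n x - \<psi> n x)"
    using gnorm_le_add_diff[of "\<psi> n" "\<phi> n" p s] sp by (simp add: gnorm_minus_commute[of s p "\<psi> n"])
  show "gnorm s p (\<phi> n) \<le> gnorm s p (\<psi> n) + gnorm s p (\<lambda>x. \<phi> n x - \<psi> n x)"
    using gnorm_le_add_diff[of "\<phi> n" "\<psi> n" p s] sp by simp
qed

text \<open>The limit of the norms is the same for all sequences of a class, so that the definite description in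
  the norm of the completion denotes it.\<close>

lemma D0_norm_eq:
  assumes sp: "0 < s" "s < 1" "1 < p" and \<phi>: "\<phi> \<in> cauchy_seqs s p \<Omega>"
    and l: "(\<lambda>n. gnorm s p (\<phi> n)) \<longlonglongrightarrow> l"
  shows "D0_norm s p (null_rel s p \<Omega> `` {\<phi>}) = l"
  unfolding D0_norm_def
proof (rule the_equality)
  have lt: "l < top" using gnorm_convergent[OF sp \<phi>] l LIMSEQ_unique by blast
  show "\<forall>\<psi>\<in>null_rel s p \<Omega> `` {\<phi>}. (\<lambda>n. gnorm s p (\<psi> n)) \<longlonglongrightarrow> l"
    using gnorm_tendsto_of_null_rel[OF sp _ l lt] by auto
  fix l' assume "\<forall>\<psi>\<in>null_rel s p \<Omega> `` {\<phi>}. (\<lambda>n. gnorm s p (\<psi> n)) \<longlonglongrightarrow> l'"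
  then have "(\<lambda>n. gnorm s p (\<phi> n)) \<longlonglongrightarrow> l'" using null_rel_refl[OF \<phi>] by auto
  then show "l' = l" using l LIMSEQ_unique by blast
qed

lemma D0E:
  assumes "U \<in> D0 s p \<Omega>"
  obtains \<phi> where "\<phi> \<in> cauchy_seqs s p \<Omega>" "U = null_rel s p \<Omega> `` {\<phi>}" "\<phi> \<in> U"
  using assms by (auto simp: D0_def elim!: quotientE dest: null_rel_refl)

lemma D0_embed_in_D0: "u \<in> C0inf \<Omega> \<Longrightarrow> D0_embed s p \<Omega> u \<in> D0 s p \<Omega>"
  unfolding D0_embed_def D0_def by (intro quotientI cauchy_seqs_const)

lemma D0_norm_embed:
  "0 < s \<Longrightarrow> s < 1 \<Longrightarrow> 1 < p \<Longrightarrow> u \<in> C0inf \<Omega> \<Longrightarrow> D0_norm s p (D0_embed s p \<Omega> u) = gnorm s p u"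
  unfolding D0_embed_def by (rule D0_norm_eq[OF _ _ _ cauchy_seqs_const]) auto

lemma Lnorm_abs: "Lnorm q \<Omega> (\<lambda>x. ennreal \<bar>f x\<bar>) = epowr (pint lborel q (\<lambda>x. indicator \<Omega> x * f x)) (1/q)"
  unfolding Lnorm_def pint_def
  by (intro arg_cong[where f = "\<lambda>z. epowr z (1/q)"] nn_integral_cong)
     (auto simp: epowr_abs indicator_def)

lemma Lq_dist_eq:
  "Lq_dist q \<Omega> f g = epowr (pint lborel q (\<lambda>x. indicator \<Omega> x * (f x - g x))) (1/q)"
  unfolding Lq_dist_def by (rule Lnorm_abs)

lemma Lq_dist_eq_supported:
  assumes "\<And>x. x \<notin> \<Omega> \<Longrightarrow> f x = 0" "\<And>x. x \<notin> \<Omega> \<Longrightarrow> g x = 0"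
  shows "Lq_dist q \<Omega> f g = epowr (pint lborel q (\<lambda>x. f x - g x)) (1/q)"
proof -
  have "(\<lambda>x. indicator \<Omega> x * (f x - g x)) = (\<lambda>x. f x - g x)"
    using assms by (auto simp: fun_eq_iff indicator_def)
  then show ?thesis by (simp add: Lq_dist_eq)
qed

lemma epowr_tendsto_0_iff: "0 < a \<Longrightarrow> ((\<lambda>n. epowr (f n) a) \<longlongrightarrow> 0) F \<longleftrightarrow> (f \<longlongrightarrow> 0) F"
  using tendsto_epowr[of f 0 F a] tendsto_epowr[of "\<lambda>n. epowr (f n) a" 0 F "1/a"]
  by (auto simp: epowr_epowr)

lemma gnorm_tendsto_0_iff: "0 < p \<Longrightarrow> ((\<lambda>n. gnorm s p (f n)) \<longlongrightarrow> 0) F \<longleftrightarrow> ((\<lambda>n. energy s p (f n)) \<longlongrightarrow> 0) F"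
  unfolding gnorm_def by (simp add: epowr_tendsto_0_iff)

text \<open>A small \<open>\<delta>\<close> disposes of the term with the measure of \<open>A\<close>, and the \<open>L\<^sup>p\<close> integral can then be taken small.\<close>

lemma pint_lower_exponent:
  fixes f :: "'a::euclidean_space \<Rightarrow> real"
  assumes [measurable]: "f \<in> borel_measurable borel" "A \<in> sets borel"
    and f0: "\<And>x. x \<notin> A \<Longrightarrow> f x = 0" and q: "0 < q" "q < p" and \<delta>: "0 < \<delta>"
  shows "pint lborel q f \<le> ennreal \<delta> * emeasure lborel A + ennreal (\<delta> powr (1 - p/q)) * pint lborel p f"
proof -
  have "pint lborel q f \<le> (\<integral>\<^sup>+ x. ennreal \<delta> * indicator A x + ennreal (\<delta> powr (1 - p/q)) * ennreal (\<bar>f x\<bar> powr p) \<partial>lborel)"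
    unfolding pint_def
  proof (rule nn_integral_mono)
    fix x
    show "ennreal (\<bar>f x\<bar> powr q) \<le> ennreal \<delta> * indicator A x + ennreal (\<delta> powr (1 - p/q)) * ennreal (\<bar>f x\<bar> powr p)"
    proof (cases "x \<in> A")
      case True
      have "\<bar>f x\<bar> powr q \<le> \<delta> + \<delta> powr (1 - p/q) * \<bar>f x\<bar> powr p" using q \<delta> by (intro powr_le_add_powr) auto
      then show ?thesis using True \<delta> by (simp add: ennreal_leI flip: ennreal_mult ennreal_plus)
    next
      case False
      then show ?thesis by (simp add: f0)
    qed
  qed
  also have "\<dots> = ennreal \<delta> * emeasure lborel A + ennreal (\<delta> powr (1 - p/q)) * pint lborel p f"
    unfolding pint_def by (simp add: nn_integral_add nn_integral_cmult)
  finally show ?thesis .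
qed

lemma tendsto_0_ennrealI:
  fixes f :: "nat \<Rightarrow> ennreal"
  assumes "\<And>e::real. 0 < e \<Longrightarrow> \<exists>N. \<forall>n\<ge>N. f n \<le> ennreal e"
  shows "f \<longlonglongrightarrow> 0"
proof (rule order_tendstoI)
  fix a :: ennreal assume "0 < a"
  then obtain b where b: "0 < b" "b < a" using dense by blast
  then obtain e where e: "b = ennreal e" "0 < e" by (cases b) auto
  then show "\<forall>\<^sub>F n in sequentially. f n < a"
    using assms[OF e(2)] b(2) by (auto simp: eventually_sequentially intro: le_less_trans)
qed auto

lemma pint_tendsto_0_lower_exponent:
  fixes f :: "nat \<Rightarrow> 'a::euclidean_space \<Rightarrow> real"
  assumes [measurable]: "\<And>n. f n \<in> borel_measurable borel" and A [measurable]: "A \<in> sets borel" "emeasure lborel A < top"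
    and f0: "\<And>n x. x \<notin> A \<Longrightarrow> f n x = 0" and q: "0 < q" "q < p"
    and lim: "(\<lambda>n. pint lborel p (f n)) \<longlonglongrightarrow> 0"
  shows "(\<lambda>n. pint lborel q (f n)) \<longlonglongrightarrow> 0"
proof (rule tendsto_0_ennrealI)
  fix e :: real assume e: "0 < e"
  obtain m where m: "emeasure lborel A = ennreal m" "0 \<le> m" using A(2) by (cases "emeasure lborel A") auto
  define \<delta> where "\<delta> = e / (2 * (m + 1))"
  have \<delta>: "0 < \<delta>" using e m by (simp add: \<delta>_def)
  define C where "C = \<delta> powr (1 - p/q)"
  have C: "0 < C" using \<delta> by (simp add: C_def)
  have "\<forall>\<^sub>F n in sequentially. pint lborel p (f n) < ennreal (e / (2 * C))"
    using order_tendstoD(2)[OF lim, of "ennreal (e / (2 * C))"] e C by simp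
  then obtain N where N: "\<And>n. N \<le> n \<Longrightarrow> pint lborel p (f n) \<le> ennreal (e / (2 * C))"
    by (auto simp: eventually_sequentially intro: less_imp_le)
  have "pint lborel q (f n) \<le> ennreal e" if "N \<le> n" for n
  proof -
    have "pint lborel q (f n) \<le> ennreal \<delta> * ennreal m + ennreal C * pint lborel p (f n)"
      using pint_lower_exponent[of "f n" A q p \<delta>] f0 q \<delta> by (simp add: m C_def)
    also have "\<dots> \<le> ennreal \<delta> * ennreal m + ennreal C * ennreal (e / (2 * C))"
      using N[OF that] by (intro add_left_mono mult_left_mono) auto
    also have "\<dots> = ennreal (\<delta> * m + e / 2)" using \<delta> m C e by (simp flip: ennreal_mult ennreal_plus)
    also have "\<dots> \<le> ennreal e"
    proof (rule ennreal_leI)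
      have "\<delta> * m \<le> e / 2" using m e by (simp add: \<delta>_def field_simps)
      then show "\<delta> * m + e / 2 \<le> e" by simp
    qed
    finally show ?thesis .
  qed
  then show "\<exists>N. \<forall>n\<ge>N. pint lborel q (f n) \<le> ennreal e" by blast
qed

section \<open>Torsion functions of bounded open sets\<close>

lemma bounded_open_sets:
  fixes \<Omega> :: "'a::euclidean_space set"
  assumes "open \<Omega>" "\<Omega> \<subseteq> ball 0 r"
  shows "\<Omega> \<in> sets borel" "emeasure lborel \<Omega> < top"
proof -
  show 1: "\<Omega> \<in> sets borel" using assms(1) by simp
  have "emeasure lborel \<Omega> \<le> emeasure lborel (ball (0::'a) r)"
    using assms(2) by (intro emeasure_mono) auto
  also have "\<dots> < top" using emeasure_lborel_ball_finite by auto
  finally show "emeasure lborel \<Omega> < top" .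
qed

lemma energy_tendsto_0_imp_pint:
  fixes f :: "nat \<Rightarrow> 'a::euclidean_space \<Rightarrow> real"
  assumes sp: "0 < s" "0 < p" and [measurable]: "\<And>n. f n \<in> borel_measurable borel"
    and f0: "\<And>n x. x \<notin> ball 0 r \<Longrightarrow> f n x = 0"
    and lim: "(\<lambda>n. energy s p (f n)) \<longlonglongrightarrow> 0"
  shows "(\<lambda>n. pint lborel p (f n)) \<longlonglongrightarrow> 0"
proof (rule tendsto_0_ennrealI)
  fix e :: real assume e: "0 < e"
  obtain C where C: "0 < C" "\<And>u::'a \<Rightarrow> real. u \<in> borel_measurable borel \<Longrightarrow> (\<And>x. x \<notin> ball 0 r \<Longrightarrow> u x = 0)
      \<Longrightarrow> ennreal C * pint lborel p u \<le> energy s p u"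
    using energy_poincare[OF sp, where r = r and 'a = 'a] by metis
  have "\<forall>\<^sub>F n in sequentially. energy s p (f n) < ennreal (C * e)"
    using order_tendstoD(2)[OF lim, of "ennreal (C * e)"] e C(1) by simp
  then obtain N where N: "\<And>n. N \<le> n \<Longrightarrow> energy s p (f n) < ennreal (C * e)"
    by (auto simp: eventually_sequentially)
  have "pint lborel p (f n) \<le> ennreal e" if "N \<le> n" for n
  proof -
    have "ennreal C * pint lborel p (f n) \<le> energy s p (f n)" using f0 by (intro C(2)) auto
    also have "\<dots> \<le> ennreal C * ennreal e"
      using N[OF that] C(1) e by (simp add: ennreal_mult)
    finally show ?thesis using C(1) by (simp add: ennreal_mult_le_mult_iff)
  qed
  then show "\<exists>N. \<forall>n\<ge>N. pint lborel p (f n) \<le> ennreal e" by blast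
qed

lemma torsion_functional_eq:
  assumes "\<And>x. x \<notin> \<Omega> \<Longrightarrow> u x = 0"
  shows "torsion_functional s p \<Omega> u = 1 / p * enn2real (energy s p u) - (LINT x|lborel. u x)"
proof -
  have "(\<lambda>x. indicator \<Omega> x *\<^sub>R u x) = u" using assms by (auto simp: fun_eq_iff indicator_def)
  then show ?thesis by (simp add: torsion_functional_def set_lebesgue_integral_def)
qed

text \<open>The sequences in the class of \<open>v\<close> converge to \<open>v\<close> in energy, hence in \<open>L\<^sup>1\<close>, by Poincare's inequality on
  a bounded set.\<close>

lemma C0inf_in_D0_fun:
  assumes sp: "0 < s" "s < 1" "1 < p" and \<Omega>: "open \<Omega>" "\<Omega> \<subseteq> ball 0 r" and v: "v \<in> C0inf \<Omega>"
  shows "v \<in> D0_fun s p \<Omega>"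
proof -
  have "(\<lambda>n. Lq_dist 1 \<Omega> (\<phi> n) v) \<longlonglongrightarrow> 0" if \<phi>: "(\<lambda>n. v, \<phi>) \<in> null_rel s p \<Omega>" for \<phi>
  proof -
    note cz = cauchy_seqs_C0inf[OF null_relD(2)[OF \<phi>]]
    note [measurable] = C0inf_borel[OF v] C0inf_borel[OF cz]
    define h where "h n x = \<phi> n x - v x" for n x
    have [measurable]: "h n \<in> borel_measurable borel" for n unfolding h_def[abs_def] by measurable
    have h0: "h n x = 0" if "x \<notin> \<Omega>" for n x using that C0inf_zero_off[OF v] C0inf_zero_off[OF cz] by (simp add: h_def)
    have "(\<lambda>n. gnorm s p (h n)) \<longlonglongrightarrow> 0"
      using null_relD(3)[OF \<phi>] by (simp add: h_def[abs_def] gnorm_minus_commute[of s p v])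
    then have "(\<lambda>n. energy s p (h n)) \<longlonglongrightarrow> 0" using sp by (simp add: gnorm_tendsto_0_iff)
    then have "(\<lambda>n. pint lborel p (h n)) \<longlonglongrightarrow> 0"
    proof (intro energy_tendsto_0_imp_pint[where r = r and s = s])
      show "h n x = 0" if "x \<notin> ball 0 r" for n x using that \<Omega>(2) by (intro h0) blast
    qed (use sp in auto)
    from pint_tendsto_0_lower_exponent[OF _ bounded_open_sets[OF \<Omega>] h0 _ _ this]
    have "(\<lambda>n. pint lborel 1 (h n)) \<longlonglongrightarrow> 0" using sp by simp
    then show ?thesis
      using C0inf_zero_off[OF v] C0inf_zero_off[OF cz] by (simp add: Lq_dist_eq_supported h_def[abs_def])
  qed
  then have "\<forall>\<phi>\<in>D0_embed s p \<Omega> v. (\<lambda>n. Lq_dist 1 \<Omega> (\<phi> n) v) \<longlonglongrightarrow> 0"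
    by (auto simp: D0_embed_def)
  then show ?thesis
    using D0_embed_in_D0[OF v] C0inf_zero_off[OF v] C0inf_borel[OF v] by (auto simp: D0_fun_def)
qed

lemma integral_diff_le_uniform:
  fixes f g :: "'a::euclidean_space \<Rightarrow> real"
  assumes "integrable lborel f" "integrable lborel g" "compact K" "\<And>x. x \<notin> K \<Longrightarrow> f x = 0 \<and> g x = 0"
    and "\<And>x. \<bar>f x - g x\<bar> \<le> \<delta>"
  shows "\<bar>(LINT x|lborel. f x) - (LINT x|lborel. g x)\<bar> \<le> \<delta> * measure lborel K"
proof -
  have K: "K \<in> sets lborel" "emeasure lborel K < \<infinity>"
    using assms(3) emeasure_compact_finite[of K] by (auto simp: borel_compact)
  have "(LINT x|lborel. f x) - (LINT x|lborel. g x) = (LINT x|lborel. f x - g x)"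
    using assms by simp
  also have "\<bar>\<dots>\<bar> \<le> (LINT x|lborel. \<bar>f x - g x\<bar>)" by (rule integral_abs_bound)
  also have "\<dots> \<le> (LINT x|lborel. \<delta> * indicator K x)"
  proof (rule integral_mono)
    show "integrable lborel (\<lambda>x. \<delta> * indicator K x)"
      using K by (intro integrable_mult_right integrable_real_indicator) auto
  qed (use assms in \<open>auto simp: indicator_def\<close>)
  also have "\<dots> = \<delta> * measure lborel K" using K by simp
  finally show ?thesis .
qed

text \<open>Minimality against test functions extends by mollification to continuous competitors with compact
  support.  Competitors built by nonlinear operations, such as absolute values and truncations, are of
  this kind when applied to test functions, but not smooth.\<close>

lemma torsion_minimal:
  fixes w v :: "'a::euclidean_space \<Rightarrow> real"
  assumes sp: "0 < s" "s < 1" "1 < p" and \<Omega>: "open \<Omega>" "\<Omega> \<subseteq> ball 0 r"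
    and w: "compact_torsion s p \<Omega> w"
    and v: "continuous_on UNIV v" "compact K" "K \<subseteq> \<Omega>" "\<And>x. x \<notin> K \<Longrightarrow> v x = 0" "energy s p v < \<infinity>"
  shows "1 / p * enn2real (energy s p w) - (LINT x|lborel. w x) \<le> 1 / p * enn2real (energy s p v) - (LINT x|lborel. v x)"
    (is "?J \<le> ?R")
proof (rule field_le_epsilon)
  fix e :: real assume e: "0 < e"
  obtain K' where K': "compact K'" "K' \<subseteq> \<Omega>" and
    app: "\<And>\<delta>. 0 < \<delta> \<Longrightarrow> \<exists>\<phi>\<in>C0inf \<Omega>. (\<forall>x. x \<notin> K' \<longrightarrow> \<phi> x = 0) \<and> (\<forall>x. \<bar>\<phi> x - v x\<bar> \<le> \<delta>) \<and> energy s p \<phi> \<le> energy s p v"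
    using mollify[OF _ v(1-4) \<Omega>(1), where p = p and s = s] sp by auto
  define m where "m = measure lborel (K \<union> K')"
  have m: "0 \<le> m" by (simp add: m_def)
  define \<delta> where "\<delta> = e / (m + 1)"
  have \<delta>: "0 < \<delta>" "\<delta> * m \<le> e" using e m by (auto simp: \<delta>_def field_simps)
  obtain \<phi> where \<phi>: "\<phi> \<in> C0inf \<Omega>" "\<And>x. x \<notin> K' \<Longrightarrow> \<phi> x = 0" "\<And>x. \<bar>\<phi> x - v x\<bar> \<le> \<delta>" "energy s p \<phi> \<le> energy s p v"
    using app[OF \<delta>(1)] by blast
  have w0: "w x = 0" if "x \<notin> \<Omega>" for x using w that by (simp add: compact_torsion_def D0_fun_def)
  have "?J = torsion_functional s p \<Omega> w" by (rule torsion_functional_eq[symmetric]) (rule w0)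
  also have "\<dots> \<le> torsion_functional s p \<Omega> \<phi>"
    using w C0inf_in_D0_fun[OF sp \<Omega> \<phi>(1)] by (simp add: compact_torsion_def)
  also have "\<dots> = 1 / p * enn2real (energy s p \<phi>) - (LINT x|lborel. \<phi> x)"
    by (rule torsion_functional_eq) (rule C0inf_zero_off[OF \<phi>(1)])
  also have "\<dots> \<le> 1 / p * enn2real (energy s p v) - (LINT x|lborel. \<phi> x)"
    using \<phi>(4) v(5) sp by (intro diff_right_mono mult_left_mono enn2real_mono) auto
  also have "(LINT x|lborel. v x) - (LINT x|lborel. \<phi> x) \<le> \<delta> * m"
  proof -
    have "\<bar>(LINT x|lborel. \<phi> x) - (LINT x|lborel. v x)\<bar> \<le> \<delta> * m"
      unfolding m_def using v K' \<phi>
      by (intro integral_diff_le_uniform C0inf_integrable[OF \<phi>(1)] integrable_compact_support[OF v(1,2)] compact_Un) auto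
    then show ?thesis by linarith
  qed
  then have "1 / p * enn2real (energy s p v) - (LINT x|lborel. \<phi> x) \<le> ?R + e" using \<delta> by linarith
  finally show "?J \<le> ?R + e" .
qed

text \<open>Functions attached to classes of the completion are limits of test functions both in \<open>L\<^sup>1\<close> and in
  energy.  The second follows from the Cauchy property and Fatou's lemma along a subsequence that
  converges almost everywhere.\<close>

lemma D0_fun_approx:
  fixes w :: "'a::euclidean_space \<Rightarrow> real"
  assumes sp: "0 < s" "s < 1" "1 < p" and w: "w \<in> D0_fun s p \<Omega>"
  shows "\<exists>\<phi>. (\<forall>n. \<phi> n \<in> C0inf \<Omega>) \<and> (\<lambda>n. pint lborel 1 (\<lambda>x. \<phi> n x - w x)) \<longlonglongrightarrow> 0
    \<and> (AE x in lborel. (\<lambda>n. \<phi> n x) \<longlonglongrightarrow> w x) \<and> (\<lambda>n. energy s p (\<phi> n)) \<longlonglongrightarrow> energy s p w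
    \<and> energy s p w < \<infinity>"
proof -
  have [measurable]: "w \<in> borel_measurable borel" and w0: "\<And>x. x \<notin> \<Omega> \<Longrightarrow> w x = 0"
    using w by (auto simp: D0_fun_def)
  obtain U where U: "U \<in> D0 s p \<Omega>" "\<And>\<phi>. \<phi> \<in> U \<Longrightarrow> (\<lambda>n. Lq_dist 1 \<Omega> (\<phi> n) w) \<longlonglongrightarrow> 0"
    using w by (auto simp: D0_fun_def)
  obtain \<phi> where \<phi>: "\<phi> \<in> cauchy_seqs s p \<Omega>" "\<phi> \<in> U" using U(1) by (rule D0E)
  note cz = cauchy_seqs_C0inf[OF \<phi>(1)]
  note [measurable] = C0inf_borel[OF cz]
  have lim: "(\<lambda>n. pint lborel 1 (\<lambda>x. \<phi> n x - w x)) \<longlonglongrightarrow> 0"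
    using U(2)[OF \<phi>(2)] w0 C0inf_zero_off[OF cz] by (simp add: Lq_dist_eq_supported)
  obtain r where r: "strict_mono r" "AE x in lborel. (\<lambda>n. \<phi> (r n) x - w x) \<longlonglongrightarrow> 0"
    using pint_tendsto_0_AE_subseq[OF _ _ lim] by auto
  define \<psi> where "\<psi> n = \<phi> (r n)" for n
  have \<psi>C: "\<psi> n \<in> C0inf \<Omega>" for n using cz by (simp add: \<psi>_def)
  have [measurable]: "\<psi> n \<in> borel_measurable borel" for n by (simp add: \<psi>_def)
  have AE: "AE x in lborel. (\<lambda>n. \<psi> n x) \<longlonglongrightarrow> w x"
    using r(2) by eventually_elim (simp add: \<psi>_def LIM_zero_iff)
  have lim\<psi>: "(\<lambda>n. pint lborel 1 (\<lambda>x. \<psi> n x - w x)) \<longlonglongrightarrow> 0"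
    using LIMSEQ_subseq_LIMSEQ[OF lim r(1)] by (simp add: o_def \<psi>_def)
  have "(\<lambda>n. energy s p (\<lambda>x. \<psi> n x - w x)) \<longlonglongrightarrow> 0"
  proof (rule tendsto_0_ennrealI)
    fix e :: real assume e: "0 < e"
    have "0 < epowr (ennreal e) (1/p)" using e by simp
    from cauchy_seqsD[OF \<phi>(1) this]
    obtain M where M: "\<And>m n. m \<ge> M \<Longrightarrow> n \<ge> M \<Longrightarrow> gnorm s p (\<lambda>x. \<phi> m x - \<phi> n x) < epowr (ennreal e) (1/p)" by blast
    have "energy s p (\<lambda>x. \<psi> n x - w x) \<le> ennreal e" if n: "M \<le> n" for n
    proof -
      have "energy s p (\<lambda>x. \<psi> n x - w x) \<le> liminf (\<lambda>k. energy s p (\<lambda>x. \<psi> n x - \<psi> k x))"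
      proof (rule energy_Fatou)
        show "AE x in lborel. (\<lambda>k. \<psi> n x - \<psi> k x) \<longlonglongrightarrow> \<psi> n x - w x"
          using AE by eventually_elim (intro tendsto_intros)
      qed (use sp in auto)
      also have "\<dots> \<le> limsup (\<lambda>k. energy s p (\<lambda>x. \<psi> n x - \<psi> k x))"
        by (rule Liminf_le_Limsup) simp
      also have "\<dots> \<le> ennreal e"
      proof (rule Limsup_bounded)
        have "energy s p (\<lambda>x. \<psi> n x - \<psi> k x) \<le> ennreal e" if "M \<le> k" for k
        proof -
          have "gnorm s p (\<lambda>x. \<psi> n x - \<psi> k x) < epowr (ennreal e) (1/p)"
            unfolding \<psi>_def using seq_suble[OF r(1)] n that by (intro M) (auto intro: order_trans)
          then have "epowr (energy s p (\<lambda>x. \<psi> n x - \<psi> k x)) (1/p) \<le> epowr (ennreal e) (1/p)"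
            by (simp add: gnorm_def)
          then have "epowr (epowr (energy s p (\<lambda>x. \<psi> n x - \<psi> k x)) (1/p)) p \<le> epowr (epowr (ennreal e) (1/p)) p"
            using sp by (rule_tac epowr_mono) auto
          then show ?thesis using sp by (simp add: epowr_epowr)
        qed
        then show "\<forall>\<^sub>F k in sequentially. energy s p (\<lambda>x. \<psi> n x - \<psi> k x) \<le> ennreal e"
          by (auto simp: eventually_sequentially)
      qed
      finally show ?thesis .
    qed
    then show "\<exists>N. \<forall>n\<ge>N. energy s p (\<lambda>x. \<psi> n x - w x) \<le> ennreal e" by blast
  qed
  then have g0: "(\<lambda>n. gnorm s p (\<lambda>x. \<psi> n x - w x)) \<longlonglongrightarrow> 0" using sp by (simp add: gnorm_tendsto_0_iff)
  have gw: "gnorm s p w < top"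
  proof -
    obtain n where n: "gnorm s p (\<lambda>x. \<psi> n x - w x) < 1"
      using order_tendstoD(2)[OF g0, of 1] by (auto simp: eventually_sequentially)
    have "gnorm s p w \<le> gnorm s p (\<psi> n) + gnorm s p (\<lambda>x. w x - \<psi> n x)"
      using sp by (intro gnorm_le_add_diff) auto
    also have "\<dots> < top"
      using C0inf_gnorm_finite[OF sp \<psi>C[of n]] n by (simp add: gnorm_minus_commute[of s p w] less_trans[OF n])
    finally show ?thesis .
  qed
  have "(\<lambda>n. gnorm s p (\<psi> n)) \<longlonglongrightarrow> gnorm s p w"
  proof (rule tendsto_close_ennreal[OF tendsto_const gw g0])
    fix n
    show "gnorm s p (\<psi> n) \<le> gnorm s p w + gnorm s p (\<lambda>x. \<psi> n x - w x)"
      using sp by (intro gnorm_le_add_diff) auto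
    show "gnorm s p w \<le> gnorm s p (\<psi> n) + gnorm s p (\<lambda>x. \<psi> n x - w x)"
      using gnorm_le_add_diff[of w "\<psi> n" p s] sp by (simp add: gnorm_minus_commute[of s p w])
  qed
  then have "(\<lambda>n. energy s p (\<psi> n)) \<longlonglongrightarrow> energy s p w"
    using sp tendsto_epowr[of "\<lambda>n. gnorm s p (\<psi> n)" "gnorm s p w" sequentially p] by (simp add: energy_eq_gnorm)
  moreover have "energy s p w < \<infinity>" using gw by (simp add: gnorm_def)
  ultimately show ?thesis using \<psi>C lim\<psi> AE by (intro exI[of _ \<psi>]) auto
qed

lemma integrable_of_pint_1:
  assumes "w \<in> borel_measurable M" "integrable M f" "pint M 1 (\<lambda>x. f x - w x) < \<infinity>"
  shows "integrable M w"
proof -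
  have [measurable]: "w \<in> borel_measurable M" "f \<in> borel_measurable M" using assms by auto
  have "integrable M (\<lambda>x. f x - w x)"
    using assms(3) by (intro integrableI_bounded) (auto simp: pint_def)
  from Bochner_Integration.integrable_diff[OF assms(2) this]
  have "integrable M (\<lambda>x. f x - (f x - w x))" .
  moreover have "(\<lambda>x. f x - (f x - w x)) = w" by auto
  ultimately show ?thesis by (simp only:)
qed

text \<open>This applies with \<open>f n\<close> and \<open>g\<close> Lipschitz functions of \<open>h n\<close> and \<open>k\<close>, and \<open>h n\<close> a sequence of test functions
  that approximates a torsion function \<open>k\<close>.\<close>

lemma integral_tendsto_of_pint_1:
  fixes f :: "nat \<Rightarrow> 'b \<Rightarrow> real"
  assumes i: "\<And>n. integrable M (f n)" "integrable M g" and L: "0 \<le> L"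
    and [measurable]: "\<And>n. h n \<in> borel_measurable M" "k \<in> borel_measurable M"
    and le: "\<And>n x. \<bar>f n x - g x\<bar> \<le> L * \<bar>h n x - k x\<bar>"
    and lim: "(\<lambda>n. pint M 1 (\<lambda>x. h n x - k x)) \<longlonglongrightarrow> 0"
  shows "(\<lambda>n. LINT x|M. f n x) \<longlonglongrightarrow> (LINT x|M. g x)"
proof (rule tendsto_L1_int[OF i])
  have "(\<integral>\<^sup>+ x. ennreal (norm (f n x - g x)) \<partial>M) \<le> ennreal L * pint M 1 (\<lambda>x. h n x - k x)" for n
  proof -
    have "(\<integral>\<^sup>+ x. ennreal (norm (f n x - g x)) \<partial>M) \<le> (\<integral>\<^sup>+ x. ennreal L * ennreal \<bar>h n x - k x\<bar> \<partial>M)"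
      using le L by (intro nn_integral_mono) (simp add: ennreal_leI flip: ennreal_mult)
    then show ?thesis by (simp add: nn_integral_cmult pint_def)
  qed
  moreover have "(\<lambda>n. ennreal L * pint M 1 (\<lambda>x. h n x - k x)) \<longlonglongrightarrow> 0"
    using ennreal_tendsto_cmult[OF _ lim, of "ennreal L"] by simp
  ultimately show "(\<lambda>n. \<integral>\<^sup>+ x. ennreal (norm (f n x - g x)) \<partial>M) \<longlonglongrightarrow> 0"
    by (rule_tac tendsto_sandwich[OF _ _ tendsto_const, where h = "\<lambda>n. ennreal L * pint M 1 (\<lambda>x. h n x - k x)"]) auto
qed

section \<open>The torsional Hardy inequality\<close>

lemma powr_le_imp_le:
  fixes a b p :: real
  assumes "a powr p \<le> b powr p" "0 < p" "0 \<le> b"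
  shows "a \<le> b"
  using powr_less_mono2[of p b a] assms by linarith

text \<open>Minimality against the competitor \<open>(\<bar>\<phi>\<bar>\<^sup>p + (c * \<bar>u\<bar>)\<^sup>p)\<close> to the power \<open>1/p\<close>, where the test functions \<open>\<phi>\<close>
  approximate \<open>w\<close>.  Its energy exceeds that of \<open>\<phi>\<close> by at most \<open>c powr p\<close> times the energy of \<open>u\<close>, by
  the hidden convexity.\<close>

lemma torsion_lp_competitor:
  fixes w u :: "'a::euclidean_space \<Rightarrow> real"
  assumes sp: "0 < s" "s < 1" "1 < p" and \<Omega>: "open \<Omega>" "\<Omega> \<subseteq> ball 0 r"
    and w: "compact_torsion s p \<Omega> w" and u: "u \<in> C0inf \<Omega>" and c: "0 < c"
  defines "\<tau> \<equiv> \<lambda>x. (\<bar>w x\<bar> powr p + (c * \<bar>u x\<bar>) powr p) powr (1/p)"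
  shows "integrable lborel w" "integrable lborel \<tau>"
    "(LINT x|lborel. \<tau> x) - (LINT x|lborel. w x) \<le> c powr p / p * enn2real (energy s p u)"
proof -
  have p: "0 < p" "1 \<le> p" using sp by auto
  have wD: "w \<in> D0_fun s p \<Omega>" using w by (simp add: compact_torsion_def)
  have [measurable]: "w \<in> borel_measurable borel" using wD by (simp add: D0_fun_def)
  note [measurable] = C0inf_borel[OF u]
  obtain \<phi> where \<phi>: "\<And>n. \<phi> n \<in> C0inf \<Omega>" "(\<lambda>n. pint lborel 1 (\<lambda>x. \<phi> n x - w x)) \<longlonglongrightarrow> 0"
      "(\<lambda>n. energy s p (\<phi> n)) \<longlonglongrightarrow> energy s p w" "energy s p w < \<infinity>"
    using D0_fun_approx[OF sp wD] by blast
  note [measurable] = C0inf_borel[OF \<phi>(1)]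
  obtain n0 where "pint lborel 1 (\<lambda>x. \<phi> n0 x - w x) < top"
    using order_tendstoD(2)[OF \<phi>(2), of top] by (auto simp: eventually_sequentially)
  then show iw: "integrable lborel w"
    by (intro integrable_of_pint_1[OF _ C0inf_integrable[OF \<phi>(1)[of n0]]]) auto
  define T where "T f x = (\<bar>f x\<bar> powr p + (c * \<bar>u x\<bar>) powr p) powr (1/p)" for f :: "'a \<Rightarrow> real" and x
  have \<tau>: "\<tau> = T w" by (simp add: \<tau>_def T_def fun_eq_iff)
  have [measurable]: "T f \<in> borel_measurable borel" if [measurable]: "f \<in> borel_measurable borel" for f
    unfolding T_def[abs_def] by measurable
  have Tle: "T f x \<le> \<bar>f x\<bar> + c * \<bar>u x\<bar>" for f x
    using lp_pair_triangle[of "\<bar>f x\<bar>" 0 0 "c * \<bar>u x\<bar>" p] c p by (simp add: T_def powr_powr)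
  have iT: "integrable lborel (T f)" if "integrable lborel f" for f
  proof (rule Bochner_Integration.integrable_bound)
    show "integrable lborel (\<lambda>x. \<bar>f x\<bar> + c * \<bar>u x\<bar>)"
      using that C0inf_integrable[OF u] by (intro Bochner_Integration.integrable_add integrable_mult_right integrable_abs)
    show "AE x in lborel. norm (T f x) \<le> norm (\<bar>f x\<bar> + c * \<bar>u x\<bar>)"
      using Tle c by (auto simp: T_def intro!: always_eventually order_trans[OF _ abs_ge_self])
  qed (use that in \<open>auto dest: borel_measurable_integrable\<close>)
  show i\<tau>: "integrable lborel \<tau>" unfolding \<tau> by (rule iT[OF iw])
  have Tlip: "\<bar>T f x - T g x\<bar> \<le> 1 * \<bar>f x - g x\<bar>" for f g x
  proof -
    have "\<bar>T f x - T g x\<bar> powr p \<le> \<bar>\<bar>f x\<bar> - \<bar>g x\<bar>\<bar> powr p + \<bar>c * \<bar>u x\<bar> - c * \<bar>u x\<bar>\<bar> powr p"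
      unfolding T_def using c p by (intro lp_pair_norm_diff) auto
    also have "\<dots> \<le> \<bar>f x - g x\<bar> powr p" using p by (simp add: powr_mono2)
    finally have "\<bar>T f x - T g x\<bar> \<le> \<bar>f x - g x\<bar>" by (rule powr_le_imp_le) (use p in auto)
    then show ?thesis by simp
  qed
  have Tlim: "(\<lambda>n. LINT x|lborel. T (\<phi> n) x) \<longlonglongrightarrow> (LINT x|lborel. T w x)"
    by (rule integral_tendsto_of_pint_1[OF iT[OF C0inf_integrable[OF \<phi>(1)]] iT[OF iw] _ _ _ Tlip \<phi>(2)]) auto
  have Eu: "energy s p u < \<infinity>" by (rule C0inf_energy_finite[OF sp u])
  have ET: "energy s p (T f) \<le> energy s p f + ennreal (c powr p) * energy s p u"
    if [measurable]: "f \<in> borel_measurable borel" for f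
  proof (rule energy_le_add_pointwise)
    fix x y
    have "\<bar>T f x - T f y\<bar> powr p \<le> \<bar>\<bar>f x\<bar> - \<bar>f y\<bar>\<bar> powr p + \<bar>c * \<bar>u x\<bar> - c * \<bar>u y\<bar>\<bar> powr p"
      unfolding T_def using c p by (intro lp_pair_norm_diff) auto
    also have "\<dots> \<le> \<bar>f x - f y\<bar> powr p + (c * \<bar>u x - u y\<bar>) powr p"
    proof (intro add_mono powr_mono2)
      have "\<bar>c * \<bar>u x\<bar> - c * \<bar>u y\<bar>\<bar> = c * \<bar>\<bar>u x\<bar> - \<bar>u y\<bar>\<bar>"
        using c by (simp add: abs_mult flip: right_diff_distrib)
      also have "\<dots> \<le> c * \<bar>u x - u y\<bar>" using c by (intro mult_left_mono) auto
      finally show "\<bar>c * \<bar>u x\<bar> - c * \<bar>u y\<bar>\<bar> \<le> c * \<bar>u x - u y\<bar>" .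
    qed (use p in auto)
    finally show "\<bar>T f x - T f y\<bar> powr p \<le> \<bar>f x - f y\<bar> powr p + c powr p * \<bar>u x - u y\<bar> powr p"
      using c by (simp add: powr_mult)
  qed auto
  have "1 / p * enn2real (energy s p w) - (LINT x|lborel. w x)
      \<le> 1 / p * (enn2real (energy s p (\<phi> n)) + c powr p * enn2real (energy s p u)) - (LINT x|lborel. T (\<phi> n) x)" for n
  proof -
    obtain K where K: "compact K" "K \<subseteq> \<Omega>" "\<And>x. x \<notin> K \<Longrightarrow> \<phi> n x = 0" using \<phi>(1) by (rule C0inf_compact_support) blast
    obtain L where L: "compact L" "L \<subseteq> \<Omega>" "\<And>x. x \<notin> L \<Longrightarrow> u x = 0" using u by (rule C0inf_compact_support) blast
    have E\<phi>: "energy s p (\<phi> n) < \<infinity>" by (rule C0inf_energy_finite[OF sp \<phi>(1)])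
    have fin: "energy s p (\<phi> n) + ennreal (c powr p) * energy s p u < \<infinity>"
      using E\<phi> Eu by (simp add: ennreal_mult_less_top)
    have J: "1 / p * enn2real (energy s p w) - (LINT x|lborel. w x)
        \<le> 1 / p * enn2real (energy s p (T (\<phi> n))) - (LINT x|lborel. T (\<phi> n) x)"
    proof (rule torsion_minimal[OF sp \<Omega> w])
      show "continuous_on UNIV (T (\<phi> n))"
        unfolding T_def[abs_def]
        using C0inf_continuous[OF \<phi>(1)] C0inf_continuous[OF u] p c
        by (intro continuous_on_powr' continuous_intros) auto
      show "compact (K \<union> L)" "K \<union> L \<subseteq> \<Omega>" using K L by auto
      show "T (\<phi> n) x = 0" if "x \<notin> K \<union> L" for x using that K(3) L(3) by (simp add: T_def)
      show "energy s p (T (\<phi> n)) < \<infinity>" using ET[of "\<phi> n"] fin by (auto intro: le_less_trans)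
    qed
    have "enn2real (energy s p (T (\<phi> n))) \<le> enn2real (energy s p (\<phi> n) + ennreal (c powr p) * energy s p u)"
      using ET[of "\<phi> n"] fin by (intro enn2real_mono) auto
    also have "\<dots> = enn2real (energy s p (\<phi> n)) + c powr p * enn2real (energy s p u)"
      using E\<phi> Eu by (subst enn2real_plus) (auto simp: enn2real_mult ennreal_mult_less_top)
    finally have "1 / p * enn2real (energy s p (T (\<phi> n)))
        \<le> 1 / p * (enn2real (energy s p (\<phi> n)) + c powr p * enn2real (energy s p u))"
      using p by (intro mult_left_mono) auto
    then show ?thesis using J by linarith
  qed
  moreover have "(\<lambda>n. 1 / p * (enn2real (energy s p (\<phi> n)) + c powr p * enn2real (energy s p u)) - (LINT x|lborel. T (\<phi> n) x))
      \<longlonglongrightarrow> 1 / p * (enn2real (energy s p w) + c powr p * enn2real (energy s p u)) - (LINT x|lborel. T w x)"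
    using \<phi>(3,4) by (intro tendsto_intros Tlim) auto
  ultimately have "1 / p * enn2real (energy s p w) - (LINT x|lborel. w x)
      \<le> 1 / p * (enn2real (energy s p w) + c powr p * enn2real (energy s p u)) - (LINT x|lborel. T w x)"
    by (intro LIMSEQ_le_const) auto
  then show "(LINT x|lborel. \<tau> x) - (LINT x|lborel. w x) \<le> c powr p / p * enn2real (energy s p u)"
    unfolding \<tau> by (simp add: distrib_left)
qed

text \<open>With \<open>u = 0\<close> the competitor is \<open>\<bar>w\<bar>\<close>.\<close>

lemma torsion_integral_abs_le:
  fixes w :: "'a::euclidean_space \<Rightarrow> real"
  assumes sp: "0 < s" "s < 1" "1 < p" and \<Omega>: "open \<Omega>" "\<Omega> \<subseteq> ball 0 r"
    and w: "compact_torsion s p \<Omega> w"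
  shows "integrable lborel w" "(LINT x|lborel. \<bar>w x\<bar>) \<le> (LINT x|lborel. w x)"
  using torsion_lp_competitor[OF sp \<Omega> w C0inf_zero, of 1] sp by (simp_all add: powr_powr)

lemma torsion_nonneg:
  fixes w :: "'a::euclidean_space \<Rightarrow> real"
  assumes sp: "0 < s" "s < 1" "1 < p" and \<Omega>: "open \<Omega>" "\<Omega> \<subseteq> ball 0 r"
    and w: "compact_torsion s p \<Omega> w"
  shows "AE x in lborel. 0 \<le> w x"
proof -
  note i = torsion_integral_abs_le[OF sp \<Omega> w]
  have "(LINT x|lborel. \<bar>w x\<bar> - w x) = (LINT x|lborel. \<bar>w x\<bar>) - (LINT x|lborel. w x)"
    using i(1) by (intro Bochner_Integration.integral_diff) auto
  moreover have "0 \<le> (LINT x|lborel. \<bar>w x\<bar> - w x)" by (rule integral_nonneg_AE) auto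
  ultimately have "(LINT x|lborel. \<bar>w x\<bar> - w x) = 0" using i(2) by linarith
  then have "AE x in lborel. \<bar>w x\<bar> - w x = 0"
    using i(1) by (subst (asm) integral_nonneg_eq_0_iff_AE) auto
  then show ?thesis by eventually_elim linarith
qed

text \<open>By convexity of the \<open>p\<close>-th power, \<open>\<tau> - \<bar>w\<bar> \<ge> (c * \<bar>u\<bar>) powr p / (p * \<tau> powr (p - 1))\<close> for the competitor \<open>\<tau>\<close>
  above; in the bound for \<open>\<integral> (\<tau> - w)\<close> the factors \<open>c powr p / p\<close> cancel.\<close>

lemma torsion_hardy_regularized:
  fixes w u :: "'a::euclidean_space \<Rightarrow> real"
  assumes sp: "0 < s" "s < 1" "1 < p" and \<Omega>: "open \<Omega>" "\<Omega> \<subseteq> ball 0 r"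
    and w: "compact_torsion s p \<Omega> w" and u: "u \<in> C0inf \<Omega>" and c: "0 < c"
  shows "(\<integral>\<^sup>+ x. ennreal (\<bar>u x\<bar> powr p / ((\<bar>w x\<bar> powr p + (c * \<bar>u x\<bar>) powr p) powr (1/p)) powr (p - 1)) \<partial>lborel) \<le> energy s p u"
proof -
  define \<tau> where "\<tau> x = (\<bar>w x\<bar> powr p + (c * \<bar>u x\<bar>) powr p) powr (1/p)" for x
  have p: "0 < p" "1 \<le> p" using sp by auto
  have i: "integrable lborel w" "integrable lborel \<tau>"
    "(LINT x|lborel. \<tau> x) - (LINT x|lborel. w x) \<le> c powr p / p * enn2real (energy s p u)"
    using torsion_lp_competitor[OF sp \<Omega> w u c] by (simp_all add: \<tau>_def[abs_def])
  have cp: "0 < c powr p" using c by simp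
  have \<tau>p: "\<tau> x powr p = \<bar>w x\<bar> powr p + (c * \<bar>u x\<bar>) powr p" for x using p by (simp add: \<tau>_def powr_powr)
  have \<tau>0: "0 \<le> \<tau> x" for x by (simp add: \<tau>_def)
  have w\<tau>: "w x \<le> \<tau> x" for x
  proof -
    have "\<bar>w x\<bar> powr p \<le> \<tau> x powr p" by (simp add: \<tau>p)
    then have "\<bar>w x\<bar> \<le> \<tau> x" by (rule powr_le_imp_le) (use p \<tau>0 in auto)
    then show ?thesis by simp
  qed
  have pw: "\<bar>u x\<bar> powr p / \<tau> x powr (p - 1) \<le> p / c powr p * (\<tau> x - w x)" for x
  proof (cases "\<tau> x = 0")
    case True
    have "0 \<le> p / c powr p * (\<tau> x - w x)" using w\<tau>[of x] p cp by (intro mult_nonneg_nonneg) auto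
    then show ?thesis using True by simp
  next
    case False
    then have t: "0 < \<tau> x powr (p - 1)" using \<tau>0[of x] by simp
    have "p * \<tau> x powr (p - 1) * (\<bar>w x\<bar> - \<tau> x) \<le> \<bar>w x\<bar> powr p - \<tau> x powr p"
      by (rule powr_tangent) (use \<tau>0 p in auto)
    then have "c powr p * \<bar>u x\<bar> powr p \<le> p * \<tau> x powr (p - 1) * (\<tau> x - \<bar>w x\<bar>)"
      using c by (simp add: \<tau>p powr_mult algebra_simps)
    also have "\<dots> \<le> p * \<tau> x powr (p - 1) * (\<tau> x - w x)"
      using p by (intro mult_left_mono) auto
    finally show ?thesis using t cp by (simp add: field_simps)
  qed
  have "(\<integral>\<^sup>+ x. ennreal (\<bar>u x\<bar> powr p / \<tau> x powr (p - 1)) \<partial>lborel) \<le> (\<integral>\<^sup>+ x. ennreal (p / c powr p * (\<tau> x - w x)) \<partial>lborel)"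
    using pw by (intro nn_integral_mono ennreal_leI)
  also have "\<dots> = ennreal (LINT x|lborel. p / c powr p * (\<tau> x - w x))"
    using i w\<tau> p cp by (intro nn_integral_eq_integral) auto
  also have "(LINT x|lborel. p / c powr p * (\<tau> x - w x)) = p / c powr p * ((LINT x|lborel. \<tau> x) - (LINT x|lborel. w x))"
    using i by simp
  also have "\<dots> \<le> p / c powr p * (c powr p / p * enn2real (energy s p u))"
    using i(3) p cp by (intro mult_left_mono) auto
  also have "\<dots> = enn2real (energy s p u)" using p cp by simp
  also have "ennreal (enn2real (energy s p u)) = energy s p u"
    using C0inf_energy_finite[OF sp u] by simp
  finally show ?thesis by (simp add: \<tau>_def ennreal_leI)
qed

lemma torsion_functionE:
  fixes w :: "'a::euclidean_space \<Rightarrow> ennreal"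
  assumes "torsion_function s p \<Omega> w"
  obtains f :: "nat \<Rightarrow> 'a \<Rightarrow> real" where
    "\<And>n. compact_torsion s p (ball 0 (real (Suc n)) \<inter> \<Omega>) (f n)"
    "AE x in lborel. x \<in> \<Omega> \<longrightarrow> (\<lambda>n. ennreal (f n x)) \<longlonglongrightarrow> w x"
proof -
  obtain wr where wr: "\<And>r. 0 < r \<Longrightarrow> compact_torsion s p (ball 0 r \<inter> \<Omega>) (wr r)"
     "AE x in lborel. x \<in> \<Omega> \<longrightarrow> ((\<lambda>r. ennreal (wr r x)) \<longlongrightarrow> w x) at_top"
    using assms by (auto simp: torsion_function_def)
  have "filterlim (\<lambda>n. real (Suc n)) at_top sequentially"
    using filterlim_compose[OF filterlim_real_sequentially filterlim_Suc] .
  then have "AE x in lborel. x \<in> \<Omega> \<longrightarrow> (\<lambda>n. ennreal (wr (real (Suc n)) x)) \<longlonglongrightarrow> w x"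
    using wr(2) by (auto elim!: eventually_mono intro: filterlim_compose)
  then show ?thesis using wr(1) by (intro that[of "\<lambda>n. wr (real (Suc n))"]) auto
qed

text \<open>The Hardy inequality with the torsion function as a weight.  Fatou's lemma removes the
  regularization and exhausts \<open>\<Omega>\<close> by bounded sets at the same time: \<open>\<tau> n\<close> lies between the torsion function of
  the \<open>n\<close>-th piece and that function plus \<open>c n * \<bar>u\<bar>\<close>.  At points where \<open>w\<close> vanishes the weight is
  \<open>\<infinity>\<close>, and the inequality says that almost all of them are zeros of \<open>u\<close>.\<close>

lemma torsion_hardy:
  fixes u :: "'a::euclidean_space \<Rightarrow> real" and w :: "'a \<Rightarrow> ennreal"
  assumes sp: "0 < s" "s < 1" "1 < p" and \<Omega>: "open \<Omega>"
    and w: "torsion_function s p \<Omega> w" and u: "u \<in> C0inf \<Omega>"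
  shows "(\<integral>\<^sup>+ x\<in>\<Omega>. ennreal (\<bar>u x\<bar> powr p) * inverse (epowr (w x) (p - 1)) \<partial>lborel) \<le> energy s p u"
proof -
  have p: "0 < p" "1 \<le> p" "0 < p - 1" using sp by auto
  obtain f where f: "\<And>n. compact_torsion s p (ball 0 (real (Suc n)) \<inter> \<Omega>) (f n)"
     "AE x in lborel. x \<in> \<Omega> \<longrightarrow> (\<lambda>n. ennreal (f n x)) \<longlonglongrightarrow> w x"
    using w by (rule torsion_functionE) blast
  have \<Omega>n: "open (ball 0 (real (Suc n)) \<inter> \<Omega>)" "ball 0 (real (Suc n)) \<inter> \<Omega> \<subseteq> ball 0 (real (Suc n))" for n
    using \<Omega> by auto
  have [measurable]: "f n \<in> borel_measurable borel" for n using f(1)[of n] by (simp add: compact_torsion_def D0_fun_def)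
  note [measurable] = C0inf_borel[OF u]
  have f0: "AE x in lborel. \<forall>n. 0 \<le> f n x"
    unfolding AE_all_countable using torsion_nonneg[OF sp \<Omega>n f(1)] by blast
  define c where "c n = 1 / real (Suc n)" for n
  have c: "0 < c n" for n by (simp add: c_def)
  define \<tau> where "\<tau> n x = (\<bar>f n x\<bar> powr p + (c n * \<bar>u x\<bar>) powr p) powr (1/p)" for n x
  have [measurable]: "\<tau> n \<in> borel_measurable borel" for n unfolding \<tau>_def[abs_def] by measurable
  define g where "g n x = ennreal (\<bar>u x\<bar> powr p / \<tau> n x powr (p - 1))" for n x
  have [measurable]: "g n \<in> borel_measurable borel" for n unfolding g_def[abs_def] by measurable
  obtain K where K: "compact K" "K \<subseteq> \<Omega>" "\<And>x. x \<notin> K \<Longrightarrow> u x = 0" using u by (rule C0inf_compact_support) blast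
  obtain N where N: "\<And>x. x \<in> K \<Longrightarrow> norm x < real (Suc N)"
  proof -
    obtain R where R: "\<And>x. x \<in> K \<Longrightarrow> norm x \<le> R" using compact_imp_bounded[OF K(1)] by (auto simp: bounded_iff)
    obtain N where "R < real N" using reals_Archimedean2 by blast
    then show ?thesis using R by (intro that[of N]) (smt (verit) of_nat_Suc)
  qed
  have uC: "u \<in> C0inf (ball 0 (real (Suc n)) \<inter> \<Omega>)" if "N \<le> n" for n
  proof -
    have "K \<subseteq> ball 0 (real (Suc n)) \<inter> \<Omega>" using K(2) N that by fastforce
    then show ?thesis using K C0inf_smooth[OF u] unfolding C0inf_iff by blast
  qed
  have le: "(\<integral>\<^sup>+ x. g n x \<partial>lborel) \<le> energy s p u" if "N \<le> n" for n
    using torsion_hardy_regularized[OF sp \<Omega>n f(1) uC[OF that] c[of n]] by (simp add: g_def \<tau>_def)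
  have "(\<integral>\<^sup>+ x\<in>\<Omega>. ennreal (\<bar>u x\<bar> powr p) * inverse (epowr (w x) (p - 1)) \<partial>lborel)
      \<le> (\<integral>\<^sup>+ x. liminf (\<lambda>n. g n x) \<partial>lborel)"
  proof (rule nn_integral_mono_AE)
    show "AE x in lborel. ennreal (\<bar>u x\<bar> powr p) * inverse (epowr (w x) (p - 1)) * indicator \<Omega> x \<le> liminf (\<lambda>n. g n x)"
      using f(2) f0
    proof eventually_elim
      case (elim x)
      show ?case
      proof (cases "u x = 0 \<or> x \<notin> \<Omega>")
        case True
        then show ?thesis by auto
      next
        case False
        then have fx: "(\<lambda>n. ennreal (f n x)) \<longlonglongrightarrow> w x" and ux: "0 < \<bar>u x\<bar>" using elim by auto
        have lo: "f n x \<le> \<tau> n x" for n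
        proof -
          have "f n x powr p \<le> \<tau> n x powr p" using elim p by (simp add: \<tau>_def powr_powr)
          then show ?thesis by (rule powr_le_imp_le) (use p in \<open>auto simp: \<tau>_def\<close>)
        qed
        have hi: "\<tau> n x \<le> f n x + c n * \<bar>u x\<bar>" for n
          using lp_pair_triangle[of "\<bar>f n x\<bar>" 0 0 "c n * \<bar>u x\<bar>" p] c[of n] p elim by (simp add: \<tau>_def powr_powr)
        have \<tau>pos: "0 < \<tau> n x" for n
        proof -
          have "0 < (c n * \<bar>u x\<bar>) powr p" using c[of n] ux by simp
          then have "0 < \<bar>f n x\<bar> powr p + (c n * \<bar>u x\<bar>) powr p" by (simp add: add_nonneg_pos)
          then show ?thesis by (simp add: \<tau>_def)
        qed
        have "(\<lambda>n. ennreal (\<tau> n x)) \<longlonglongrightarrow> w x"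
        proof (rule tendsto_sandwich[OF _ _ fx])
          have "c \<longlonglongrightarrow> 0" unfolding c_def by (rule LIMSEQ_Suc[OF lim_1_over_n])
          then have "(\<lambda>n. ennreal (c n * \<bar>u x\<bar>)) \<longlonglongrightarrow> ennreal (0 * \<bar>u x\<bar>)"
            by (intro tendsto_ennrealI tendsto_intros)
          then have "(\<lambda>n. ennreal (f n x) + ennreal (c n * \<bar>u x\<bar>)) \<longlonglongrightarrow> w x + 0"
            using fx by (intro tendsto_add) auto
          then show "(\<lambda>n. ennreal (f n x) + ennreal (c n * \<bar>u x\<bar>)) \<longlonglongrightarrow> w x" by simp
          show "\<forall>\<^sub>F n in sequentially. ennreal (f n x) \<le> ennreal (\<tau> n x)" by (intro always_eventually allI ennreal_leI lo)
          show "\<forall>\<^sub>F n in sequentially. ennreal (\<tau> n x) \<le> ennreal (f n x) + ennreal (c n * \<bar>u x\<bar>)"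
          proof (rule always_eventually, rule allI)
            fix n
            have "ennreal (\<tau> n x) \<le> ennreal (f n x + c n * \<bar>u x\<bar>)" by (intro ennreal_leI hi)
            also have "\<dots> = ennreal (f n x) + ennreal (c n * \<bar>u x\<bar>)" using elim c[of n] by (intro ennreal_plus) auto
            finally show "ennreal (\<tau> n x) \<le> ennreal (f n x) + ennreal (c n * \<bar>u x\<bar>)" .
          qed
        qed
        then have "(\<lambda>n. ennreal (\<bar>u x\<bar> powr p) * inverse (epowr (ennreal (\<tau> n x)) (p - 1)))
            \<longlonglongrightarrow> ennreal (\<bar>u x\<bar> powr p) * inverse (epowr (w x) (p - 1))"
        proof (intro ennreal_tendsto_cmult)
          assume "(\<lambda>n. ennreal (\<tau> n x)) \<longlonglongrightarrow> w x"
          then have "(\<lambda>n. epowr (ennreal (\<tau> n x)) (p - 1)) \<longlonglongrightarrow> epowr (w x) (p - 1)"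
            using p by (intro tendsto_epowr)
          moreover have "continuous_on UNIV (inverse :: ennreal \<Rightarrow> ennreal)"
            by (rule continuous_on_inverse_ennreal[OF continuous_on_id])
          ultimately show "(\<lambda>n. inverse (epowr (ennreal (\<tau> n x)) (p - 1))) \<longlonglongrightarrow> inverse (epowr (w x) (p - 1))"
            by (intro continuous_on_tendsto_compose[of UNIV inverse]) auto
        qed auto
        moreover have "ennreal (\<bar>u x\<bar> powr p) * inverse (epowr (ennreal (\<tau> n x)) (p - 1)) = g n x" for n
          using \<tau>pos[of n] by (simp add: g_def epowr_ennreal less_imp_le inverse_ennreal divide_inverse flip: ennreal_mult)
        ultimately have "(\<lambda>n. g n x) \<longlonglongrightarrow> ennreal (\<bar>u x\<bar> powr p) * inverse (epowr (w x) (p - 1))" by simp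
        then have "liminf (\<lambda>n. g n x) = ennreal (\<bar>u x\<bar> powr p) * inverse (epowr (w x) (p - 1))"
          by (intro lim_imp_Liminf) auto
        then show ?thesis by (auto simp: indicator_def)
      qed
    qed
  qed
  also have "\<dots> \<le> liminf (\<lambda>n. \<integral>\<^sup>+ x. g n x \<partial>lborel)" by (rule nn_integral_liminf) measurable
  also have "\<dots> \<le> limsup (\<lambda>n. \<integral>\<^sup>+ x. g n x \<partial>lborel)" by (rule Liminf_le_Limsup) simp
  also have "\<dots> \<le> energy s p u"
    using le by (intro Limsup_bounded) (auto simp: eventually_sequentially)
  finally show ?thesis .
qed

text \<open>Young's inequality under the integral, and the Hardy inequality for the first term.  At points of
  \<open>A \<inter> \<Omega>\<close> where \<open>W\<close> is \<open>0\<close> or \<open>\<infinity>\<close> and \<open>u\<close> is not \<open>0\<close>, one of the two terms is infinite.  The additive form with a free parameter makes each of the two terms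
  small in turn: the energy term through \<open>a\<close>, the torsion term through \<open>a\<close> or through the set \<open>A\<close>.\<close>

lemma integral_power_le_energy_add_torsion:
  fixes u :: "'a::euclidean_space \<Rightarrow> real" and w :: "'a \<Rightarrow> ennreal"
  assumes sp: "0 < s" "s < 1" "1 < p" and q: "1 \<le> q" "q < p" and \<Omega>: "open \<Omega>"
    and w: "torsion_function s p \<Omega> w" and u: "u \<in> C0inf \<Omega>"
    and [measurable]: "W \<in> borel_measurable borel" and W: "\<And>x. x \<in> \<Omega> \<Longrightarrow> W x = w x"
    and A [measurable]: "A \<in> sets borel" and a: "0 < a"
  shows "pint lborel q (\<lambda>x. indicator A x * u x) \<le> ennreal a * energy s p u
      + ennreal (a powr (- q / (p - q))) * (\<integral>\<^sup>+ x\<in>A \<inter> \<Omega>. epowr (W x) ((p - 1) / (p - q) * q) \<partial>lborel)"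
proof -
  define \<gamma> where "\<gamma> = (p - 1) / (p - q) * q"
  have \<gamma>: "0 < \<gamma>" using q sp by (simp add: \<gamma>_def)
  have p1: "0 < p - 1" using sp by simp
  note [measurable] = C0inf_borel[OF u]
  have [measurable]: "\<Omega> \<in> sets borel" using \<Omega> by simp
  let ?F = "\<lambda>x. ennreal (\<bar>u x\<bar> powr p) * inverse (epowr (W x) (p - 1)) * indicator \<Omega> x"
  let ?G = "\<lambda>x. epowr (W x) \<gamma> * indicator (A \<inter> \<Omega>) x"
  have [measurable]: "(\<lambda>x. epowr (W x) (p - 1)) \<in> borel_measurable borel" "(\<lambda>x. epowr (W x) \<gamma>) \<in> borel_measurable borel"
    using p1 \<gamma> by (auto intro: measurable_compose[OF _ borel_measurable_epowr])
  have [measurable]: "?F \<in> borel_measurable borel" "?G \<in> borel_measurable borel" by measurable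
  have "pint lborel q (\<lambda>x. indicator A x * u x) \<le> (\<integral>\<^sup>+ x. ennreal a * ?F x + ennreal (a powr (- q / (p - q))) * ?G x \<partial>lborel)"
    unfolding pint_def
  proof (rule nn_integral_mono)
    fix x
    show "ennreal (\<bar>indicator A x * u x\<bar> powr q) \<le> ennreal a * ?F x + ennreal (a powr (- q / (p - q))) * ?G x"
    proof (cases "x \<in> A \<and> x \<in> \<Omega> \<and> u x \<noteq> 0")
      case False
      then show ?thesis using C0inf_zero_off[OF u, of x] by (auto simp: indicator_def)
    next
      case True
      consider "W x = 0" | "W x = top" | y where "W x = ennreal y" "0 < y"
        by (cases "W x") (auto simp: less_le)
      then show ?thesis
      proof cases
        case 1
        then show ?thesis using True a by (simp add: ennreal_mult_top)
      next
        case 2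
        then show ?thesis using True a by (simp add: ennreal_mult_top)
      next
        case 3
        have "\<bar>u x\<bar> powr q \<le> a * (\<bar>u x\<bar> powr p / y powr (p - 1)) + a powr (- q / (p - q)) * y powr \<gamma>"
          unfolding \<gamma>_def using 3 a q by (intro powr_weighted_young) auto
        then have "ennreal (\<bar>u x\<bar> powr q) \<le> ennreal (a * (\<bar>u x\<bar> powr p / y powr (p - 1)) + a powr (- q / (p - q)) * y powr \<gamma>)"
          by (rule ennreal_leI)
        also have "\<dots> = ennreal a * ?F x + ennreal (a powr (- q / (p - q))) * ?G x"
          using True 3 a by (simp add: epowr_ennreal inverse_ennreal divide_inverse ennreal_mult)
        finally show ?thesis using True by simp
      qed
    qed
  qed
  also have "\<dots> = ennreal a * (\<integral>\<^sup>+ x. ?F x \<partial>lborel) + ennreal (a powr (- q / (p - q))) * (\<integral>\<^sup>+ x. ?G x \<partial>lborel)"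
    by (simp add: nn_integral_add nn_integral_cmult)
  also have "(\<integral>\<^sup>+ x. ?F x \<partial>lborel) \<le> energy s p u"
  proof -
    have "(\<integral>\<^sup>+ x. ?F x \<partial>lborel) = (\<integral>\<^sup>+ x\<in>\<Omega>. ennreal (\<bar>u x\<bar> powr p) * inverse (epowr (w x) (p - 1)) \<partial>lborel)"
      by (intro nn_integral_cong) (auto simp: indicator_def W)
    then show ?thesis using torsion_hardy[OF sp \<Omega> w u] by simp
  qed
  finally show ?thesis unfolding \<gamma>_def by (simp add: mult_left_mono)
qed

section \<open>From the Poincare-Sobolev constant to the torsion function\<close>

text \<open>Both sides are homogeneous of degree \<open>p\<close>, so it suffices to normalize \<open>u\<close>.\<close>

lemma lambda_pq_le:
  fixes u :: "'a::euclidean_space \<Rightarrow> real"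
  assumes p: "0 < p" and q: "0 < q" and c: "ennreal c \<le> lambda_pq s p q \<Omega>" "0 < c" and u: "u \<in> C0inf \<Omega>"
  shows "ennreal c * epowr (pint lborel q u) (p / q) \<le> energy s p u"
proof -
  obtain K where K: "compact K" "K \<subseteq> \<Omega>" "\<And>x. x \<notin> K \<Longrightarrow> u x = 0" using u by (rule C0inf_compact_support) blast
  note [measurable] = C0inf_borel[OF u]
  have int: "integrable lborel (\<lambda>x. \<bar>u x\<bar> powr q)"
  proof (rule integrable_compact_support[OF _ K(1)])
    show "continuous_on UNIV (\<lambda>x. \<bar>u x\<bar> powr q)"
      using C0inf_continuous[OF u] q by (intro continuous_on_powr' continuous_intros) auto
  qed (use K in auto)
  define I where "I = (LINT x|lborel. \<bar>u x\<bar> powr q)"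
  have I: "pint lborel q u = ennreal I" unfolding pint_def I_def
    using int by (intro nn_integral_eq_integral) auto
  have I0: "0 \<le> I" unfolding I_def by (rule integral_nonneg_AE) auto
  show ?thesis
  proof (cases "I = 0")
    case True
    then show ?thesis by (simp add: I)
  next
    case False
    then have Ip: "0 < I" using I0 by simp
    define t where "t = I powr (-1/q)"
    have t: "0 < t" using Ip by (simp add: t_def)
    define v where "v x = t * u x" for x
    have vC: "v \<in> C0inf \<Omega>" unfolding v_def[abs_def] by (rule C0inf_cmult[OF u])
    have tq: "t powr q * I = 1"
    proof -
      have "t powr q = I powr (-1)" using q by (simp add: t_def powr_powr)
      also have "\<dots> = 1 / I" using Ip by (simp add: powr_minus_divide)
      finally show ?thesis using Ip by simp
    qed
    have "(LINT x:\<Omega>|lborel. \<bar>v x\<bar> powr q) = (LINT x|lborel. t powr q * \<bar>u x\<bar> powr q)"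
      unfolding set_lebesgue_integral_def
      using t C0inf_zero_off[OF u] by (intro Bochner_Integration.integral_cong) (auto simp: v_def abs_mult powr_mult indicator_def)
    also have "\<dots> = 1" using tq by (simp add: I_def)
    finally have "(LINT x:\<Omega>|lborel. \<bar>v x\<bar> powr q) = 1" .
    then have "lambda_pq s p q \<Omega> \<le> energy s p v"
      unfolding lambda_pq_def using vC by (intro INF_lower) auto
    then have "ennreal c \<le> ennreal (t powr p) * energy s p u"
      using c(1) p t unfolding v_def[abs_def] by (simp add: energy_cmult)
    then have "ennreal (I powr (p/q)) * ennreal c \<le> ennreal (I powr (p/q)) * (ennreal (t powr p) * energy s p u)"
      by (rule mult_left_mono) simp
    also have "\<dots> = ennreal (I powr (p/q) * t powr p) * energy s p u"
      by (simp add: ennreal_mult mult.assoc)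
    also have "I powr (p/q) * t powr p = 1"
      using Ip by (simp add: t_def powr_powr flip: powr_add)
    finally show ?thesis using I0 by (simp add: I epowr_ennreal mult.commute)
  qed
qed

lemma ennreal_mult_le_iff_le_divide:
  assumes "0 < c"
  shows "ennreal c * x \<le> y \<longleftrightarrow> x \<le> y / ennreal c"
proof (cases x; cases y)
  fix a b :: real assume "x = ennreal a" "0 \<le> a" "y = ennreal b" "0 \<le> b"
  then show ?thesis using assms by (simp add: divide_ennreal pos_le_divide_eq mult.commute flip: ennreal_mult)
qed (use assms in \<open>auto simp: ennreal_mult_top ennreal_top_divide divide_ennreal top_unique ennreal_mult_eq_top_iff\<close>)

text \<open>Fatou's lemma along mollifications of \<open>v\<close>, whose energies do not exceed that of \<open>v\<close>.\<close>

lemma lambda_pq_le_continuous: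
  fixes v :: "'a::euclidean_space \<Rightarrow> real"
  assumes p: "1 \<le> p" and q: "0 < q" and c: "ennreal c \<le> lambda_pq s p q \<Omega>" "0 < c" and \<Omega>: "open \<Omega>"
    and v: "continuous_on UNIV v" "compact K" "K \<subseteq> \<Omega>" "\<And>x. x \<notin> K \<Longrightarrow> v x = 0"
  shows "ennreal c * epowr (pint lborel q v) (p / q) \<le> energy s p v"
proof -
  have app: "\<And>\<delta>. 0 < \<delta> \<Longrightarrow> \<exists>\<phi>\<in>C0inf \<Omega>. (\<forall>x. \<bar>\<phi> x - v x\<bar> \<le> \<delta>) \<and> energy s p \<phi> \<le> energy s p v"
    using mollify[OF p v \<Omega>, of s] by blast
  have "\<exists>\<phi>\<in>C0inf \<Omega>. (\<forall>x. \<bar>\<phi> x - v x\<bar> \<le> 1 / real (Suc n)) \<and> energy s p \<phi> \<le> energy s p v" for n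
    by (rule app) simp
  then obtain \<phi> where \<phi>: "\<And>n. \<phi> n \<in> C0inf \<Omega>" "\<And>n x. \<bar>\<phi> n x - v x\<bar> \<le> 1 / real (Suc n)"
      "\<And>n. energy s p (\<phi> n) \<le> energy s p v"
    by metis
  note [measurable] = C0inf_borel[OF \<phi>(1)]
  have pq: "0 < p / q" "0 < q / p" using p q by auto
  have lim: "(\<lambda>n. \<phi> n x) \<longlonglongrightarrow> v x" for x
  proof -
    have "(\<lambda>n. \<phi> n x - v x) \<longlonglongrightarrow> 0"
      by (rule Lim_null_comparison[OF _ LIMSEQ_Suc[OF lim_1_over_n]]) (use \<phi>(2) in auto)
    then show ?thesis by (simp add: LIM_zero_iff)
  qed
  define B where "B = epowr (energy s p v / ennreal c) (q / p)"
  have "pint lborel q (\<phi> n) \<le> B" for n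
  proof -
    have "ennreal c * epowr (pint lborel q (\<phi> n)) (p / q) \<le> energy s p (\<phi> n)"
      using p by (intro lambda_pq_le[OF _ q c \<phi>(1)]) auto
    also have "\<dots> \<le> energy s p v" by (rule \<phi>(3))
    finally have "epowr (pint lborel q (\<phi> n)) (p / q) \<le> energy s p v / ennreal c"
      using c(2) by (simp add: ennreal_mult_le_iff_le_divide)
    then show ?thesis using pq by (simp add: B_def epowr_le_iff)
  qed
  then have "limsup (\<lambda>n. pint lborel q (\<phi> n)) \<le> B" by (intro Limsup_bounded) auto
  moreover have "pint lborel q v \<le> liminf (\<lambda>n. pint lborel q (\<phi> n))"
    using q lim by (intro pint_Fatou) auto
  moreover have "liminf (\<lambda>n. pint lborel q (\<phi> n)) \<le> limsup (\<lambda>n. pint lborel q (\<phi> n))"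
    by (rule Liminf_le_Limsup) simp
  ultimately have "pint lborel q v \<le> B" by (meson order_trans)
  then have "epowr (pint lborel q v) (p / q) \<le> energy s p v / ennreal c"
    using pq by (simp add: B_def epowr_le_iff)
  then show ?thesis using c(2) by (simp add: ennreal_mult_le_iff_le_divide)
qed

lemma truncated_power_lipschitz:
  fixes a b k r :: real
  assumes "0 \<le> b" "b \<le> a" "0 < k" "1 \<le> r"
  shows "0 \<le> min a k powr r - min b k powr r"
    "min a k powr r - min b k powr r \<le> r * k powr (r - 1) * (a - b)"
proof -
  define a' b' where "a' = min a k" and "b' = min b k"
  have ab: "0 \<le> b'" "b' \<le> a'" "a' \<le> k" "a' - b' \<le> a - b" using assms by (auto simp: a'_def b'_def)
  show "0 \<le> min a k powr r - min b k powr r"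
    using ab assms by (simp add: powr_mono2 flip: a'_def b'_def)
  have "r * a' powr (r - 1) * (b' - a') \<le> b' powr r - a' powr r"
    using ab assms by (intro powr_tangent) auto
  then have "a' powr r - b' powr r \<le> r * a' powr (r - 1) * (a' - b')" by (simp add: algebra_simps)
  also have "\<dots> \<le> r * k powr (r - 1) * (a - b)"
    using ab assms by (intro mult_mono powr_mono2) auto
  finally show "min a k powr r - min b k powr r \<le> r * k powr (r - 1) * (a - b)" by (simp add: a'_def b'_def)
qed

text \<open>The pointwise inequality behind the following comparison of energies: passing from \<open>v\<close> to
  \<open>v - \<epsilon> * min v k powr r\<close> lowers the energy by at least \<open>\<epsilon> / \<kappa> powr p\<close> times that of \<open>min v k powr \<kappa>\<close>.  The
  bound on \<open>\<epsilon>\<close> keeps the competitor a nondecreasing function of \<open>v\<close>.\<close>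

lemma truncated_power_competitor:
  fixes a b k r p \<epsilon> \<kappa> :: real
  assumes ab: "0 \<le> a" "0 \<le> b" and k: "0 < k" and r: "1 \<le> r" and p: "1 \<le> p"
    and \<epsilon>: "0 \<le> \<epsilon>" "\<epsilon> * (r * k powr (r - 1)) \<le> 1" and \<kappa>: "\<kappa> = (r + p - 1) / p"
  shows "\<bar>(a - \<epsilon> * min a k powr r) - (b - \<epsilon> * min b k powr r)\<bar> powr p
      + \<epsilon> / \<kappa> powr p * \<bar>min a k powr \<kappa> - min b k powr \<kappa>\<bar> powr p \<le> \<bar>a - b\<bar> powr p"
proof -
  have \<kappa>1: "1 \<le> \<kappa>" using r p by (simp add: \<kappa>)
  have main: "\<bar>(a - \<epsilon> * min a k powr r) - (b - \<epsilon> * min b k powr r)\<bar> powr p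
      + \<epsilon> / \<kappa> powr p * \<bar>min a k powr \<kappa> - min b k powr \<kappa>\<bar> powr p \<le> \<bar>a - b\<bar> powr p"
    if ab: "0 \<le> b" "b \<le> a" for a b
  proof -
    define d where "d = a - b"
    define e where "e = min a k powr r - min b k powr r"
    have d: "0 \<le> d" using ab by (simp add: d_def)
    have e: "0 \<le> e" "e \<le> r * k powr (r - 1) * d"
      using truncated_power_lipschitz[OF ab k r] by (simp_all add: e_def d_def)
    have "\<epsilon> * e \<le> \<epsilon> * (r * k powr (r - 1) * d)" using e \<epsilon> by (intro mult_left_mono) auto
    also have "\<dots> = (\<epsilon> * (r * k powr (r - 1))) * d" by simp
    also have "\<dots> \<le> 1 * d" using \<epsilon> d by (intro mult_right_mono) auto
    finally have ed: "\<epsilon> * e \<le> d" by simp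
    have 1: "(d - \<epsilon> * e) powr p \<le> d powr p - \<epsilon> * e * d powr (p - 1)"
      using e \<epsilon> ed p by (intro powr_diff_le_linear) auto
    define a' b' where "a' = min a k" and "b' = min b k"
    have ab': "0 \<le> b'" "b' \<le> a'" "a' - b' \<le> d" using ab k by (auto simp: a'_def b'_def d_def)
    have "\<bar>a' powr \<kappa> - b' powr \<kappa>\<bar> powr p = (a' powr \<kappa> - b' powr \<kappa>) powr p"
      using ab' \<kappa>1 by (simp add: powr_mono2)
    also have "\<dots> \<le> \<kappa> powr p * (e * (a' - b') powr (p - 1))"
      using powr_increment_bound[OF ab'(1,2) p r \<kappa>] by (simp add: e_def a'_def b'_def)
    also have "\<dots> \<le> \<kappa> powr p * (e * d powr (p - 1))"
      using ab' e p by (intro mult_left_mono powr_mono2) auto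
    finally have 2: "\<epsilon> / \<kappa> powr p * \<bar>a' powr \<kappa> - b' powr \<kappa>\<bar> powr p \<le> \<epsilon> / \<kappa> powr p * (\<kappa> powr p * (e * d powr (p - 1)))"
      using \<epsilon> by (intro mult_left_mono) auto
    also have "\<dots> = \<epsilon> * e * d powr (p - 1)" using \<kappa>1 by simp
    finally have "(d - \<epsilon> * e) powr p + \<epsilon> / \<kappa> powr p * \<bar>a' powr \<kappa> - b' powr \<kappa>\<bar> powr p \<le> d powr p"
      using 1 by linarith
    moreover have "\<bar>(a - \<epsilon> * min a k powr r) - (b - \<epsilon> * min b k powr r)\<bar> = d - \<epsilon> * e"
    proof -
      have "(a - \<epsilon> * min a k powr r) - (b - \<epsilon> * min b k powr r) = d - \<epsilon> * e"
        by (simp add: d_def e_def algebra_simps)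
      then show ?thesis using ed by simp
    qed
    moreover have "\<bar>a - b\<bar> = d" using d by (simp add: d_def)
    ultimately show ?thesis by (simp only: a'_def b'_def)
  qed
  show ?thesis
  proof (cases "b \<le> a")
    case True
    then show ?thesis using main ab by blast
  next
    case False
    then show ?thesis using main[of a b] ab by (simp add: abs_minus_commute)
  qed
qed

text \<open>The competitor \<open>w - \<epsilon> * min w k powr r\<close> raises the torsion functional by \<open>\<epsilon> * X\<close> through the integral,
  where \<open>X = \<integral> min w k powr r\<close>, and lowers it by a multiple of \<open>\<epsilon>\<close> times the energy of \<open>min w k powr \<kappa>\<close>.
  The exponent \<open>r\<close> is chosen so that \<open>(r + p - 1) / p\<close>, the exponent of the lost energy, equals \<open>r / q\<close>;
  therefore the Poincare-Sobolev inequality bounds this energy below by a multiple of \<open>X powr (p / q)\<close>.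
  By minimality \<open>X powr (p / q)\<close> is at most a multiple of \<open>X\<close>, and since \<open>q < p\<close> and \<open>X\<close> is finite by truncation,
  \<open>X\<close> is bounded by a constant that depends neither on the bounded piece \<open>D\<close> nor on \<open>k\<close>.\<close>

lemma torsion_truncated_bound:
  fixes w :: "'a::euclidean_space \<Rightarrow> real"
  assumes sp: "0 < s" "s < 1" "1 < p" and q: "1 \<le> q" "q < p"
    and c: "ennreal c \<le> lambda_pq s p q \<Omega>" "0 < c" and \<Omega>: "open \<Omega>"
    and D: "open D" "D \<subseteq> ball 0 R" "D \<subseteq> \<Omega>" and w: "compact_torsion s p D w" and k: "0 < k"
  defines "r \<equiv> (p - 1) / (p - q) * q"
  defines "\<kappa> \<equiv> r / q"
  shows "(\<integral>\<^sup>+ x. ennreal (min \<bar>w x\<bar> k powr r) \<partial>lborel) \<le> ennreal ((p * \<kappa> powr p / c) powr (q / (p - q)))"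
proof -
  have p: "0 < p" "1 \<le> p" using sp by auto
  have r1: "1 \<le> r"
  proof -
    have "p - q \<le> (p - 1) * q"
    proof -
      have "0 \<le> p * (q - 1)" using p q by simp
      then show ?thesis by (simp add: algebra_simps)
    qed
    then show ?thesis using q by (simp add: r_def field_simps)
  qed
  have \<kappa>: "\<kappa> = (r + p - 1) / p"
  proof -
    have "r * (p - q) = (p - 1) * q" using q by (simp add: r_def)
    then have "r * p = (r + p - 1) * q" by (simp add: algebra_simps)
    then show ?thesis using p q by (simp add: \<kappa>_def field_simps)
  qed
  have \<kappa>0: "0 < \<kappa>" using r1 q by (simp add: \<kappa>_def)
  have wD: "w \<in> D0_fun s p D" using w by (simp add: compact_torsion_def)
  have [measurable]: "w \<in> borel_measurable borel" using wD by (simp add: D0_fun_def)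
  have w0: "w x = 0" if "x \<notin> D" for x using wD that by (simp add: D0_fun_def)
  obtain \<phi> where \<phi>: "\<And>n. \<phi> n \<in> C0inf D" "(\<lambda>n. pint lborel 1 (\<lambda>x. \<phi> n x - w x)) \<longlonglongrightarrow> 0"
      "(\<lambda>n. energy s p (\<phi> n)) \<longlonglongrightarrow> energy s p w" "energy s p w < \<infinity>"
    using D0_fun_approx[OF sp wD] by blast
  note [measurable] = C0inf_borel[OF \<phi>(1)]
  note iw = torsion_integral_abs_le[OF sp D(1,2) w]
  define L where "L = r * k powr (r - 1)"
  have L: "0 < L" using r1 k by (simp add: L_def)
  \<comment> \<open>the largest step for which the competitor is a nondecreasing function of \<open>\<bar>\<phi> n\<bar>\<close>\<close>
  define \<epsilon> where "\<epsilon> = 1 / L"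
  have \<epsilon>: "0 < \<epsilon>" "\<epsilon> * (r * k powr (r - 1)) \<le> 1" using L by (auto simp: \<epsilon>_def L_def)
  define g where "g f x = min \<bar>f x\<bar> k powr r" for f :: "'a \<Rightarrow> real" and x
  define G where "G f x = min \<bar>f x\<bar> k powr \<kappa>" for f :: "'a \<Rightarrow> real" and x
  have g0: "0 \<le> g f x" for f x by (simp add: g_def)
  have [measurable]: "g f \<in> borel_measurable borel" "G f \<in> borel_measurable borel"
    if [measurable]: "f \<in> borel_measurable borel" for f
    unfolding g_def[abs_def] G_def[abs_def] by measurable
  have glip: "\<bar>g f x - g h x\<bar> \<le> L * \<bar>f x - h x\<bar>" for f h x
  proof -
    have *: "\<bar>g f x - g h x\<bar> \<le> L * (\<bar>f x\<bar> - \<bar>h x\<bar>)" if "\<bar>h x\<bar> \<le> \<bar>f x\<bar>" for f h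
      using truncated_power_lipschitz[of "\<bar>h x\<bar>" "\<bar>f x\<bar>" k r] that k r1 by (simp add: g_def L_def)
    have "\<bar>g f x - g h x\<bar> \<le> L * \<bar>\<bar>f x\<bar> - \<bar>h x\<bar>\<bar>"
      using *[of h f] *[of f h] by (cases "\<bar>h x\<bar> \<le> \<bar>f x\<bar>") (auto simp: abs_minus_commute)
    also have "\<dots> \<le> L * \<bar>f x - h x\<bar>" using L by (intro mult_left_mono) auto
    finally show ?thesis .
  qed
  have ig: "integrable lborel (g f)" if f: "integrable lborel f" for f
  proof (rule Bochner_Integration.integrable_bound)
    show "integrable lborel (\<lambda>x. L * \<bar>f x\<bar>)" using f by (intro integrable_mult_right integrable_abs)
    show "AE x in lborel. norm (g f x) \<le> norm (L * \<bar>f x\<bar>)"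
      using glip[of f _ "\<lambda>x. 0"] r1 k L by (auto simp: g_def abs_mult)
  qed (use f in \<open>auto dest: borel_measurable_integrable\<close>)
  define X where "X f = (LINT x|lborel. g f x)" for f
  have X0: "0 \<le> X f" for f unfolding X_def using g0 by (intro integral_nonneg_AE) auto
  have nnX: "(\<integral>\<^sup>+ x. ennreal (g f x) \<partial>lborel) = ennreal (X f)" if "integrable lborel f" for f
    unfolding X_def using ig[OF that] g0 by (intro nn_integral_eq_integral) auto
  have Gq: "pint lborel q (G f) = ennreal (X f)" if "integrable lborel f" for f
    unfolding nnX[OF that, symmetric] pint_def
    using k q by (intro nn_integral_cong) (simp add: G_def g_def powr_powr \<kappa>_def)
  have step: "1 / p * enn2real (energy s p w) - (LINT x|lborel. w x)
      \<le> 1 / p * (enn2real (energy s p (\<phi> n)) - \<epsilon> / \<kappa> powr p * (c * X (\<phi> n) powr (p / q)))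
        - (LINT x|lborel. \<bar>\<phi> n x\<bar>) + \<epsilon> * X (\<phi> n)" for n
  proof -
    obtain K where K: "compact K" "K \<subseteq> D" "\<And>x. x \<notin> K \<Longrightarrow> \<phi> n x = 0" using \<phi>(1) by (rule C0inf_compact_support) blast
    have \<phi>i: "integrable lborel (\<phi> n)" by (rule C0inf_integrable[OF \<phi>(1)])
    have \<phi>c: "continuous_on UNIV (\<phi> n)" by (rule C0inf_continuous[OF \<phi>(1)])
    have E\<phi>: "energy s p (\<phi> n) < \<infinity>" by (rule C0inf_energy_finite[OF sp \<phi>(1)])
    define v where "v x = \<bar>\<phi> n x\<bar> - \<epsilon> * g (\<phi> n) x" for x
    have gc: "continuous_on UNIV (g (\<phi> n))"
      unfolding g_def[abs_def] using r1 k by (intro continuous_on_powr' continuous_intros \<phi>c) auto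
    have Gc: "continuous_on UNIV (G (\<phi> n))"
      unfolding G_def[abs_def] using \<kappa>0 k by (intro continuous_on_powr' continuous_intros \<phi>c) auto
    have vc: "continuous_on UNIV v" unfolding v_def[abs_def] by (intro continuous_intros \<phi>c gc)
    have [measurable]: "v \<in> borel_measurable borel" using vc by (rule borel_measurable_continuous_onI)
    have "energy s p v + ennreal (\<epsilon> / \<kappa> powr p) * energy s p (G (\<phi> n)) \<le> energy s p (\<phi> n)"
    proof (rule energy_add_pointwise_le)
      fix x y
      have "\<bar>v x - v y\<bar> powr p + \<epsilon> / \<kappa> powr p * \<bar>G (\<phi> n) x - G (\<phi> n) y\<bar> powr p \<le> \<bar>\<bar>\<phi> n x\<bar> - \<bar>\<phi> n y\<bar>\<bar> powr p"
        unfolding v_def g_def G_def using p k r1 \<epsilon> \<kappa> by (intro truncated_power_competitor) auto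
      also have "\<dots> \<le> \<bar>\<phi> n x - \<phi> n y\<bar> powr p" using p by (intro powr_mono2) auto
      finally show "\<bar>v x - v y\<bar> powr p + \<epsilon> / \<kappa> powr p * \<bar>G (\<phi> n) x - G (\<phi> n) y\<bar> powr p \<le> \<bar>\<phi> n x - \<phi> n y\<bar> powr p" .
    qed (use \<epsilon> in auto)
    moreover have "ennreal c * epowr (pint lborel q (G (\<phi> n))) (p / q) \<le> energy s p (G (\<phi> n))"
      using p q K D(3) k \<kappa>0 by (intro lambda_pq_le_continuous[OF _ _ c \<Omega> Gc K(1)]) (auto simp: G_def)
    ultimately have "energy s p v + ennreal (\<epsilon> / \<kappa> powr p) * (ennreal c * epowr (pint lborel q (G (\<phi> n))) (p / q)) \<le> energy s p (\<phi> n)"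
      by (meson add_left_mono mult_left_mono order_trans zero_le)
    then have le: "energy s p v + ennreal (\<epsilon> / \<kappa> powr p * (c * X (\<phi> n) powr (p / q))) \<le> energy s p (\<phi> n)"
      using c \<epsilon> X0 by (simp add: Gq[OF \<phi>i] epowr_ennreal flip: ennreal_mult)
    have Ev: "energy s p v < \<infinity>" using le E\<phi> by (metis add_increasing2 le_less_trans order_refl zero_le order_trans)
    have "ennreal (enn2real (energy s p v) + \<epsilon> / \<kappa> powr p * (c * X (\<phi> n) powr (p / q))) \<le> ennreal (enn2real (energy s p (\<phi> n)))"
      using le Ev E\<phi> c \<epsilon> by (subst ennreal_plus) auto
    then have leR: "enn2real (energy s p v) \<le> enn2real (energy s p (\<phi> n)) - \<epsilon> / \<kappa> powr p * (c * X (\<phi> n) powr (p / q))"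
      by (simp add: ennreal_le_iff)
    have "1 / p * enn2real (energy s p w) - (LINT x|lborel. w x) \<le> 1 / p * enn2real (energy s p v) - (LINT x|lborel. v x)"
      using K k r1 Ev by (intro torsion_minimal[OF sp D(1,2) w vc K(1,2)]) (auto simp: v_def g_def)
    moreover have "1 / p * enn2real (energy s p v) \<le> 1 / p * (enn2real (energy s p (\<phi> n)) - \<epsilon> / \<kappa> powr p * (c * X (\<phi> n) powr (p / q)))"
      using leR p by (intro mult_left_mono) auto
    moreover have "(LINT x|lborel. v x) = (LINT x|lborel. \<bar>\<phi> n x\<bar>) - \<epsilon> * X (\<phi> n)"
      unfolding v_def X_def using \<phi>i ig[OF \<phi>i] by simp
    ultimately show ?thesis by linarith
  qed
  have Xlim: "(\<lambda>n. X (\<phi> n)) \<longlonglongrightarrow> X w"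
    unfolding X_def
    by (rule integral_tendsto_of_pint_1[OF ig[OF C0inf_integrable[OF \<phi>(1)]] ig[OF iw(1)] _ _ _ glip \<phi>(2)]) (use L in auto)
  have absl: "(\<lambda>n. LINT x|lborel. \<bar>\<phi> n x\<bar>) \<longlonglongrightarrow> (LINT x|lborel. \<bar>w x\<bar>)"
    using C0inf_integrable[OF \<phi>(1)] iw(1)
    by (intro integral_tendsto_of_pint_1[where L = 1, OF _ _ _ _ _ _ \<phi>(2)]) auto
  have "(\<lambda>n. 1 / p * (enn2real (energy s p (\<phi> n)) - \<epsilon> / \<kappa> powr p * (c * X (\<phi> n) powr (p / q)))
        - (LINT x|lborel. \<bar>\<phi> n x\<bar>) + \<epsilon> * X (\<phi> n))
     \<longlonglongrightarrow> 1 / p * (enn2real (energy s p w) - \<epsilon> / \<kappa> powr p * (c * X w powr (p / q)))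
        - (LINT x|lborel. \<bar>w x\<bar>) + \<epsilon> * X w"
  proof (intro tendsto_add tendsto_diff tendsto_mult tendsto_const absl Xlim)
    show "(\<lambda>n. enn2real (energy s p (\<phi> n))) \<longlonglongrightarrow> enn2real (energy s p w)"
      using \<phi>(3,4) by (intro tendsto_enn2real) auto
    show "(\<lambda>n. X (\<phi> n) powr (p / q)) \<longlonglongrightarrow> X w powr (p / q)"
      using p q X0 by (intro tendsto_powr' Xlim tendsto_const) auto
  qed
  then have "1 / p * enn2real (energy s p w) - (LINT x|lborel. w x)
     \<le> 1 / p * (enn2real (energy s p w) - \<epsilon> / \<kappa> powr p * (c * X w powr (p / q)))
        - (LINT x|lborel. \<bar>w x\<bar>) + \<epsilon> * X w"
    using step by (intro LIMSEQ_le_const) auto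
  moreover have "(LINT x|lborel. w x) \<le> (LINT x|lborel. \<bar>w x\<bar>)"
    using iw(1) by (intro integral_mono) auto
  ultimately have "\<epsilon> * (c / (p * \<kappa> powr p) * X w powr (p / q)) \<le> \<epsilon> * X w"
    using \<open>(LINT x|lborel. w x) \<le> (LINT x|lborel. \<bar>w x\<bar>)\<close> by (simp add: right_diff_distrib field_simps)
  then have main: "c / (p * \<kappa> powr p) * X w powr (p / q) \<le> X w"
    using \<epsilon>(1) by (subst (asm) mult_le_cancel_left_pos)
  have "X w \<le> (p * \<kappa> powr p / c) powr (q / (p - q))"
  proof (cases "X w = 0")
    case False
    then have Xp: "0 < X w" using X0[of w] by simp
    have "X w powr (p / q) = X w * X w powr (p / q - 1)" using Xp by (simp add: powr_diff)
    then have "X w * (c / (p * \<kappa> powr p) * X w powr (p / q - 1)) \<le> X w * 1" using main by (simp add: mult_ac)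
    then have "c / (p * \<kappa> powr p) * X w powr (p / q - 1) \<le> 1"
      using Xp by (subst (asm) mult_le_cancel_left_pos)
    then have "X w powr (p / q - 1) \<le> p * \<kappa> powr p / c"
      using c p \<kappa>0 by (simp add: field_simps)
    then have "(X w powr (p / q - 1)) powr (q / (p - q)) \<le> (p * \<kappa> powr p / c) powr (q / (p - q))"
      using q by (intro powr_mono2) auto
    moreover have eq: "(p / q - 1) * (q / (p - q)) = 1" using q by (simp add: field_simps)
    have "(X w powr (p / q - 1)) powr (q / (p - q)) = X w"
      unfolding powr_powr eq using Xp by simp
    ultimately show ?thesis by simp
  qed simp
  then show ?thesis using nnX[OF iw(1)] by (simp add: g_def ennreal_leI)
qed

text \<open>Fatou's lemma along the pieces \<open>ball 0 (n + 1) \<inter> \<Omega>\<close> with truncation at \<open>n + 1\<close>.\<close>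

lemma torsion_integrable_of_lambda_pos:
  fixes w :: "'a::euclidean_space \<Rightarrow> ennreal"
  assumes sp: "0 < s" "s < 1" "1 < p" and q: "1 \<le> q" "q < p" and \<Omega>: "open \<Omega>"
    and w: "torsion_function s p \<Omega> w" and pos: "0 < lambda_pq s p q \<Omega>"
  shows "(\<integral>\<^sup>+ x\<in>\<Omega>. epowr (w x) ((p - 1) / (p - q) * q) \<partial>lborel) < \<infinity>"
proof -
  define r where "r = (p - 1) / (p - q) * q"
  have r: "0 < r" using sp q by (simp add: r_def)
  obtain c where c: "0 < c" "ennreal c \<le> lambda_pq s p q \<Omega>"
  proof -
    obtain b where b: "0 < b" "b < lambda_pq s p q \<Omega>" using dense[OF pos] by blast
    then show ?thesis by (cases b) (auto intro: that)
  qed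
  obtain f where f: "\<And>n. compact_torsion s p (ball 0 (real (Suc n)) \<inter> \<Omega>) (f n)"
     "AE x in lborel. x \<in> \<Omega> \<longrightarrow> (\<lambda>n. ennreal (f n x)) \<longlonglongrightarrow> w x"
    using w by (rule torsion_functionE) blast
  have \<Omega>n: "open (ball 0 (real (Suc n)) \<inter> \<Omega>)" "ball 0 (real (Suc n)) \<inter> \<Omega> \<subseteq> ball 0 (real (Suc n))"
    "ball 0 (real (Suc n)) \<inter> \<Omega> \<subseteq> \<Omega>" for n
    using \<Omega> by auto
  have [measurable]: "f n \<in> borel_measurable borel" for n using f(1)[of n] by (simp add: compact_torsion_def D0_fun_def)
  have f0: "AE x in lborel. \<forall>n. 0 \<le> f n x"
    unfolding AE_all_countable using torsion_nonneg[OF sp \<Omega>n(1,2) f(1)] by blast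
  define B where "B = ennreal ((p * (r / q) powr p / c) powr (q / (p - q)))"
  define g where "g n x = ennreal (min \<bar>f n x\<bar> (real (Suc n)) powr r)" for n x
  have [measurable]: "g n \<in> borel_measurable borel" for n unfolding g_def[abs_def] by measurable
  have le: "(\<integral>\<^sup>+ x. g n x \<partial>lborel) \<le> B" for n
    using torsion_truncated_bound[OF sp q c(2,1) \<Omega> \<Omega>n f(1), of "real (Suc n)"] by (simp add: g_def B_def r_def)
  have "(\<integral>\<^sup>+ x\<in>\<Omega>. epowr (w x) r \<partial>lborel) \<le> (\<integral>\<^sup>+ x. liminf (\<lambda>n. g n x) \<partial>lborel)"
  proof (rule nn_integral_mono_AE)
    show "AE x in lborel. epowr (w x) r * indicator \<Omega> x \<le> liminf (\<lambda>n. g n x)"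
      using f(2) f0
    proof eventually_elim
      case (elim x)
      show ?case
      proof (cases "x \<in> \<Omega>")
        case True
        have g: "g n x = epowr (min (ennreal (f n x)) (ennreal (real (Suc n)))) r" for n
        proof -
          have "min (ennreal (f n x)) (ennreal (real (Suc n))) = ennreal (min (f n x) (real (Suc n)))"
            using elim by (simp add: min_def del: of_nat_Suc)
          then show ?thesis using elim by (simp add: g_def epowr_ennreal del: of_nat_Suc)
        qed
        have "(\<lambda>n. ennreal (real (Suc n))) \<longlonglongrightarrow> top"
          using LIMSEQ_Suc[OF of_nat_tendsto_top_ennreal] by (simp add: ennreal_of_nat_eq_real_of_nat)
        then have "(\<lambda>n. min (ennreal (f n x)) (ennreal (real (Suc n)))) \<longlonglongrightarrow> min (w x) top"
          using elim True by (intro tendsto_min) auto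
        then have "(\<lambda>n. g n x) \<longlonglongrightarrow> epowr (w x) r" unfolding g using r by (intro tendsto_epowr) (auto simp: min_def)
        then have "liminf (\<lambda>n. g n x) = epowr (w x) r" by (intro lim_imp_Liminf) auto
        then show ?thesis using True by simp
      qed auto
    qed
  qed
  also have "\<dots> \<le> liminf (\<lambda>n. \<integral>\<^sup>+ x. g n x \<partial>lborel)" by (rule nn_integral_liminf) measurable
  also have "\<dots> \<le> limsup (\<lambda>n. \<integral>\<^sup>+ x. g n x \<partial>lborel)" by (rule Liminf_le_Limsup) simp
  also have "\<dots> \<le> B" using le by (intro Limsup_bounded) auto
  also have "\<dots> < \<infinity>" by (simp add: B_def)
  finally show ?thesis by (simp add: r_def)
qed

section \<open>Local compactness\<close>

lemma C0inf_energy_diff_le: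
  assumes sp: "0 < s" "1 \<le> p" and u: "u \<in> C0inf \<Omega>" "v \<in> C0inf \<Omega>"
    and E: "energy s p u \<le> ennreal E" "energy s p v \<le> ennreal E" "0 \<le> E"
  shows "energy s p (\<lambda>x. u x - v x) \<le> ennreal (2 powr p * E)"
proof -
  note [measurable] = C0inf_borel[OF u(1)] C0inf_borel[OF u(2)]
  have p: "0 < p" using sp by simp
  have "gnorm s p (\<lambda>x. u x - v x) \<le> gnorm s p u + gnorm s p (\<lambda>x. (-1) * v x)"
    using gnorm_triangle[of u "\<lambda>x. (-1) * v x" p s] sp by simp
  also have "\<dots> = gnorm s p u + gnorm s p v" using p by (subst gnorm_cmult) auto
  also have "\<dots> \<le> epowr (ennreal E) (1/p) + epowr (ennreal E) (1/p)"
    unfolding gnorm_def using p E by (intro add_mono epowr_mono) auto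
  also have "\<dots> = ennreal (2 * E powr (1/p))" using E by (simp add: epowr_ennreal flip: ennreal_plus)
  finally have "epowr (gnorm s p (\<lambda>x. u x - v x)) p \<le> epowr (ennreal (2 * E powr (1/p))) p"
    using p by (rule_tac epowr_mono) auto
  then show ?thesis using p E by (simp add: energy_eq_gnorm epowr_ennreal powr_mult powr_powr)
qed

text \<open>On a ball of small radius \<open>h\<close> a function differs little from its average, in terms of the
  energy.  The energy term on the right does not depend on the ball, so that overlapping balls do no
  harm.\<close>

lemma ball_average_bound:
  fixes u :: "'a::euclidean_space \<Rightarrow> real"
  assumes sp: "0 < s" "1 \<le> p" and u: "u \<in> C0inf \<Omega>" and h: "0 < h" and x: "x \<in> ball z h"
  defines "B \<equiv> measure lborel (ball (0::'a) h)"
  shows "ennreal (\<bar>u x\<bar> powr p) \<le> ennreal (2 powr (p - 1)) *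
     (ennreal ((2 * h) powr (real DIM('a) + s * p) / B) * (\<integral>\<^sup>+ y. ennreal (\<bar>u x - u y\<bar> powr p / norm (x - y) powr (real DIM('a) + s * p)) \<partial>lborel)
       + ennreal (\<bar>(LINT y|lborel. indicator (ball z h) y * u y) / B\<bar> powr p))"
proof -
  define \<alpha> where "\<alpha> = real DIM('a) + s * p"
  have \<alpha>: "0 < \<alpha>" using sp by (simp add: \<alpha>_def add_pos_pos)
  note [measurable] = C0inf_borel[OF u]
  have B: "0 < B" "measure lborel (ball z h) = B" "emeasure lborel (ball z h) = ennreal B"
  proof -
    show 1: "0 < B" unfolding B_def using h by (rule content_ball_pos)
    show 2: "measure lborel (ball z h) = B" unfolding B_def using h by (simp add: content_ball)
    show "emeasure lborel (ball z h) = ennreal B"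
      unfolding 2[symmetric] using emeasure_lborel_ball_finite[of z h] by (intro emeasure_eq_ennreal_measure) auto
  qed
  define m where "m = (LINT y|lborel. indicator (ball z h) y * u y) / B"
  have [measurable]: "ball z h \<in> sets borel" by simp
  have iu: "integrable lborel (\<lambda>y. indicator (ball z h) y * u y)"
    using integrable_real_mult_indicator[OF _ C0inf_integrable[OF u], of "ball z h"] by (simp add: mult.commute)
  have i1: "integrable lborel (\<lambda>y. indicator (ball z h) y * u x)"
    using B(3) by (intro integrable_mult_left integrable_real_indicator) auto
  have "u x - m = (LINT y|lborel. indicator (ball z h) y * (u x - u y)) / B"
  proof -
    have "(LINT y|lborel. indicator (ball z h) y * (u x - u y))
        = (LINT y|lborel. indicator (ball z h) y * u x - indicator (ball z h) y * u y)"
      by (simp add: right_diff_distrib)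
    also have "\<dots> = (LINT y|lborel. indicator (ball z h) y * u x) - (LINT y|lborel. indicator (ball z h) y * u y)"
      by (intro Bochner_Integration.integral_diff i1 iu)
    also have "(LINT y|lborel. indicator (ball z h) y * u x) = B * u x" using B by simp
    finally show ?thesis using B by (simp add: m_def field_simps)
  qed
  also have "\<bar>\<dots>\<bar> \<le> (LINT y|lborel. \<bar>indicator (ball z h) y * (u x - u y)\<bar>) / B"
    using B by (simp add: divide_right_mono)
  also have "\<dots> = (LINT y|lborel. indicator (ball z h) y / B * \<bar>u x - u y\<bar>)"
    by (simp add: abs_mult mult.commute divide_inverse mult.left_commute flip: integral_mult_right_zero)
  finally have "ennreal \<bar>u x - m\<bar> \<le> ennreal (LINT y|lborel. indicator (ball z h) y / B * \<bar>u x - u y\<bar>)" by (rule ennreal_leI)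
  also have "\<dots> = (\<integral>\<^sup>+ y. ennreal (indicator (ball z h) y / B * \<bar>u x - u y\<bar>) \<partial>lborel)"
  proof (rule nn_integral_eq_integral[symmetric])
    have "integrable lborel (\<lambda>y. (1 / B) * \<bar>indicator (ball z h) y * u x - indicator (ball z h) y * u y\<bar>)"
      by (intro integrable_mult_right integrable_abs Bochner_Integration.integrable_diff i1 iu)
    also have "(\<lambda>y. (1 / B) * \<bar>indicator (ball z h) y * u x - indicator (ball z h) y * u y\<bar>)
        = (\<lambda>y. indicator (ball z h) y / B * \<bar>u x - u y\<bar>)"
      by (auto simp: indicator_def fun_eq_iff)
    finally show "integrable lborel (\<lambda>y. indicator (ball z h) y / B * \<bar>u x - u y\<bar>)" .
  qed (use B in auto)
  also have "\<dots> = (\<integral>\<^sup>+ y. ennreal (indicator (ball z h) y / B) * ennreal \<bar>u x - u y\<bar> \<partial>lborel)"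
    using B(1) by (intro nn_integral_cong ennreal_mult) auto
  also have "\<dots> = (\<integral>\<^sup>+ y. ennreal \<bar>u x - u y\<bar> \<partial>density lborel (\<lambda>y. ennreal (indicator (ball z h) y / B)))"
    by (subst nn_integral_density) auto
  finally have 1: "ennreal \<bar>u x - m\<bar> \<le> (\<integral>\<^sup>+ y. ennreal \<bar>u x - u y\<bar> \<partial>density lborel (\<lambda>y. ennreal (indicator (ball z h) y / B)))" .
  have mass: "(\<integral>\<^sup>+ y. ennreal (indicator (ball z h) y / B) \<partial>lborel) = 1"
  proof -
    have "(\<integral>\<^sup>+ y. ennreal (indicator (ball z h) y / B) \<partial>lborel) = (\<integral>\<^sup>+ y. ennreal (1 / B) * indicator (ball z h) y \<partial>lborel)"
      by (intro nn_integral_cong) (auto simp: indicator_def)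
    also have "\<dots> = 1" using B by (subst nn_integral_cmult_indicator) (auto simp flip: ennreal_mult)
    finally show ?thesis .
  qed
  have "ennreal (\<bar>u x - m\<bar> powr p) = epowr (ennreal \<bar>u x - m\<bar>) p" by (simp add: epowr_ennreal)
  also have "\<dots> \<le> epowr (\<integral>\<^sup>+ y. ennreal \<bar>u x - u y\<bar> \<partial>density lborel (\<lambda>y. ennreal (indicator (ball z h) y / B))) p"
    using sp by (intro epowr_mono 1) auto
  also have "\<dots> \<le> (\<integral>\<^sup>+ y. ennreal (\<bar>u x - u y\<bar> powr p) \<partial>density lborel (\<lambda>y. ennreal (indicator (ball z h) y / B)))"
    using sp mass by (intro nn_integral_jensen) (auto simp: emeasure_density)
  also have "\<dots> = (\<integral>\<^sup>+ y. ennreal (indicator (ball z h) y / B) * ennreal (\<bar>u x - u y\<bar> powr p) \<partial>lborel)"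
    by (subst nn_integral_density) auto
  also have "\<dots> \<le> (\<integral>\<^sup>+ y. ennreal ((2 * h) powr \<alpha> / B) * ennreal (\<bar>u x - u y\<bar> powr p / norm (x - y) powr \<alpha>) \<partial>lborel)"
  proof (rule nn_integral_mono)
    fix y
    show "ennreal (indicator (ball z h) y / B) * ennreal (\<bar>u x - u y\<bar> powr p)
       \<le> ennreal ((2 * h) powr \<alpha> / B) * ennreal (\<bar>u x - u y\<bar> powr p / norm (x - y) powr \<alpha>)"
    proof (cases "y \<in> ball z h \<and> x \<noteq> y")
      case True
      have "dist x y \<le> dist z x + dist z y" by (metis dist_commute dist_triangle)
      also have "\<dots> < h + h" using x True by (intro add_strict_mono) auto
      finally have "norm (x - y) powr \<alpha> \<le> (2 * h) powr \<alpha>"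
        using \<alpha> by (intro powr_mono2) (auto simp: dist_norm)
      moreover have "0 < norm (x - y) powr \<alpha>" using True by simp
      ultimately have "\<bar>u x - u y\<bar> powr p * norm (x - y) powr \<alpha> \<le> \<bar>u x - u y\<bar> powr p * (2 * h) powr \<alpha>"
        by (intro mult_left_mono) auto
      then have "\<bar>u x - u y\<bar> powr p \<le> (2 * h) powr \<alpha> * (\<bar>u x - u y\<bar> powr p / norm (x - y) powr \<alpha>)"
        using \<open>0 < norm (x - y) powr \<alpha>\<close> by (simp add: field_simps)
      then have "1 / B * \<bar>u x - u y\<bar> powr p \<le> 1 / B * ((2 * h) powr \<alpha> * (\<bar>u x - u y\<bar> powr p / norm (x - y) powr \<alpha>))"
        using B by (intro mult_left_mono) auto
      then have "ennreal (1 / B * \<bar>u x - u y\<bar> powr p) \<le> ennreal ((2 * h) powr \<alpha> / B * (\<bar>u x - u y\<bar> powr p / norm (x - y) powr \<alpha>))"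
        by (intro ennreal_leI) simp
      then show ?thesis using True B by (simp only: ennreal_mult' indicator_def) (simp flip: ennreal_mult)
    next
      case False
      then show ?thesis using B by (auto simp: indicator_def)
    qed
  qed
  also have "\<dots> = ennreal ((2 * h) powr \<alpha> / B) * (\<integral>\<^sup>+ y. ennreal (\<bar>u x - u y\<bar> powr p / norm (x - y) powr \<alpha>) \<partial>lborel)"
    by (rule nn_integral_cmult) measurable
  finally have 2: "ennreal (\<bar>u x - m\<bar> powr p) \<le> \<dots>" .
  have "\<bar>u x\<bar> powr p \<le> (\<bar>u x - m\<bar> + \<bar>m\<bar>) powr p" using sp by (intro powr_mono2) auto
  also have "\<dots> \<le> 2 powr (p - 1) * (\<bar>u x - m\<bar> powr p + \<bar>m\<bar> powr p)"
    using powr_add_weighted[of "\<bar>u x - m\<bar>" "\<bar>m\<bar>" 1 1 p] sp by simp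
  finally have "ennreal (\<bar>u x\<bar> powr p) \<le> ennreal (2 powr (p - 1) * (\<bar>u x - m\<bar> powr p + \<bar>m\<bar> powr p))"
    by (rule ennreal_leI)
  also have "\<dots> = ennreal (2 powr (p - 1)) * (ennreal (\<bar>u x - m\<bar> powr p) + ennreal (\<bar>m\<bar> powr p))"
    by (simp add: ennreal_mult ennreal_plus[symmetric] del: ennreal_plus)
  also have "\<dots> \<le> ennreal (2 powr (p - 1)) * (ennreal ((2 * h) powr \<alpha> / B) * (\<integral>\<^sup>+ y. ennreal (\<bar>u x - u y\<bar> powr p / norm (x - y) powr \<alpha>) \<partial>lborel)
       + ennreal (\<bar>m\<bar> powr p))"
    by (intro mult_left_mono add_right_mono 2) auto
  finally show ?thesis by (simp add: m_def \<alpha>_def)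
qed

text \<open>Cover the ball by finitely many balls of radius \<open>h\<close>.  The factor of the energy in the previous lemma
  is a multiple of \<open>h powr (s * p)\<close>, and \<open>h\<close> is chosen to make it \<open>\<epsilon>\<close>.  Up to a small multiple of the energy, the
  \<open>L\<^sup>p\<close> integral over a ball is thus controlled by finitely many linear functionals.\<close>

lemma local_bound_by_averages:
  fixes R s p \<epsilon> :: real
  assumes sp: "0 < s" "1 \<le> p" and \<epsilon>: "0 < \<epsilon>"
  shows "\<exists>h C F. finite F \<and> 0 \<le> C \<and> (\<forall>\<Omega>. \<forall>u\<in>C0inf \<Omega>.
     pint lborel p (\<lambda>x::'a::euclidean_space. indicator (cball 0 R) x * u x)
       \<le> ennreal \<epsilon> * energy s p u + ennreal C * ennreal (\<Sum>z\<in>F. \<bar>LINT y|lborel. indicator (ball z h) y * u y\<bar> powr p))"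
proof -
  define N where "N = real DIM('a)"
  define V where "V = unit_ball_vol N"
  have V: "0 < V" by (simp add: V_def N_def)
  define \<alpha> where "\<alpha> = N + s * p"
  have p: "0 < p" using sp by simp
  \<comment> \<open>\<open>h\<close> makes the factor of the energy equal to \<open>\<epsilon>\<close>\<close>
  define h where "h = (\<epsilon> * V / (2 powr (p - 1) * 2 powr \<alpha>)) powr (1 / (s * p))"
  have h: "0 < h" using \<epsilon> V by (simp add: h_def)
  define B where "B = measure lborel (ball (0::'a) h)"
  have BV: "B = V * h powr N" using h by (simp add: B_def content_ball V_def N_def powr_realpow)
  have B: "0 < B" using BV V h by simp
  have coef: "2 powr (p - 1) * ((2 * h) powr \<alpha> / B) = \<epsilon>"
  proof -
    have "(2 * h) powr \<alpha> / B = 2 powr \<alpha> / V * h powr (s * p)"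
      using h V by (simp add: BV powr_mult \<alpha>_def powr_add)
    also have "h powr (s * p) = \<epsilon> * V / (2 powr (p - 1) * 2 powr \<alpha>)"
      using sp p \<epsilon> V by (simp add: h_def powr_powr)
    finally show ?thesis using V by simp
  qed
  obtain F where F: "finite F" "cball (0::'a) R \<subseteq> (\<Union>z\<in>F. ball z h)"
  proof -
    have "compact (cball (0::'a) R)" by simp
    then obtain F where "finite F" "F \<subseteq> cball 0 R" "cball (0::'a) R \<subseteq> (\<Union>z\<in>F. ball z h)"
      using compactE_image[of "cball (0::'a) R" "cball 0 R" "\<lambda>z. ball z h"] h by (metis (no_types, lifting) UN_I centre_in_ball open_ball subsetI)
    then show ?thesis using that by blast
  qed
  define C where "C = 2 powr (p - 1) / B powr p * measure lborel (cball (0::'a) R)"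
  have C: "0 \<le> C" by (simp add: C_def)
  show ?thesis
  proof (intro exI conjI allI ballI)
    show "finite F" by (rule F)
    show "0 \<le> C" by (rule C)
    fix \<Omega> and u :: "'a \<Rightarrow> real" assume u: "u \<in> C0inf \<Omega>"
    note [measurable] = C0inf_borel[OF u]
    define A where "A z = (LINT y|lborel. indicator (ball z h) y * u y)" for z
    define S where "S = (\<Sum>z\<in>F. \<bar>A z\<bar> powr p)"
    have S0: "0 \<le> S" by (simp add: S_def sum_nonneg)
    define k where "k x = (\<integral>\<^sup>+ y. ennreal (\<bar>u x - u y\<bar> powr p / norm (x - y) powr \<alpha>) \<partial>lborel)" for x
    have [measurable]: "k \<in> borel_measurable borel" unfolding k_def[abs_def] by measurable
    have [measurable]: "cball (0::'a) R \<in> sets borel" by (simp add: borel_closed)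
    have "pint lborel p (\<lambda>x. indicator (cball 0 R) x * u x)
        \<le> (\<integral>\<^sup>+ x. ennreal \<epsilon> * k x + ennreal (2 powr (p - 1) / B powr p * S) * indicator (cball 0 R) x \<partial>lborel)"
      unfolding pint_def
    proof (rule nn_integral_mono)
      fix x
      show "ennreal (\<bar>indicator (cball 0 R) x * u x\<bar> powr p)
          \<le> ennreal \<epsilon> * k x + ennreal (2 powr (p - 1) / B powr p * S) * indicator (cball 0 R) x"
      proof (cases "x \<in> cball 0 R")
        case True
        then obtain z where z: "z \<in> F" "x \<in> ball z h" using F by blast
        have "ennreal (\<bar>u x\<bar> powr p) \<le> ennreal (2 powr (p - 1)) * (ennreal ((2 * h) powr \<alpha> / B) * k x + ennreal (\<bar>A z / B\<bar> powr p))"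
          using ball_average_bound[OF sp u h z(2)] unfolding A_def k_def \<alpha>_def N_def B_def by simp
        also have "\<dots> = ennreal (2 powr (p - 1) * ((2 * h) powr \<alpha> / B)) * k x + ennreal (2 powr (p - 1) * \<bar>A z / B\<bar> powr p)"
        proof -
          have gen: "ennreal c * (ennreal d * K + ennreal e) = ennreal (c * d) * K + ennreal (c * e)"
            if "0 \<le> c" "0 \<le> d" "0 \<le> e" for c d e :: real and K
            using that by (simp add: distrib_left ennreal_mult mult.assoc)
          show ?thesis using B by (intro gen) auto
        qed
        also have "\<dots> = ennreal \<epsilon> * k x + ennreal (2 powr (p - 1) * \<bar>A z / B\<bar> powr p)" by (simp only: coef)
        also have "\<dots> \<le> ennreal \<epsilon> * k x + ennreal (2 powr (p - 1) / B powr p * S)"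
        proof (intro add_left_mono ennreal_leI)
          have "\<bar>A z\<bar> powr p \<le> S" unfolding S_def using F(1) z(1) by (intro member_le_sum) auto
          moreover have "2 powr (p - 1) * \<bar>A z / B\<bar> powr p = 2 powr (p - 1) / B powr p * \<bar>A z\<bar> powr p"
            using B by (simp add: powr_divide)
          ultimately show "2 powr (p - 1) * \<bar>A z / B\<bar> powr p \<le> 2 powr (p - 1) / B powr p * S"
            by (simp only:) (intro mult_left_mono, auto)
        qed
        finally show ?thesis using True by simp
      qed simp
    qed
    also have "\<dots> = ennreal \<epsilon> * (\<integral>\<^sup>+ x. k x \<partial>lborel) + ennreal (2 powr (p - 1) / B powr p * S) * emeasure lborel (cball (0::'a) R)"
      by (simp add: nn_integral_add nn_integral_cmult)
    also have "(\<integral>\<^sup>+ x. k x \<partial>lborel) = energy s p u"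
      by (simp add: energy_iterated k_def \<alpha>_def N_def)
    also have "emeasure lborel (cball (0::'a) R) = ennreal (measure lborel (cball (0::'a) R))"
      using emeasure_lborel_cball_finite[of "0::'a" R] by (intro emeasure_eq_ennreal_measure) auto
    also have "ennreal (2 powr (p - 1) / B powr p * S) * ennreal (measure lborel (cball (0::'a) R)) = ennreal C * ennreal S"
      using S0 C by (simp add: C_def mult_ac flip: ennreal_mult)
    finally show "pint lborel p (\<lambda>x. indicator (cball 0 R) x * u x)
       \<le> ennreal \<epsilon> * energy s p u + ennreal C * ennreal (\<Sum>z\<in>F. \<bar>LINT y|lborel. indicator (ball z h) y * u y\<bar> powr p)"
      by (simp add: S_def A_def)
  qed
qed

lemma finite_family_convergent_subseq:
  fixes a :: "'i \<Rightarrow> nat \<Rightarrow> real"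
  assumes "finite F" "\<And>z. z \<in> F \<Longrightarrow> bounded (range (a z))"
  shows "\<exists>r. strict_mono r \<and> (\<forall>z\<in>F. convergent (\<lambda>n. a z (r n)))"
  using assms
proof (induction F rule: finite_induct)
  case empty
  then show ?case by (auto intro!: exI[of _ id] simp: strict_mono_def)
next
  case (insert y F)
  then obtain r where r: "strict_mono r" "\<forall>z\<in>F. convergent (\<lambda>n. a z (r n))" by auto
  have "bounded (range (\<lambda>n. a y (r n)))"
    using insert.prems[of y] by (auto intro: bounded_subset)
  from bounded_imp_convergent_subsequence[OF this] obtain l t where t: "strict_mono t" "((\<lambda>n. a y (r n)) \<circ> t) \<longlonglongrightarrow> l" by blast
  have "convergent (\<lambda>n. a z (r (t n)))" if "z \<in> F" for z
    using convergent_subseq_convergent[OF r(2)[rule_format, OF that] t(1)] by (simp add: o_def)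
  moreover have "convergent (\<lambda>n. a y (r (t n)))" using t(2) by (auto simp: convergent_def o_def)
  ultimately show ?case using strict_mono_o[OF r(1) t(1)] unfolding o_def by auto
qed

text \<open>The three properties of the inclusion into \<open>L\<^sup>q\<close> from which its compactness will follow: it is
  continuous at \<open>0\<close>, it is bounded on sets of bounded energy, and on these sets the mass near
  infinity is uniformly small.\<close>

definition Lq_continuous :: "real \<Rightarrow> real \<Rightarrow> real \<Rightarrow> 'a::euclidean_space set \<Rightarrow> bool" where
  "Lq_continuous s p q \<Omega> \<longleftrightarrow>
     (\<forall>e>0. \<exists>d>0. \<forall>u\<in>C0inf \<Omega>. energy s p u \<le> ennreal d \<longrightarrow> pint lborel q u \<le> ennreal e)"

definition Lq_bounded :: "real \<Rightarrow> real \<Rightarrow> real \<Rightarrow> 'a::euclidean_space set \<Rightarrow> bool" where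
  "Lq_bounded s p q \<Omega> \<longleftrightarrow>
     (\<forall>E\<ge>0. \<exists>Q\<ge>0. \<forall>u\<in>C0inf \<Omega>. energy s p u \<le> ennreal E \<longrightarrow> pint lborel q u \<le> ennreal Q)"

definition Lq_tight :: "real \<Rightarrow> real \<Rightarrow> real \<Rightarrow> 'a::euclidean_space set \<Rightarrow> bool" where
  "Lq_tight s p q \<Omega> \<longleftrightarrow>
     (\<forall>E\<ge>0. \<forall>e>0. \<exists>R. \<forall>u\<in>C0inf \<Omega>. energy s p u \<le> ennreal E \<longrightarrow>
        pint lborel q (\<lambda>x. indicator (- cball 0 R) x * u x) \<le> ennreal e)"

lemma pint_split:
  fixes f :: "'a::euclidean_space \<Rightarrow> real"
  assumes [measurable]: "f \<in> borel_measurable borel" "K \<in> sets borel"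
  shows "pint lborel q f = pint lborel q (\<lambda>x. indicator K x * f x) + pint lborel q (\<lambda>x. indicator (- K) x * f x)"
  unfolding pint_def
  by (subst nn_integral_add[symmetric]) (auto intro!: nn_integral_cong simp: indicator_def)

text \<open>The mass of a difference outside a large ball is small by tightness.  Inside, finitely many averages
  control it, and these converge along a subsequence because they are bounded.\<close>

lemma pairwise_close_subseq:
  fixes u :: "nat \<Rightarrow> 'a::euclidean_space \<Rightarrow> real"
  assumes sp: "0 < s" "s < 1" "1 < p" and q: "1 \<le> q" "q < p"
    and bdd: "Lq_bounded s p q \<Omega>" and tail: "Lq_tight s p q \<Omega>"
    and u: "\<And>n. u n \<in> C0inf \<Omega>" "\<And>n. energy s p (u n) \<le> ennreal E" "0 \<le> E" and e: "0 < e"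
  shows "\<exists>r::nat \<Rightarrow> nat. strict_mono r \<and> (\<forall>i j. pint lborel q (\<lambda>x. u (r i) x - u (r j) x) \<le> ennreal e)"
proof -
  note [measurable] = C0inf_borel[OF u(1)]
  define E2 where "E2 = 2 powr p * E"
  have E2: "0 \<le> E2" using u(3) by (simp add: E2_def)
  have wE: "energy s p (\<lambda>x. u i x - u j x) \<le> ennreal E2" for i j
    unfolding E2_def by (rule C0inf_energy_diff_le[OF _ _ u(1) u(1) u(2) u(2) u(3)]) (use sp in auto)
  have wC: "(\<lambda>x. u i x - u j x) \<in> C0inf \<Omega>" for i j by (intro C0inf_diff u)
  have "0 < e / 2" using e by simp
  with tail E2 obtain R where R: "\<And>u. u \<in> C0inf \<Omega> \<Longrightarrow> energy s p u \<le> ennreal E2 \<Longrightarrow>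
        pint lborel q (\<lambda>x. indicator (- cball 0 R) x * u x) \<le> ennreal (e / 2)"
    unfolding Lq_tight_def by blast
  define K where "K = cball (0::'a) R"
  have K [measurable]: "K \<in> sets borel" by (simp add: K_def borel_closed)
  define m where "m = measure lborel K"
  have m: "emeasure lborel K = ennreal m" "0 \<le> m"
    unfolding m_def K_def using emeasure_lborel_cball_finite[of "0::'a" R] by (auto intro: emeasure_eq_ennreal_measure)
  \<comment> \<open>\<open>e/2\<close> goes to the tail, \<open>e/4\<close> to lowering the exponent, \<open>e/8\<close> to the energy and \<open>e/8\<close> to the averages\<close>
  define \<delta> where "\<delta> = e / (4 * (m + 1))"
  have \<delta>: "0 < \<delta>" "\<delta> * m \<le> e / 4" using e m by (auto simp: \<delta>_def field_simps)
  define C1 where "C1 = \<delta> powr (1 - p/q)"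
  have C1: "0 < C1" using \<delta> by (simp add: C1_def)
  define \<epsilon> where "\<epsilon> = e / (8 * C1 * (E2 + 1))"
  have \<epsilon>: "0 < \<epsilon>" "C1 * (\<epsilon> * E2) \<le> e / 8"
  proof -
    show "0 < \<epsilon>" 
    proof -
      have "0 < 8 * C1 * (E2 + 1)" using C1 E2 by simp
      then show ?thesis unfolding \<epsilon>_def using e by (rule_tac divide_pos_pos)
    qed
    have "C1 * (\<epsilon> * E2) = e / 8 * (E2 / (E2 + 1))"
    proof -
      have "C1 * (e / (8 * C1 * d) * E2) = e / 8 * (E2 / d)" for d using C1 by simp
      then show ?thesis unfolding \<epsilon>_def .
    qed
    also have "\<dots> \<le> e / 8 * 1" using e E2 by (intro mult_left_mono) (auto simp: divide_le_eq)
    finally show "C1 * (\<epsilon> * E2) \<le> e / 8" by simp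
  qed
  obtain h C F where F: "finite F" "0 \<le> C" and loc: "\<And>u. u \<in> C0inf \<Omega> \<Longrightarrow>
     pint lborel p (\<lambda>x. indicator K x * u x)
       \<le> ennreal \<epsilon> * energy s p u + ennreal C * ennreal (\<Sum>z\<in>F. \<bar>LINT y|lborel. indicator (ball z h) y * u y\<bar> powr p)"
    using local_bound_by_averages[OF sp(1) _ \<epsilon>(1), of p R, where 'a = 'a] sp unfolding K_def by (meson less_imp_le)
  define \<theta> where "\<theta> = e / (8 * (C1 * C + 1))"
  have \<theta>: "0 < \<theta>" "C1 * (C * \<theta>) \<le> e / 8"
  proof -
    have "0 < C1 * C + 1" using C1 F(2) by (simp add: add_nonneg_pos)
    then show "0 < \<theta>" "C1 * (C * \<theta>) \<le> e / 8" using e by (auto simp: \<theta>_def field_simps)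
  qed
  define a where "a z n = (LINT y|lborel. indicator (ball z h) y * u n y)" for z n
  have ia: "integrable lborel (\<lambda>y. indicator (ball z h) y * u n y)" for z n
    using integrable_real_mult_indicator[OF _ C0inf_integrable[OF u(1)], of "ball z h" n] by (simp add: mult.commute)
  obtain Q where Q: "0 \<le> Q" "\<And>n. pint lborel q (u n) \<le> ennreal Q"
    using bdd u unfolding Lq_bounded_def by metis
  have "bounded (range (a z))" for z
  proof -
    have "\<bar>a z n\<bar> \<le> measure lborel (ball z h) + Q" for n
    proof -
      have [measurable]: "ball z h \<in> sets borel" by simp
      have b: "emeasure lborel (ball z h) = ennreal (measure lborel (ball z h))"
        using emeasure_lborel_ball_finite[of z h] by (intro emeasure_eq_ennreal_measure) auto
      have "ennreal \<bar>a z n\<bar> \<le> (\<integral>\<^sup>+ y. ennreal \<bar>indicator (ball z h) y * u n y\<bar> \<partial>lborel)"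
        using integral_norm_bound_ennreal[OF ia[of z n]] by (simp add: a_def)
      also have "\<dots> \<le> (\<integral>\<^sup>+ y. indicator (ball z h) y + ennreal (\<bar>u n y\<bar> powr q) \<partial>lborel)"
      proof (rule nn_integral_mono)
        fix y
        have "\<bar>u n y\<bar> \<le> 1 + \<bar>u n y\<bar> powr q"
        proof (cases "\<bar>u n y\<bar> \<le> 1")
          case False
          then have "\<bar>u n y\<bar> powr 1 \<le> \<bar>u n y\<bar> powr q" using q by (intro powr_mono) auto
          then show ?thesis using False by simp
        qed (simp add: add_increasing2)
        then have "ennreal \<bar>u n y\<bar> \<le> 1 + ennreal (\<bar>u n y\<bar> powr q)"
          by (metis ennreal_1 ennreal_leI ennreal_plus powr_ge_zero zero_le_one)
        then show "ennreal \<bar>indicator (ball z h) y * u n y\<bar> \<le> indicator (ball z h) y + ennreal (\<bar>u n y\<bar> powr q)"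
          by (auto simp: indicator_def)
      qed
      also have "\<dots> = emeasure lborel (ball z h) + pint lborel q (u n)"
        unfolding pint_def by (subst nn_integral_add) auto
      also have "\<dots> \<le> ennreal (measure lborel (ball z h)) + ennreal Q" using Q(2) b by (intro add_mono) auto
      also have "\<dots> = ennreal (measure lborel (ball z h) + Q)" using Q(1) by simp
      finally show ?thesis using Q(1) by (simp add: ennreal_le_iff del: ennreal_plus)
    qed
    then show ?thesis by (auto simp: bounded_iff)
  qed
  then obtain r0 where r0: "strict_mono r0" "\<And>z. z \<in> F \<Longrightarrow> convergent (\<lambda>n. a z (r0 n))"
    using finite_family_convergent_subseq[OF F(1), of a] by blast
  define \<rho> where "\<rho> = (\<theta> / (real (card F) + 1)) powr (1/p)"
  have \<rho>: "0 < \<rho>" using \<theta> by (simp add: \<rho>_def)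
  have "\<forall>z\<in>F. \<exists>N. \<forall>i\<ge>N. \<forall>j\<ge>N. \<bar>a z (r0 i) - a z (r0 j)\<bar> < \<rho>"
  proof
    fix z assume "z \<in> F"
    then have "Cauchy (\<lambda>n. a z (r0 n))" using r0(2) convergent_Cauchy by blast
    from metric_CauchyD[OF this \<rho>] show "\<exists>N. \<forall>i\<ge>N. \<forall>j\<ge>N. \<bar>a z (r0 i) - a z (r0 j)\<bar> < \<rho>"
      by (simp add: dist_real_def)
  qed
  then obtain N0 where N0: "\<And>z i j. z \<in> F \<Longrightarrow> N0 z \<le> i \<Longrightarrow> N0 z \<le> j \<Longrightarrow> \<bar>a z (r0 i) - a z (r0 j)\<bar> < \<rho>"
    by metis
  define N where "N = sum N0 F"
  have N: "N0 z \<le> N" if "z \<in> F" for z unfolding N_def using F(1) that by (intro member_le_sum) auto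
  define r where "r i = r0 (N + i)" for i
  have "strict_mono r" using r0(1) by (simp add: r_def strict_mono_def)
  moreover have "pint lborel q (\<lambda>x. u (r i) x - u (r j) x) \<le> ennreal e" for i j
  proof -
    define w where "w x = u (r i) x - u (r j) x" for x
    have [measurable]: "w \<in> borel_measurable borel" unfolding w_def[abs_def] by measurable
    have w: "w \<in> C0inf \<Omega>" "energy s p w \<le> ennreal E2" unfolding w_def[abs_def] by (intro wC, intro wE)
    have aw: "(LINT y|lborel. indicator (ball z h) y * w y) = a z (r i) - a z (r j)" for z
      using ia by (simp add: w_def a_def right_diff_distrib)
    have S: "(\<Sum>z\<in>F. \<bar>LINT y|lborel. indicator (ball z h) y * w y\<bar> powr p) \<le> \<theta>"
    proof -
      have "(\<Sum>z\<in>F. \<bar>LINT y|lborel. indicator (ball z h) y * w y\<bar> powr p) \<le> (\<Sum>z\<in>F. \<theta> / (real (card F) + 1))"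
      proof (rule sum_mono)
        fix z assume z: "z \<in> F"
        have "\<bar>a z (r i) - a z (r j)\<bar> powr p \<le> \<rho> powr p"
          unfolding r_def using N0[OF z, of "N + i" "N + j"] N[OF z] sp by (intro powr_mono2) auto
        also have "\<rho> powr p = \<theta> / (real (card F) + 1)" using sp \<theta> by (simp add: \<rho>_def powr_powr)
        finally show "\<bar>LINT y|lborel. indicator (ball z h) y * w y\<bar> powr p \<le> \<theta> / (real (card F) + 1)"
          by (simp only: aw)
      qed
      also have "\<dots> \<le> \<theta>" using \<theta> by (simp add: field_simps)
      finally show ?thesis .
    qed
    have "pint lborel p (\<lambda>x. indicator K x * w x)
        \<le> ennreal \<epsilon> * energy s p w + ennreal C * ennreal (\<Sum>z\<in>F. \<bar>LINT y|lborel. indicator (ball z h) y * w y\<bar> powr p)"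
      by (rule loc[OF w(1)])
    also have "\<dots> \<le> ennreal \<epsilon> * ennreal E2 + ennreal C * ennreal \<theta>"
      using w(2) S by (intro add_mono mult_left_mono ennreal_leI) auto
    also have "\<dots> = ennreal (\<epsilon> * E2 + C * \<theta>)"
      using \<epsilon> E2 F \<theta> by (simp flip: ennreal_mult ennreal_plus)
    finally have Kp: "pint lborel p (\<lambda>x. indicator K x * w x) \<le> ennreal (\<epsilon> * E2 + C * \<theta>)" .
    have "pint lborel q (\<lambda>x. indicator K x * w x)
        \<le> ennreal \<delta> * emeasure lborel K + ennreal C1 * pint lborel p (\<lambda>x. indicator K x * w x)"
      unfolding C1_def using q \<delta> by (intro pint_lower_exponent) auto
    also have "\<dots> \<le> ennreal \<delta> * ennreal m + ennreal C1 * ennreal (\<epsilon> * E2 + C * \<theta>)"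
      using Kp by (intro add_mono mult_left_mono) (auto simp: m)
    also have "\<dots> = ennreal (\<delta> * m + C1 * (\<epsilon> * E2 + C * \<theta>))"
    proof -
      have "0 \<le> \<epsilon> * E2 + C * \<theta>" using \<epsilon> E2 F \<theta> by simp
      then show ?thesis using \<delta> m C1 by (simp flip: ennreal_mult ennreal_plus)
    qed
    also have "\<dots> \<le> ennreal (e / 2)"
      using \<delta>(2) \<epsilon>(2) \<theta>(2) by (intro ennreal_leI) (simp add: distrib_left)
    finally have Kq: "pint lborel q (\<lambda>x. indicator K x * w x) \<le> ennreal (e / 2)" .
    have "pint lborel q w = pint lborel q (\<lambda>x. indicator K x * w x) + pint lborel q (\<lambda>x. indicator (- K) x * w x)"
      by (rule pint_split) auto
    also have "\<dots> \<le> ennreal (e / 2) + ennreal (e / 2)"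
      using R[OF w] by (intro add_mono Kq) (simp add: K_def)
    also have "\<dots> = ennreal e" using e by (simp flip: ennreal_plus)
    finally show ?thesis by (simp add: w_def[abs_def])
  qed
  ultimately show ?thesis by blast
qed

lemma cauchy_subseq:
  fixes u :: "nat \<Rightarrow> 'a::euclidean_space \<Rightarrow> real"
  assumes sp: "0 < s" "s < 1" "1 < p" and q: "1 \<le> q" "q < p"
    and bdd: "Lq_bounded s p q \<Omega>" and tail: "Lq_tight s p q \<Omega>"
    and u: "\<And>n. u n \<in> C0inf \<Omega>" "\<And>n. energy s p (u n) \<le> ennreal E" "0 \<le> E"
  shows "\<exists>k::nat \<Rightarrow> nat. strict_mono k \<and> (\<forall>e>0. \<exists>N. \<forall>i\<ge>N. \<forall>j\<ge>N. pint lborel q (\<lambda>x. u (k i) x - u (k j) x) \<le> ennreal e)"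
proof -
  define P where "P n s \<longleftrightarrow> (\<forall>i j. pint lborel q (\<lambda>x. u (s i) x - u (s j) x) \<le> ennreal (1 / real (Suc n)))" for n and s :: "nat \<Rightarrow> nat"
  interpret subseqs P
  proof
    fix n and t :: "nat \<Rightarrow> nat" assume "strict_mono t"
    have "\<exists>r::nat \<Rightarrow> nat. strict_mono r \<and> (\<forall>i j. pint lborel q (\<lambda>x. u (t (r i)) x - u (t (r j)) x) \<le> ennreal (1 / real (Suc n)))"
      by (rule pairwise_close_subseq[OF sp q bdd tail]) (use u in auto)
    then show "\<exists>r'. strict_mono r' \<and> P n (t \<circ> r')" unfolding P_def by simp
  qed
  have close: "pint lborel q (\<lambda>x. u (diagseq i) x - u (diagseq j) x) \<le> ennreal (1 / real (Suc n))"
    if "Suc n \<le> i" "Suc n \<le> j" for n i j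
  proof -
    have "P n (diagseq \<circ> ((+) (Suc n)))" by (rule diagseq_holds) (simp add: P_def)
    then have "pint lborel q (\<lambda>x. u (diagseq (Suc n + (i - Suc n))) x - u (diagseq (Suc n + (j - Suc n))) x) \<le> ennreal (1 / real (Suc n))"
      unfolding P_def o_def by blast
    then show ?thesis using that by simp
  qed
  have "\<exists>N. \<forall>i\<ge>N. \<forall>j\<ge>N. pint lborel q (\<lambda>x. u (diagseq i) x - u (diagseq j) x) \<le> ennreal e" if e: "0 < e" for e :: real
  proof -
    obtain n where n: "1 / real (Suc n) < e" using nat_approx_posE[OF e] by metis
    then show ?thesis using close[of n]
      by (intro exI[of _ "Suc n"]) (meson ennreal_leI less_imp_le order_trans)
  qed
  then show ?thesis by (intro exI[where x = diagseq] conjI subseq_diagseq) simp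
qed

section \<open>The compact operator\<close>

text \<open>A relation and not a function of \<open>U\<close>, since the limit is determined up to null sets only.\<close>

definition Lq_limit :: "real \<Rightarrow> 'a::euclidean_space set \<Rightarrow> (nat \<Rightarrow> 'a \<Rightarrow> real) set \<Rightarrow> ('a \<Rightarrow> real) \<Rightarrow> bool" where
  "Lq_limit q \<Omega> U f \<longleftrightarrow> f \<in> borel_measurable borel \<and> (\<forall>x. x \<notin> \<Omega> \<longrightarrow> f x = 0)
     \<and> (\<forall>\<phi>\<in>U. (\<lambda>n. pint lborel q (\<lambda>x. \<phi> n x - f x)) \<longlonglongrightarrow> 0)"

lemma pint_tendsto_0_add:
  assumes [measurable]: "\<And>n. f n \<in> borel_measurable M" "\<And>n. g n \<in> borel_measurable M" and q: "1 \<le> q"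
    and lim: "(\<lambda>n. pint M q (f n)) \<longlonglongrightarrow> 0" "(\<lambda>n. pint M q (g n)) \<longlonglongrightarrow> 0"
  shows "(\<lambda>n. pint M q (\<lambda>x. f n x + g n x)) \<longlonglongrightarrow> 0"
proof (rule tendsto_sandwich[OF _ _ tendsto_const])
  have "(\<lambda>n. ennreal (2 powr (q - 1)) * (pint M q (f n) + pint M q (g n))) \<longlonglongrightarrow> ennreal (2 powr (q - 1)) * (0 + 0)"
    by (intro ennreal_tendsto_cmult tendsto_add lim) auto
  then show "(\<lambda>n. ennreal (2 powr (q - 1)) * (pint M q (f n) + pint M q (g n))) \<longlonglongrightarrow> 0" by simp
  show "\<forall>\<^sub>F n in sequentially. pint M q (\<lambda>x. f n x + g n x) \<le> ennreal (2 powr (q - 1)) * (pint M q (f n) + pint M q (g n))"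
    using q by (intro always_eventually allI pint_add_le) auto
qed auto

lemma pint_limit_unique:
  assumes [measurable]: "\<And>n. \<phi> n \<in> borel_measurable M" "f \<in> borel_measurable M" "g \<in> borel_measurable M" and q: "1 \<le> q"
    and lim: "(\<lambda>n. pint M q (\<lambda>x. \<phi> n x - f x)) \<longlonglongrightarrow> 0" "(\<lambda>n. pint M q (\<lambda>x. \<phi> n x - g x)) \<longlonglongrightarrow> 0"
  shows "AE x in M. f x = g x"
proof -
  have "(\<lambda>n. pint M q (\<lambda>x. (f x - \<phi> n x) + (\<phi> n x - g x))) \<longlonglongrightarrow> 0"
    using q lim by (intro pint_tendsto_0_add) (auto simp: pint_minus_commute[of M q f])
  then have "pint M q (\<lambda>x. f x - g x) = 0" by (simp add: LIMSEQ_const_iff)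
  then have "AE x in M. ennreal (\<bar>f x - g x\<bar> powr q) = 0"
    unfolding pint_def by (subst (asm) nn_integral_0_iff_AE) auto
  then show ?thesis by eventually_elim auto
qed

text \<open>The limit does not depend on the sequence chosen in a class.\<close>

lemma Lq_limit_null_rel:
  assumes q: "1 \<le> q" and p: "0 < p"
    and small: "Lq_continuous s p q \<Omega>"
    and r: "(\<phi>, \<psi>) \<in> null_rel s p \<Omega>" and [measurable]: "f \<in> borel_measurable borel"
    and lim: "(\<lambda>n. pint lborel q (\<lambda>x. \<phi> n x - f x)) \<longlonglongrightarrow> 0"
  shows "(\<lambda>n. pint lborel q (\<lambda>x. \<psi> n x - f x)) \<longlonglongrightarrow> 0"
proof -
  note C = cauchy_seqs_C0inf[OF null_relD(1)[OF r]] cauchy_seqs_C0inf[OF null_relD(2)[OF r]]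
  note [measurable] = C0inf_borel[OF C(1)] C0inf_borel[OF C(2)]
  have E: "(\<lambda>n. energy s p (\<lambda>x. \<phi> n x - \<psi> n x)) \<longlonglongrightarrow> 0"
    using null_relD(3)[OF r] p by (simp add: gnorm_tendsto_0_iff)
  have "(\<lambda>n. pint lborel q (\<lambda>x. \<phi> n x - \<psi> n x)) \<longlonglongrightarrow> 0"
  proof (rule tendsto_0_ennrealI)
    fix e :: real assume "0 < e"
    with small obtain d where d: "0 < d" "\<And>u. u \<in> C0inf \<Omega> \<Longrightarrow> energy s p u \<le> ennreal d \<Longrightarrow> pint lborel q u \<le> ennreal e"
      unfolding Lq_continuous_def by blast
    have "\<forall>\<^sub>F n in sequentially. energy s p (\<lambda>x. \<phi> n x - \<psi> n x) < ennreal d"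
      using order_tendstoD(2)[OF E, of "ennreal d"] d(1) by simp
    then obtain N where "\<And>n. N \<le> n \<Longrightarrow> energy s p (\<lambda>x. \<phi> n x - \<psi> n x) < ennreal d" by (auto simp: eventually_sequentially)
    then have "pint lborel q (\<lambda>x. \<phi> n x - \<psi> n x) \<le> ennreal e" if "N \<le> n" for n
      using that by (intro d(2) C0inf_diff[OF C] less_imp_le)
    then show "\<exists>N. \<forall>n\<ge>N. pint lborel q (\<lambda>x. \<phi> n x - \<psi> n x) \<le> ennreal e" by blast
  qed
  then have "(\<lambda>n. pint lborel q (\<lambda>x. (\<psi> n x - \<phi> n x) + (\<phi> n x - f x))) \<longlonglongrightarrow> 0"
    using q lim by (intro pint_tendsto_0_add) (auto simp: pint_minus_commute[of lborel q "\<psi> _"])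
  then show ?thesis by simp
qed

lemma Lq_limit_of_cauchy:
  fixes u :: "nat \<Rightarrow> 'a::euclidean_space \<Rightarrow> real"
  assumes q: "1 \<le> q" and \<Omega>: "open \<Omega>" and u: "\<And>n. u n \<in> C0inf \<Omega>"
    and cau: "\<And>e. 0 < e \<Longrightarrow> \<exists>N. \<forall>m\<ge>N. \<forall>n\<ge>N. pint lborel q (\<lambda>x. u m x - u n x) \<le> ennreal e"
  shows "\<exists>f. f \<in> borel_measurable borel \<and> (\<forall>x. x \<notin> \<Omega> \<longrightarrow> f x = 0)
     \<and> (\<lambda>n. pint lborel q (\<lambda>x. u n x - f x)) \<longlonglongrightarrow> 0"
proof -
  note [measurable] = C0inf_borel[OF u]
  have [measurable]: "\<Omega> \<in> sets borel" using \<Omega> by simp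
  obtain g where g: "g \<in> borel_measurable lborel" "(\<lambda>n. pint lborel q (\<lambda>x. u n x - g x)) \<longlonglongrightarrow> 0"
    using pint_complete[of u lborel q] q cau by auto
  have [measurable]: "g \<in> borel_measurable borel" using g(1) by simp
  define f where "f x = indicator \<Omega> x * g x" for x
  have "f \<in> borel_measurable borel" unfolding f_def[abs_def] by measurable
  moreover have "(\<lambda>n. pint lborel q (\<lambda>x. u n x - f x)) \<longlonglongrightarrow> 0"
  proof (rule tendsto_sandwich[OF _ _ tendsto_const g(2)])
    show "\<forall>\<^sub>F n in sequentially. pint lborel q (\<lambda>x. u n x - f x) \<le> pint lborel q (\<lambda>x. u n x - g x)"
      using q C0inf_zero_off[OF u] by (intro always_eventually allI pint_mono) (auto simp: f_def indicator_def)
  qed auto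
  ultimately show ?thesis by (intro exI[of _ f]) (auto simp: f_def)
qed

lemma Lq_dist_tendsto_0_iff:
  assumes "0 < q" "\<And>n x. x \<notin> \<Omega> \<Longrightarrow> f n x = 0" "\<And>x. x \<notin> \<Omega> \<Longrightarrow> g x = 0"
  shows "(\<lambda>n. Lq_dist q \<Omega> (f n) g) \<longlonglongrightarrow> 0 \<longleftrightarrow> (\<lambda>n. pint lborel q (\<lambda>x. f n x - g x)) \<longlonglongrightarrow> 0"
  using assms by (simp add: Lq_dist_eq_supported epowr_tendsto_0_iff)

lemma Lq_supported_iff:
  assumes "0 < q" "open \<Omega>" "f \<in> borel_measurable borel" "\<And>x. x \<notin> \<Omega> \<Longrightarrow> f x = 0"
  shows "f \<in> Lq q \<Omega> \<longleftrightarrow> pint lborel q f < \<infinity>"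
proof -
  have "(\<lambda>x. indicator \<Omega> x * f x) = f" using assms(4) by (auto simp: fun_eq_iff indicator_def)
  then show ?thesis using assms by (simp add: Lq_def set_borel_measurable_def Lnorm_abs)
qed

text \<open>The operator sends a class to the common limit of its sequences.  For compactness, replace the members
  of a bounded sequence in the completion by nearby test functions, and select a Cauchy subsequence of
  these.\<close>

lemma compact_embedding_of_bounds:
  fixes \<Omega> :: "'a::euclidean_space set"
  assumes sp: "0 < s" "s < 1" "1 < p" and q: "1 \<le> q" "q < p" and \<Omega>: "open \<Omega>"
    and small: "Lq_continuous s p q \<Omega>"
    and bdd: "Lq_bounded s p q \<Omega>" and tail: "Lq_tight s p q \<Omega>"
  shows "compact_embedding s p q \<Omega>"
proof -
  have p: "0 < p" "1 \<le> p" and q0: "0 < q" using sp q by auto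
  note nr = Lq_limit_null_rel[OF q(1) p(1) small]
  have finE: "pint lborel q u < top" if u: "u \<in> C0inf \<Omega>" for u
  proof -
    have "energy s p u < top" using C0inf_energy_finite[OF sp u] by simp
    then obtain E where "energy s p u = ennreal E" "0 \<le> E" by (cases "energy s p u") auto
    then show ?thesis using bdd u unfolding Lq_bounded_def by (metis ennreal_less_top le_less_trans order_refl)
  qed
  have exL: "\<exists>f. Lq_limit q \<Omega> U f" if "U \<in> D0 s p \<Omega>" for U
  proof -
    obtain \<phi> where \<phi>: "\<phi> \<in> cauchy_seqs s p \<Omega>" "U = null_rel s p \<Omega> `` {\<phi>}" using \<open>U \<in> D0 s p \<Omega>\<close> by (rule D0E)
    have "\<exists>f. f \<in> borel_measurable borel \<and> (\<forall>x. x \<notin> \<Omega> \<longrightarrow> f x = 0) \<and> (\<lambda>n. pint lborel q (\<lambda>x. \<phi> n x - f x)) \<longlonglongrightarrow> 0"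
    proof (rule Lq_limit_of_cauchy[OF q(1) \<Omega> cauchy_seqs_C0inf[OF \<phi>(1)]])
      fix e :: real assume "0 < e"
      with small obtain d where d: "0 < d" "\<And>u. u \<in> C0inf \<Omega> \<Longrightarrow> energy s p u \<le> ennreal d \<Longrightarrow> pint lborel q u \<le> ennreal e"
        unfolding Lq_continuous_def by blast
      have "0 < epowr (ennreal d) (1/p)" using d by simp
      from cauchy_seqsD[OF \<phi>(1) this] obtain N where
        N: "\<And>m n. N \<le> m \<Longrightarrow> N \<le> n \<Longrightarrow> gnorm s p (\<lambda>x. \<phi> m x - \<phi> n x) < epowr (ennreal d) (1/p)" by blast
      have "pint lborel q (\<lambda>x. \<phi> m x - \<phi> n x) \<le> ennreal e" if "N \<le> m" "N \<le> n" for m n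
      proof (rule d(2)[OF C0inf_diff[OF cauchy_seqs_C0inf[OF \<phi>(1)] cauchy_seqs_C0inf[OF \<phi>(1)]]])
        show "energy s p (\<lambda>x. \<phi> m x - \<phi> n x) \<le> ennreal d"
          using N[OF that] p by (simp add: gnorm_def epowr_less_iff epowr_epowr less_imp_le)
      qed
      then show "\<exists>N. \<forall>m\<ge>N. \<forall>n\<ge>N. pint lborel q (\<lambda>x. \<phi> m x - \<phi> n x) \<le> ennreal e" by blast
    qed
    then obtain f where f: "f \<in> borel_measurable borel" "\<And>x. x \<notin> \<Omega> \<Longrightarrow> f x = 0" "(\<lambda>n. pint lborel q (\<lambda>x. \<phi> n x - f x)) \<longlonglongrightarrow> 0"
      by blast
    then have "Lq_limit q \<Omega> U f" unfolding Lq_limit_def \<phi>(2) using nr by auto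
    then show ?thesis by blast
  qed
  define T where "T U = (SOME f. Lq_limit q \<Omega> U f)" for U
  have T: "Lq_limit q \<Omega> U (T U)" if "Lq_limit q \<Omega> U f" for U f
    unfolding T_def using that someI_ex[of "Lq_limit q \<Omega> U"] by blast
  have T_eq: "AE x in lborel. T U x = f x" if f: "Lq_limit q \<Omega> U f" and \<phi>: "\<phi> \<in> U" "\<And>n. \<phi> n \<in> C0inf \<Omega>" for U f \<phi>
  proof (rule pint_limit_unique[OF _ _ _ q(1)])
    show "\<phi> n \<in> borel_measurable lborel" for n using C0inf_borel[OF \<phi>(2)] by simp
    show "T U \<in> borel_measurable lborel" "(\<lambda>n. pint lborel q (\<lambda>x. \<phi> n x - T U x)) \<longlonglongrightarrow> 0"
      using T[OF f] \<phi>(1) by (auto simp: Lq_limit_def)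
    show "f \<in> borel_measurable lborel" "(\<lambda>n. pint lborel q (\<lambda>x. \<phi> n x - f x)) \<longlonglongrightarrow> 0"
      using f \<phi>(1) by (auto simp: Lq_limit_def)
  qed
  have TD: "T U \<in> borel_measurable borel" "\<And>x. x \<notin> \<Omega> \<Longrightarrow> T U x = 0"
    "\<And>\<phi>. \<phi> \<in> U \<Longrightarrow> (\<lambda>n. pint lborel q (\<lambda>x. \<phi> n x - T U x)) \<longlonglongrightarrow> 0" if "U \<in> D0 s p \<Omega>" for U
    using T exL[OF that] by (auto simp: Lq_limit_def)
  have Lq_of_lim: "pint lborel q f < \<infinity>"
    if [measurable]: "f \<in> borel_measurable borel" and \<phi>: "\<And>n. \<phi> n \<in> C0inf \<Omega>" and lim: "(\<lambda>n. pint lborel q (\<lambda>x. \<phi> n x - f x)) \<longlonglongrightarrow> 0" for f \<phi>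
  proof -
    note [measurable] = C0inf_borel[OF \<phi>]
    obtain n where n: "pint lborel q (\<lambda>x. \<phi> n x - f x) < top"
      using order_tendstoD(2)[OF lim, of top] by (auto simp: eventually_sequentially)
    have "pint lborel q (\<lambda>x. (f x - \<phi> n x) + \<phi> n x) \<le> ennreal (2 powr (q - 1)) * (pint lborel q (\<lambda>x. f x - \<phi> n x) + pint lborel q (\<phi> n))"
      using q by (intro pint_add_le) auto
    also have "\<dots> < top"
      using n finE[OF \<phi>[of n]] by (simp add: ennreal_mult_less_top pint_minus_commute[of lborel q f])
    finally show ?thesis by simp
  qed
  have "compact_operator s p q \<Omega> T"
    unfolding compact_operator_def
  proof (intro conjI ballI allI impI)
    fix U assume U: "U \<in> D0 s p \<Omega>"
    obtain \<phi> where \<phi>: "\<phi> \<in> cauchy_seqs s p \<Omega>" "\<phi> \<in> U" using U by (rule D0E)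
    show "T U \<in> Lq q \<Omega>"
      using Lq_of_lim[OF TD(1)[OF U] cauchy_seqs_C0inf[OF \<phi>(1)] TD(3)[OF U \<phi>(2)]]
        Lq_supported_iff[OF q0 \<Omega> TD(1)[OF U] TD(2)[OF U]] by simp
  next
    fix U V assume U: "U \<in> D0 s p \<Omega>" and V: "V \<in> D0 s p \<Omega>"
    obtain \<phi> where \<phi>: "\<phi> \<in> cauchy_seqs s p \<Omega>" "\<phi> \<in> U" using U by (rule D0E)
    obtain \<psi> where \<psi>: "\<psi> \<in> cauchy_seqs s p \<Omega>" "\<psi> \<in> V" using V by (rule D0E)
    note [measurable] = TD(1)[OF U] TD(1)[OF V]
    have "Lq_limit q \<Omega> (D0_add s p \<Omega> U V) (\<lambda>x. T U x + T V x)"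
      unfolding Lq_limit_def
    proof (intro conjI ballI allI impI)
      fix \<xi> assume "\<xi> \<in> D0_add s p \<Omega> U V"
      then obtain a b where ab: "a \<in> U" "b \<in> V" "((\<lambda>n x. a n x + b n x), \<xi>) \<in> null_rel s p \<Omega>" by (auto simp: D0_add_def)
      have Ca: "a \<in> cauchy_seqs s p \<Omega>" "b \<in> cauchy_seqs s p \<Omega>"
        using U V ab(1,2) by (auto simp: D0_def elim!: quotientE dest: null_relD)
      note [measurable] = C0inf_borel[OF cauchy_seqs_C0inf[OF Ca(1)]] C0inf_borel[OF cauchy_seqs_C0inf[OF Ca(2)]]
      have "(\<lambda>n. pint lborel q (\<lambda>x. (a n x - T U x) + (b n x - T V x))) \<longlonglongrightarrow> 0"
        using q TD(3)[OF U ab(1)] TD(3)[OF V ab(2)] by (intro pint_tendsto_0_add) auto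
      then have "(\<lambda>n. pint lborel q (\<lambda>x. (a n x + b n x) - (T U x + T V x))) \<longlonglongrightarrow> 0" by (simp add: algebra_simps)
      from nr[OF ab(3) _ this] show "(\<lambda>n. pint lborel q (\<lambda>x. \<xi> n x - (T U x + T V x))) \<longlonglongrightarrow> 0" by simp
    qed (use TD(2)[OF U] TD(2)[OF V] in auto)
    moreover have "(\<lambda>n x. \<phi> n x + \<psi> n x) \<in> D0_add s p \<Omega> U V"
      unfolding D0_add_def using null_rel_refl[OF cauchy_seqs_add[OF \<phi>(1) \<psi>(1) p(2)]] \<phi>(2) \<psi>(2) by blast
    ultimately have "AE x in lborel. T (D0_add s p \<Omega> U V) x = T U x + T V x"
      using C0inf_add[OF cauchy_seqs_C0inf[OF \<phi>(1)] cauchy_seqs_C0inf[OF \<psi>(1)]] by (intro T_eq) auto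
    then show "AE x\<in>\<Omega> in lborel. T (D0_add s p \<Omega> U V) x = T U x + T V x" by eventually_elim simp
  next
    fix c :: real and U assume U: "U \<in> D0 s p \<Omega>"
    obtain \<phi> where \<phi>: "\<phi> \<in> cauchy_seqs s p \<Omega>" "\<phi> \<in> U" using U by (rule D0E)
    note [measurable] = TD(1)[OF U]
    have "Lq_limit q \<Omega> (D0_scale s p \<Omega> c U) (\<lambda>x. c * T U x)"
      unfolding Lq_limit_def
    proof (intro conjI ballI allI impI)
      fix \<xi> assume "\<xi> \<in> D0_scale s p \<Omega> c U"
      then obtain a where ab: "a \<in> U" "((\<lambda>n x. c * a n x), \<xi>) \<in> null_rel s p \<Omega>" by (auto simp: D0_scale_def)
      have Ca: "a \<in> cauchy_seqs s p \<Omega>"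
        using U ab(1) by (auto simp: D0_def elim!: quotientE dest: null_relD)
      note [measurable] = C0inf_borel[OF cauchy_seqs_C0inf[OF Ca]]
      have "(\<lambda>n. ennreal (\<bar>c\<bar> powr q) * pint lborel q (\<lambda>x. a n x - T U x)) \<longlonglongrightarrow> ennreal (\<bar>c\<bar> powr q) * 0"
        by (intro ennreal_tendsto_cmult TD(3)[OF U ab(1)]) simp
      then have "(\<lambda>n. pint lborel q (\<lambda>x. c * a n x - c * T U x)) \<longlonglongrightarrow> 0"
        by (simp add: pint_cmult flip: right_diff_distrib)
      from nr[OF ab(2) _ this] show "(\<lambda>n. pint lborel q (\<lambda>x. \<xi> n x - c * T U x)) \<longlonglongrightarrow> 0" by simp
    qed (use TD(2)[OF U] in auto)
    moreover have "(\<lambda>n x. c * \<phi> n x) \<in> D0_scale s p \<Omega> c U"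
      unfolding D0_scale_def using null_rel_refl[OF cauchy_seqs_cmult[OF \<phi>(1) p(2)]] \<phi>(2) by blast
    ultimately have "AE x in lborel. T (D0_scale s p \<Omega> c U) x = c * T U x"
      using C0inf_cmult[OF cauchy_seqs_C0inf[OF \<phi>(1)]] by (intro T_eq) auto
    then show "AE x\<in>\<Omega> in lborel. T (D0_scale s p \<Omega> c U) x = c * T U x" by eventually_elim simp
  next
    fix U :: "nat \<Rightarrow> (nat \<Rightarrow> 'a \<Rightarrow> real) set" assume "(\<forall>n. U n \<in> D0 s p \<Omega>) \<and> (\<exists>C<\<infinity>. \<forall>n. D0_norm s p (U n) \<le> C)"
    then obtain C where U: "\<And>n. U n \<in> D0 s p \<Omega>" and C: "C < \<infinity>" "\<And>n. D0_norm s p (U n) \<le> C" by blast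
    have "\<exists>v. v \<in> C0inf \<Omega> \<and> gnorm s p v \<le> C + 1 \<and> pint lborel q (\<lambda>x. v x - T (U n) x) \<le> ennreal (1 / real (Suc n))" for n
    proof -
      obtain \<phi> where \<phi>: "\<phi> \<in> cauchy_seqs s p \<Omega>" "U n = null_rel s p \<Omega> `` {\<phi>}" "\<phi> \<in> U n" using U by (rule D0E)
      obtain l where l: "l < top" "(\<lambda>m. gnorm s p (\<phi> m)) \<longlonglongrightarrow> l" using gnorm_convergent[OF sp \<phi>(1)] by blast
      have "l \<le> C" using C(2)[of n] D0_norm_eq[OF sp \<phi>(1) l(2)] by (simp add: \<phi>(2))
      then have "l < C + 1" using C(1) l(1)
        by (metis add.right_neutral ennreal_add_left_cancel_less infinity_ennreal_def le_less_trans less_top zero_less_one order_less_imp_not_eq)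
      then have "\<forall>\<^sub>F m in sequentially. gnorm s p (\<phi> m) < C + 1" using order_tendstoD(2)[OF l(2)] by blast
      moreover have "\<forall>\<^sub>F m in sequentially. pint lborel q (\<lambda>x. \<phi> m x - T (U n) x) < ennreal (1 / real (Suc n))"
        using order_tendstoD(2)[OF TD(3)[OF U \<phi>(3)], of "ennreal (1 / real (Suc n))"] by (simp del: of_nat_Suc)
      ultimately have "\<forall>\<^sub>F m in sequentially. gnorm s p (\<phi> m) < C + 1 \<and> pint lborel q (\<lambda>x. \<phi> m x - T (U n) x) < ennreal (1 / real (Suc n))"
        by (rule eventually_conj)
      then obtain m where "gnorm s p (\<phi> m) < C + 1" "pint lborel q (\<lambda>x. \<phi> m x - T (U n) x) < ennreal (1 / real (Suc n))"
        using eventually_happens'[OF sequentially_bot] by blast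
      then show ?thesis using cauchy_seqs_C0inf[OF \<phi>(1), of m] by (intro exI[of _ "\<phi> m"]) (auto intro: less_imp_le)
    qed
    then obtain v where v: "\<And>n. v n \<in> C0inf \<Omega>" "\<And>n. gnorm s p (v n) \<le> C + 1"
        "\<And>n. pint lborel q (\<lambda>x. v n x - T (U n) x) \<le> ennreal (1 / real (Suc n))" by metis
    note [measurable] = C0inf_borel[OF v(1)] TD(1)[OF U]
    obtain E where E: "epowr (C + 1) p = ennreal E" "0 \<le> E"
    proof -
      have "epowr (C + 1) p < top" using C(1) by simp
      then show ?thesis by (cases "epowr (C + 1) p") (auto intro: that)
    qed
    have vE: "energy s p (v n) \<le> ennreal E" for n
      unfolding E(1)[symmetric] energy_eq_gnorm[OF p(1)] using p v(2) by (rule_tac epowr_mono) auto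
    have "\<exists>k::nat \<Rightarrow> nat. strict_mono k \<and> (\<forall>e>0. \<exists>N. \<forall>i\<ge>N. \<forall>j\<ge>N. pint lborel q (\<lambda>x. v (k i) x - v (k j) x) \<le> ennreal e)"
      by (rule cauchy_subseq[OF sp q bdd tail v(1) vE E(2)])
    then obtain k where k: "strict_mono (k :: nat \<Rightarrow> nat)" "\<And>e. 0 < e \<Longrightarrow> \<exists>N. \<forall>i\<ge>N. \<forall>j\<ge>N. pint lborel q (\<lambda>x. v (k i) x - v (k j) x) \<le> ennreal e"
      by blast
    obtain f where f: "f \<in> borel_measurable borel" "\<And>x. x \<notin> \<Omega> \<Longrightarrow> f x = 0" "(\<lambda>n. pint lborel q (\<lambda>x. v (k n) x - f x)) \<longlonglongrightarrow> 0"
      using Lq_limit_of_cauchy[OF q(1) \<Omega>, of "\<lambda>n. v (k n)"] v(1) k(2) by blast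
    note [measurable] = f(1)
    have "f \<in> Lq q \<Omega>"
      using Lq_of_lim[OF f(1) _ f(3)] v(1) Lq_supported_iff[OF q0 \<Omega> f(1,2)] by simp
    moreover have "(\<lambda>n. Lq_dist q \<Omega> (T (U (k n))) f) \<longlonglongrightarrow> 0"
    proof -
      have "(\<lambda>n. pint lborel q (\<lambda>x. v n x - T (U n) x)) \<longlonglongrightarrow> 0"
      proof (rule tendsto_sandwich[OF _ _ tendsto_const])
        have "(\<lambda>n. ennreal (1 / real (Suc n))) \<longlonglongrightarrow> ennreal 0"
          by (intro tendsto_ennrealI LIMSEQ_Suc[OF lim_1_over_n])
        then show "(\<lambda>n. ennreal (1 / real (Suc n))) \<longlonglongrightarrow> 0" by simp
      qed (use v(3) in auto)
      from LIMSEQ_subseq_LIMSEQ[OF this k(1)]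
      have "(\<lambda>n. pint lborel q (\<lambda>x. v (k n) x - T (U (k n)) x)) \<longlonglongrightarrow> 0" by (simp add: o_def)
      then have "(\<lambda>n. pint lborel q (\<lambda>x. (T (U (k n)) x - v (k n) x) + (v (k n) x - f x))) \<longlonglongrightarrow> 0"
        using q f(3) by (intro pint_tendsto_0_add) (auto simp: pint_minus_commute[of lborel q "v _" "T _"])
      then show ?thesis
        using Lq_dist_tendsto_0_iff[of q \<Omega> "\<lambda>n. T (U (k n))" f] q0 TD(2)[OF U] f(2) by simp
    qed
    ultimately show "\<exists>k f. strict_mono k \<and> f \<in> Lq q \<Omega> \<and> (\<lambda>n. Lq_dist q \<Omega> (T (U (k n))) f) \<longlonglongrightarrow> 0"
      using k(1) by blast
  qed
  moreover have "AE x\<in>\<Omega> in lborel. T (D0_embed s p \<Omega> u) x = u x" if u: "u \<in> C0inf \<Omega>" for u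
  proof -
    have "Lq_limit q \<Omega> (D0_embed s p \<Omega> u) u"
      unfolding Lq_limit_def D0_embed_def
      using nr[OF _ C0inf_borel[OF u], of "\<lambda>n. u"] C0inf_borel[OF u] C0inf_zero_off[OF u] by auto
    moreover have "(\<lambda>n. u) \<in> D0_embed s p \<Omega> u"
      unfolding D0_embed_def using null_rel_refl[OF cauchy_seqs_const[OF u]] by auto
    ultimately have "AE x in lborel. T (D0_embed s p \<Omega> u) x = u x" using u by (intro T_eq) auto
    then show ?thesis by eventually_elim simp
  qed
  ultimately show ?thesis unfolding compact_embedding_def by blast
qed

section \<open>The equivalence\<close>

text \<open>In the additive Hardy-Young inequality the parameter \<open>a\<close> is free.  Large \<open>a\<close> makes the torsion term
  small and gives continuity; small \<open>a\<close> makes the energy term small, and on the complement of a large ball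
  the torsion term is small because the weight is integrable.\<close>

lemma compact_embedding_of_torsion_integrable:
  fixes w :: "'a::euclidean_space \<Rightarrow> ennreal"
  assumes sp: "0 < s" "s < 1" "1 < p" and q: "1 \<le> q" "q < p" and \<Omega>: "open \<Omega>"
    and w: "torsion_function s p \<Omega> w"
    and fin: "(\<integral>\<^sup>+ x\<in>\<Omega>. epowr (w x) ((p - 1) / (p - q) * q) \<partial>lborel) < \<infinity>"
  shows "compact_embedding s p q \<Omega>"
proof -
  define \<gamma> where "\<gamma> = (p - 1) / (p - q) * q"
  have \<gamma>: "0 < \<gamma>" using q sp by (simp add: \<gamma>_def)
  have [measurable]: "\<Omega> \<in> sets borel" using \<Omega> by simp
  define W where "W x = w x * indicator \<Omega> x" for x
  have "w \<in> borel_measurable (restrict_space lborel \<Omega>)" using w by (simp add: torsion_function_def)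
  then have W [measurable]: "W \<in> borel_measurable borel"
    unfolding W_def[abs_def] by (subst (asm) borel_measurable_restrict_space_iff_ennreal) auto
  have Ww: "W x = w x" if "x \<in> \<Omega>" for x using that by (simp add: W_def)
  have [measurable]: "(\<lambda>x. epowr (W x) \<gamma>) \<in> borel_measurable borel"
    using \<gamma> by (auto intro: measurable_compose[OF W borel_measurable_epowr])
  define \<nu> where "\<nu> = density lborel (\<lambda>x. epowr (W x) \<gamma> * indicator \<Omega> x)"
  have \<nu>: "emeasure \<nu> A = (\<integral>\<^sup>+ x\<in>A \<inter> \<Omega>. epowr (W x) \<gamma> \<partial>lborel)" if "A \<in> sets borel" for A
    unfolding \<nu>_def using that by (subst emeasure_density) (auto intro!: nn_integral_cong simp: indicator_def)
  have "emeasure \<nu> UNIV = (\<integral>\<^sup>+ x\<in>\<Omega>. epowr (w x) \<gamma> \<partial>lborel)"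
    by (subst \<nu>) (auto intro!: nn_integral_cong simp: indicator_def Ww)
  then have "emeasure \<nu> UNIV < top" using fin by (simp add: \<gamma>_def)
  then obtain i where i: "emeasure \<nu> UNIV = ennreal i" "0 \<le> i"
    by (cases "emeasure \<nu> UNIV") auto
  have key: "pint lborel q (\<lambda>x. indicator A x * u x) \<le> ennreal a * energy s p u + ennreal (a powr (- q / (p - q))) * emeasure \<nu> A"
    if "u \<in> C0inf \<Omega>" "A \<in> sets borel" "0 < a" for u A a
    using integral_power_le_energy_add_torsion[OF sp q \<Omega> w that(1) W Ww that(2,3)] \<nu>[OF that(2)] by (simp add: \<gamma>_def)
  have keyU: "pint lborel q u \<le> ennreal a * energy s p u + ennreal (a powr (- q / (p - q))) * ennreal i"
    if "u \<in> C0inf \<Omega>" "0 < a" for u a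
    using key[OF that(1) _ that(2), of UNIV] by (simp add: i)
  show ?thesis
  proof (rule compact_embedding_of_bounds[OF sp q \<Omega>])
    show "Lq_continuous s p q \<Omega>"
      unfolding Lq_continuous_def
    proof (intro allI impI)
      fix e :: real assume e: "0 < e"
      \<comment> \<open>\<open>a\<close> solves \<open>a powr (- q / (p - q)) = e / (2 * (i + 1))\<close>\<close>
      define a where "a = (2 * (i + 1) / e) powr ((p - q) / q)"
      have a: "0 < a" using e i by (simp add: a_def)
      have "a powr (- q / (p - q)) = (2 * (i + 1) / e) powr (- 1)"
        using q by (simp add: a_def powr_powr)
      also have "\<dots> = e / (2 * (i + 1))" using e i by (simp add: powr_minus_divide)
      finally have "a powr (- q / (p - q)) = e / (2 * (i + 1))" .
      moreover have "e / (2 * d) * d = e / 2" if "d \<noteq> 0" for d :: real using that by simp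
      ultimately have "a powr (- q / (p - q)) * (i + 1) = e / 2" using i(2) by (metis add_nonneg_eq_0_iff zero_le_one zero_neq_one)
      moreover have "a powr (- q / (p - q)) * i \<le> a powr (- q / (p - q)) * (i + 1)"
        by (intro mult_left_mono) auto
      ultimately have ai: "a powr (- q / (p - q)) * i \<le> e / 2" by linarith
      show "\<exists>d>0. \<forall>u\<in>C0inf \<Omega>. energy s p u \<le> ennreal d \<longrightarrow> pint lborel q u \<le> ennreal e"
      proof (intro exI[where x = "e / (2 * a)"] conjI ballI impI)
        show "0 < e / (2 * a)" using e a by simp
        fix u assume u: "u \<in> C0inf \<Omega>" "energy s p u \<le> ennreal (e / (2 * a))"
        have "pint lborel q u \<le> ennreal a * energy s p u + ennreal (a powr (- q / (p - q))) * ennreal i"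
          by (rule keyU[OF u(1) a])
        also have "\<dots> \<le> ennreal a * ennreal (e / (2 * a)) + ennreal (a powr (- q / (p - q))) * ennreal i"
          using u(2) by (intro add_right_mono mult_left_mono) auto
        also have "\<dots> = ennreal (e / 2 + a powr (- q / (p - q)) * i)"
          using a e i by (simp flip: ennreal_mult ennreal_plus)
        also have "\<dots> \<le> ennreal e" using ai by (intro ennreal_leI) simp
        finally show "pint lborel q u \<le> ennreal e" .
      qed
    qed
  next
    show "Lq_bounded s p q \<Omega>"
      unfolding Lq_bounded_def
    proof (intro allI impI)
      fix E :: real assume E: "0 \<le> E"
      show "\<exists>Q\<ge>0. \<forall>u\<in>C0inf \<Omega>. energy s p u \<le> ennreal E \<longrightarrow> pint lborel q u \<le> ennreal Q"
      proof (intro exI[where x = "E + i"] conjI ballI impI)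
        show "0 \<le> E + i" using E i by simp
        fix u assume u: "u \<in> C0inf \<Omega>" "energy s p u \<le> ennreal E"
        have "pint lborel q u \<le> energy s p u + ennreal i" using keyU[OF u(1), of 1] by simp
        also have "\<dots> \<le> ennreal E + ennreal i" using u(2) by (intro add_right_mono)
        also have "\<dots> = ennreal (E + i)" using E i by simp
        finally show "pint lborel q u \<le> ennreal (E + i)" .
      qed
    qed
  next
    show "Lq_tight s p q \<Omega>"
      unfolding Lq_tight_def
    proof (intro allI impI)
      fix E e :: real assume E: "0 \<le> E" and e: "0 < e"
      define a where "a = e / (2 * (E + 1))"
      have a: "0 < a" "a * E \<le> e / 2" using e E by (auto simp: a_def field_simps)
      define c where "c = a powr (- q / (p - q))"
      have c: "0 < c" using a by (simp add: c_def)
      have "(\<lambda>n. emeasure \<nu> (- cball 0 (real n))) \<longlonglongrightarrow> emeasure \<nu> (\<Inter>n. - cball 0 (real n))"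
      proof (rule Lim_emeasure_decseq)
        show "range (\<lambda>n. - cball (0::'a) (real n)) \<subseteq> sets \<nu>" by (auto simp: \<nu>_def borel_closed)
        show "decseq (\<lambda>n. - cball (0::'a) (real n))" by (auto simp: decseq_def)
        fix n
        have "emeasure \<nu> (- cball 0 (real n)) \<le> ennreal i"
          unfolding i(1)[symmetric] by (intro emeasure_mono) (auto simp: \<nu>_def)
        then show "emeasure \<nu> (- cball 0 (real n)) \<noteq> \<infinity>" by (auto simp: top_unique)
      qed
      also have "(\<Inter>n. - cball (0::'a) (real n)) = {}"
      proof -
        have "x \<notin> (\<Inter>n. - cball (0::'a) (real n))" for x :: 'a
        proof -
          obtain n where "norm x \<le> real n" using real_arch_simple by blast
          then have "x \<in> cball 0 (real n)" by simp
          then show ?thesis by blast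
        qed
        then show ?thesis by blast
      qed
      finally have "(\<lambda>n. emeasure \<nu> (- cball 0 (real n))) \<longlonglongrightarrow> 0" by simp
      from order_tendstoD(2)[OF this, of "ennreal (e / (2 * c))"] e c
      obtain n where n: "emeasure \<nu> (- cball 0 (real n)) < ennreal (e / (2 * c))"
        by (auto simp: eventually_sequentially)
      show "\<exists>R. \<forall>u\<in>C0inf \<Omega>. energy s p u \<le> ennreal E \<longrightarrow>
          pint lborel q (\<lambda>x. indicator (- cball 0 R) x * u x) \<le> ennreal e"
      proof (intro exI[where x = "real n"] ballI impI)
        fix u assume u: "u \<in> C0inf \<Omega>" "energy s p u \<le> ennreal E"
        have "pint lborel q (\<lambda>x. indicator (- cball 0 (real n)) x * u x)
           \<le> ennreal a * energy s p u + ennreal c * emeasure \<nu> (- cball 0 (real n))"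
          unfolding c_def by (rule key[OF u(1) _ a(1)]) (simp add: borel_closed)
        also have "\<dots> \<le> ennreal a * ennreal E + ennreal c * ennreal (e / (2 * c))"
          using u(2) n by (intro add_mono mult_left_mono) auto
        also have "\<dots> = ennreal (a * E + e / 2)"
          using a c e E by (simp flip: ennreal_mult ennreal_plus)
        also have "\<dots> \<le> ennreal e" using a(2) by (intro ennreal_leI) simp
        finally show "pint lborel q (\<lambda>x. indicator (- cball 0 (real n)) x * u x) \<le> ennreal e" .
      qed
    qed
  qed
qed

text \<open>If the constant vanished, test functions with energy at most \<open>1\<close> could have arbitrarily large
  norm in \<open>L\<^sup>q\<close>, and no subsequence would converge.\<close>

lemma lambda_pos_of_compact_embedding:
  fixes \<Omega> :: "'a::euclidean_space set"
  assumes sp: "0 < s" "s < 1" "1 < p" and q: "1 \<le> q" and \<Omega>: "open \<Omega>"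
    and T: "compact_embedding s p q \<Omega>"
  shows "0 < lambda_pq s p q \<Omega>"
proof (rule ccontr)
  have p: "0 < p" using sp by simp
  have [measurable]: "\<Omega> \<in> sets borel" using \<Omega> by simp
  obtain T where T: "compact_operator s p q \<Omega> T"
    and Te: "\<And>u. u \<in> C0inf \<Omega> \<Longrightarrow> AE x in lborel. x \<in> \<Omega> \<longrightarrow> T (D0_embed s p \<Omega> u) x = u x"
    using T by (auto simp: compact_embedding_def)
  assume "\<not> 0 < lambda_pq s p q \<Omega>"
  then have z: "lambda_pq s p q \<Omega> = 0" by simp
  have "\<exists>u. u \<in> C0inf \<Omega> \<and> (LINT x:\<Omega>|lborel. \<bar>u x\<bar> powr q) = 1 \<and> energy s p u < ennreal ((1 / real (Suc n)) powr p)" for n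
  proof -
    have "lambda_pq s p q \<Omega> < ennreal ((1 / real (Suc n)) powr p)" by (simp add: z del: of_nat_Suc)
    then show ?thesis unfolding lambda_pq_def INF_less_iff by auto
  qed
  then obtain u where u: "\<And>n. u n \<in> C0inf \<Omega>" "\<And>n. (LINT x:\<Omega>|lborel. \<bar>u n x\<bar> powr q) = 1"
      "\<And>n. energy s p (u n) < ennreal ((1 / real (Suc n)) powr p)" by metis
  define v where "v n x = real (Suc n) * u n x" for n x
  have vC: "v n \<in> C0inf \<Omega>" for n unfolding v_def[abs_def] by (rule C0inf_cmult[OF u(1)])
  note [measurable] = C0inf_borel[OF u(1)] C0inf_borel[OF vC]
  have vg: "gnorm s p (v n) \<le> 1" for n
  proof -
    have "energy s p (v n) = ennreal (real (Suc n) powr p) * energy s p (u n)"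
      unfolding v_def[abs_def] using p by (simp add: energy_cmult del: of_nat_Suc)
    also have "\<dots> \<le> ennreal (real (Suc n) powr p) * ennreal ((1 / real (Suc n)) powr p)"
      using u(3) by (intro mult_left_mono less_imp_le) auto
    also have "\<dots> = 1" by (simp add: powr_divide del: of_nat_Suc flip: ennreal_mult)
    finally have "epowr (energy s p (v n)) (1/p) \<le> epowr 1 (1/p)" using p by (rule_tac epowr_mono) auto
    then show ?thesis using epowr_ennreal[of 1 "1/p"] by (simp add: gnorm_def)
  qed
  have pu: "pint lborel q (u n) = 1" for n
  proof -
    have i: "set_integrable lborel \<Omega> (\<lambda>x. \<bar>u n x\<bar> powr q)"
      using u(2)[of n] unfolding set_integrable_def set_lebesgue_integral_def
      by (metis not_integrable_integral_eq zero_neq_one)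
    have "(\<lambda>x. indicator \<Omega> x *\<^sub>R (\<bar>u n x\<bar> powr q)) = (\<lambda>x. \<bar>u n x\<bar> powr q)"
      using C0inf_zero_off[OF u(1)] by (auto simp: fun_eq_iff indicator_def)
    then have "integrable lborel (\<lambda>x. \<bar>u n x\<bar> powr q)" "(LINT x|lborel. \<bar>u n x\<bar> powr q) = 1"
      using i u(2)[of n] by (simp_all add: set_integrable_def set_lebesgue_integral_def)
    then show ?thesis unfolding pint_def by (subst nn_integral_eq_integral) auto
  qed
  have pv: "pint lborel q (v n) = ennreal (real (Suc n) powr q)" for n
    unfolding v_def[abs_def] by (subst pint_cmult) (auto simp: pu)
  define U where "U n = D0_embed s p \<Omega> (v n)" for n
  have UD: "U n \<in> D0 s p \<Omega>" for n unfolding U_def by (rule D0_embed_in_D0[OF vC])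
  have "D0_norm s p (U n) \<le> 1" for n using vg D0_norm_embed[OF sp vC] by (simp add: U_def)
  then have "(\<forall>n. U n \<in> D0 s p \<Omega>) \<and> (\<exists>C<\<infinity>. \<forall>n. D0_norm s p (U n) \<le> C)"
    using UD by (auto intro!: exI[of _ 1])
  then obtain k f where k: "strict_mono (k :: nat \<Rightarrow> nat)" "f \<in> Lq q \<Omega>" "(\<lambda>n. Lq_dist q \<Omega> (T (U (k n))) f) \<longlonglongrightarrow> 0"
    using T unfolding compact_operator_def by blast
  define g where "g x = indicator \<Omega> x * f x" for x
  have [measurable]: "g \<in> borel_measurable lborel"
    using k(2) by (simp add: Lq_def set_borel_measurable_def g_def[abs_def])
  have gf: "pint lborel q g < top"
    using k(2) by (simp add: Lq_def Lnorm_abs g_def[abs_def])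
  have "Lq_dist q \<Omega> (T (U n)) f = epowr (pint lborel q (\<lambda>x. v n x - g x)) (1/q)" for n
  proof -
    have "AE x in lborel. indicator \<Omega> x * (T (U n) x - f x) = v n x - g x"
      using Te[OF vC[of n]] by eventually_elim (use C0inf_zero_off[OF vC] in \<open>auto simp: U_def g_def indicator_def\<close>)
    then have "pint lborel q (\<lambda>x. indicator \<Omega> x * (T (U n) x - f x)) = pint lborel q (\<lambda>x. v n x - g x)"
      by (rule pint_cong_AE)
    then show ?thesis by (simp add: Lq_dist_eq)
  qed
  then have lim: "(\<lambda>n. pint lborel q (\<lambda>x. v (k n) x - g x)) \<longlonglongrightarrow> 0"
    using k(3) q by (simp add: epowr_tendsto_0_iff)
  define B where "B = ennreal (2 powr (q - 1)) * (1 + pint lborel q g)"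
  have "B < top" using gf by (simp add: B_def ennreal_mult_less_top)
  then obtain b where b: "B = ennreal b" "0 \<le> b" by (cases B) auto
  have "\<forall>\<^sub>F n in sequentially. pint lborel q (\<lambda>x. v (k n) x - g x) < 1"
    using order_tendstoD(2)[OF lim] by simp
  then have "\<forall>\<^sub>F n in sequentially. real n \<le> b"
  proof eventually_elim
    case (elim n)
    have "real n \<le> real (Suc (k n))" using seq_suble[OF k(1), of n] by simp
    also have "\<dots> \<le> real (Suc (k n)) powr q" using powr_mono[of 1 q "real (Suc (k n))"] q by simp
    finally have "ennreal (real n) \<le> pint lborel q (v (k n))" unfolding pv by (rule ennreal_leI)
    also have "\<dots> \<le> ennreal (2 powr (q - 1)) * (pint lborel q (\<lambda>x. v (k n) x - g x) + pint lborel q g)"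
      using pint_add_le[of "\<lambda>x. v (k n) x - g x" lborel g q] q by simp
    also have "\<dots> \<le> B" unfolding B_def using elim by (intro mult_left_mono add_right_mono) auto
    finally show ?case using b by simp
  qed
  then obtain N where N: "\<And>n. N \<le> n \<Longrightarrow> real n \<le> b" by (auto simp: eventually_sequentially)
  obtain m where "b < real m" using reals_Archimedean2 by blast
  then show False using N[of "N + m"] by simp
qed

theorem theorem1p3:
  fixes p q s :: real
    and \<Omega> :: "'a::euclidean_space set"
    and w :: "'a \<Rightarrow> ennreal"
  assumes "1 < p" and "1 \<le> q" and "q < p"
    and "0 < s" and "s < 1"
    and "open \<Omega>"
    and "torsion_function s p \<Omega> w"
  shows "(compact_embedding s p q \<Omega> \<longleftrightarrow> Lnorm ((p - 1) / (p - q) * q) \<Omega> w < \<infinity>) \<and>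
         (compact_embedding s p q \<Omega> \<longleftrightarrow> 0 < lambda_pq s p q \<Omega>)"
proof -
  have "Lnorm ((p - 1) / (p - q) * q) \<Omega> w < \<infinity>
      \<longleftrightarrow> (\<integral>\<^sup>+ x\<in>\<Omega>. epowr (w x) ((p - 1) / (p - q) * q) \<partial>lborel) < \<infinity>"
    by (simp add: Lnorm_def)
  moreover note compact_embedding_of_torsion_integrable[OF assms(4,5,1,2,3,6,7)]
    torsion_integrable_of_lambda_pos[OF assms(4,5,1,2,3,6,7)]
    lambda_pos_of_compact_embedding[OF assms(4,5,1,2,6)]
  ultimately show ?thesis by blast
qed

end
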